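(* In the metric of $\mathbb{H}(\mathbb{P}(\mathbb{X}))$, $$\lim_{V\to\infty}\tilde{\mathfrak{H}}_{V,1}=\tilde{\mathfrak{H}}.$$ If for each $V$ the probabilities satisfy $\mathcal{P}^{a}=\dfrac{P_{n_1}P_{n_2}\cdots P_{n_V}}{V^{MV}}$ for every $a\in\mathcal{A}$, then in the metric of $\mathbb{P}(\mathbb{P}(\mathbb{X}))$ $$\lim_{V\to\infty}\tilde{\mathfrak{P}}_{V,1}=\tilde{\mathfrak{P}}.$$
   Context: Spaces and metrics. For a compact metric space $Y$: $\mathbb{H}(Y)$ is the set of non-empty compact subsets of $Y$ with the Hausdorff metric; $\mathbb{P}(Y)$ is the set of Borel probability measures on $Y$ with the Monge–Kantorovitch metric $d(\mu,\nu)=\sup\{\int f\,d\mu-\int f\,d\nu\}$ over $f:Y\to\mathbb{R}$ with Lipschitz constant at most $1$. For $f:\mathbb{X}\to\mathbb{X}$, $f(\mu)=\mu\circ f^{-1}$. IFS. An IFS (with probabilities) on a compact metric space $Y$ is a finite family of contraction maps $g_a:Y\to Y$ together with probabilities $p_a\ge 0$, $\sum_a p_a=1$. Its set attractor is the unique non-empty compact $A\subset Y$ with $A=\bigcup_a g_a(A)$; its measure attractor is the unique Borel probability measure $\mu$ on $Y$ with $\mu=\sum_a p_a\, g_a(\mu)$, where $g(\mu)=\mu\circ g^{-1}$. SuperIFS. $(\mathbb{X},d)$ is a compact metric space; $M,N,V$ are positive integers. For $n\in\{1,\dots,N\}$, $m\in\{1,\dots,M\}$, $f_m^n:\mathbb{X}\to\mathbb{X}$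 is Lipschitz with constant $l$, where $0\le l<1$ is fixed, and $p_m^n\ge0$ with $\sum_{m=1}^Mp_m^n=1$ for each $n$. $P_1,\dots,P_N>0$ with $\sum_nP_n=1$. Random fractal measures. $T$ is the set of all finite sequences over $\{1,\dots,M\}$, including the empty sequence $\emptyset$. $\Omega$ is the set of all functions (code trees) $\sigma:T\to\{1,\dots,N\}$. $\rho$ is the probability measure on $\Omega$ (on the $\sigma$-algebra generated by cylinder sets) under which the random variables $\sigma(i)$, $i\in T$, are i.i.d. with $\Pr(\sigma(i)=n)=P_n$. For $\sigma\in\Omega$, $$\tilde{\mathcal{F}}(\sigma)=\lim_{k\to\infty}\ \sum_{i=i_1\cdots i_k\in T}p_{i_1}^{\sigma(\emptyset)}p_{i_2}^{\sigma(i_1)}\cdots p_{i_k}^{\sigma(i_1\cdots i_{k-1})}\;f_{i_1}^{\sigma(\emptyset)}\circ f_{i_2}^{\sigma(i_1)}\circ\cdots\circ f_{i_k}^{\sigma(i_1\cdots i_{k-1})}(\varsigma),$$ the limit existing in the Monge–Kantorovitch metric and being independent of $\varsigma\in\mathbb{P}(\mathbb{X})$. $\tilde{\mathfrak{H}}=\{\tilde{\mathcal{F}}(\sigma):\sigma\in\Omega\}$ is the set of fractal measures associated with the superIFS, and $\tilde{\mathfrak{P}}=\rho\circ\tilde{\mathcal{F}}^{-1}$ is the corresponding distribution. $V$-variable fractal measures. Write $\mathbb{P}=\mathbb{P}(\mathbb{X})$; $\mathbb{P}^V$ carries the maximum metric. $\mathcal{A}=\{\{1,\dots,N\}\times\{1,\dots,V\}^M\}^V$;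 write $a=(a_1,\dots,a_V)\in\mathcal{A}$ with $a_v=(n_v;v_{v,1},\dots,v_{v,M})$. $\{\mathcal{P}^a\}_{a\in\mathcal{A}}$ are probabilities. For $a\in\mathcal{A}$ define $f^a:\mathbb{P}^V\to\mathbb{P}^V$ by letting the $v$-th component of $f^a(\mu_1,\dots,\mu_V)$ be $\sum_{m=1}^M p_m^{n_v}f_m^{n_v}(\mu_{v_{v,m}})$. $\tilde{\mathcal{F}}_V=\{\mathbb{P}^V;f^a,\mathcal{P}^a,a\in\mathcal{A}\}$ is an IFS of contractions with set attractor $\tilde{\mathfrak{H}}_V$ and measure attractor $\tilde{\mathfrak{P}}_V$. $\tilde{\mathfrak{H}}_{V,1}\subset\mathbb{P}$ is the set of first components of elements of $\tilde{\mathfrak{H}}_V$, and $\tilde{\mathfrak{P}}_{V,1}(B)=\tilde{\mathfrak{P}}_V(B\times\mathbb{P}\times\cdots\times\mathbb{P})$ for Borel $B\subset\mathbb{P}$. *)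

theory Defs
  imports "HOL-Probability.Probability"
begin

text \<open>
  Metric spaces are given by a carrier \<open>S\<close> and a distance \<open>d\<close>, because the same constructions are
  applied to a space, to its space of probability measures, and to finite powers of the latter.
  The library's \<open>Metric_space S d\<close> asks for symmetry and nonnegativity of \<open>d\<close> on the whole type;
  the distances below are therefore set to \<open>0\<close> outside of their carriers.
\<close>

definition borel_on :: "'a set \<Rightarrow> ('a \<Rightarrow> 'a \<Rightarrow> real) \<Rightarrow> 'a measure" where
  "borel_on S d = sigma S {U. openin (Metric_space.mtopology S d) U}"

definition hyperspace :: "'a set \<Rightarrow> ('a \<Rightarrow> 'a \<Rightarrow> real) \<Rightarrow> 'a set set" where
  "hyperspace S d = {A. A \<noteq> {} \<and> compactin (Metric_space.mtopology S d) A}"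

definition hausdorff_dist ::
    "'a set \<Rightarrow> ('a \<Rightarrow> 'a \<Rightarrow> real) \<Rightarrow> 'a set \<Rightarrow> 'a set \<Rightarrow> real" where
  "hausdorff_dist S d A B =
     (if A \<in> hyperspace S d \<and> B \<in> hyperspace S d
      then max (SUP a\<in>A. INF b\<in>B. d a b) (SUP b\<in>B. INF a\<in>A. d b a) else 0)"

definition prob_measures :: "'a set \<Rightarrow> ('a \<Rightarrow> 'a \<Rightarrow> real) \<Rightarrow> 'a measure set" where
  "prob_measures S d = {\<mu>. prob_space \<mu> \<and> space \<mu> = S \<and> sets \<mu> = sets (borel_on S d)}"

definition MK_dist ::
    "'a set \<Rightarrow> ('a \<Rightarrow> 'a \<Rightarrow> real) \<Rightarrow> 'a measure \<Rightarrow> 'a measure \<Rightarrow> real" where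
  "MK_dist S d \<mu> \<nu> =
     (if \<mu> \<in> prob_measures S d \<and> \<nu> \<in> prob_measures S d
      then SUP f \<in> {f. \<forall>x\<in>S. \<forall>y\<in>S. \<bar>f x - f y\<bar> \<le> d x y}. (\<integral>x. f x \<partial>\<mu>) - (\<integral>x. f x \<partial>\<nu>)
      else 0)"

text \<open>The measure \<open>\<Sum>i\<in>I. w i * \<nu> i\<close> on the measurable space \<open>B\<close>.\<close>

definition mixture :: "'a measure \<Rightarrow> 'i set \<Rightarrow> ('i \<Rightarrow> real) \<Rightarrow> ('i \<Rightarrow> 'a measure) \<Rightarrow> 'a measure" where
  "mixture B I w \<nu> =
     measure_of (space B) (sets B) (\<lambda>E. \<Sum>i\<in>I. ennreal (w i) * emeasure (\<nu> i) E)"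


section \<open>Attractors of iterated function systems\<close>

definition set_attractor ::
    "'a set \<Rightarrow> ('a \<Rightarrow> 'a \<Rightarrow> real) \<Rightarrow> 'i set \<Rightarrow> ('i \<Rightarrow> 'a \<Rightarrow> 'a) \<Rightarrow> 'a set" where
  "set_attractor S d I g = (THE A. A \<in> hyperspace S d \<and> A = (\<Union>a\<in>I. g a ` A))"

definition measure_attractor ::
    "'a set \<Rightarrow> ('a \<Rightarrow> 'a \<Rightarrow> real) \<Rightarrow> 'i set \<Rightarrow> ('i \<Rightarrow> real) \<Rightarrow> ('i \<Rightarrow> 'a \<Rightarrow> 'a) \<Rightarrow> 'a measure" where
  "measure_attractor S d I w g =
     (THE \<mu>. \<mu> \<in> prob_measures S d \<and>
             \<mu> = mixture (borel_on S d) I w (\<lambda>a. distr \<mu> (borel_on S d) (g a)))"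


section \<open>Random fractal measures\<close>

text \<open>
  Throughout, \<open>f n m\<close> and \<open>p n m\<close> stand for $f_m^n$ and $p_m^n$. Finite sequences are lists;
  a list index is shifted by one, so that \<open>i ! j\<close> is $i_{j+1}$ and \<open>take j i\<close> is
  $i_1 \cdots i_j$.
\<close>

definition code_trees :: "nat \<Rightarrow> nat \<Rightarrow> (nat list \<Rightarrow> nat) set" where
  "code_trees M N = lists {1..M} \<rightarrow>\<^sub>E {1..N}"

definition code_tree_measure ::
    "nat \<Rightarrow> nat \<Rightarrow> (nat \<Rightarrow> real) \<Rightarrow> (nat list \<Rightarrow> nat) measure" where
  "code_tree_measure M N P =
     (\<Pi>\<^sub>M i\<in>lists {1..M}. point_measure {1..N} (\<lambda>n. ennreal (P n)))"

definition word_weight ::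
    "(nat \<Rightarrow> nat \<Rightarrow> real) \<Rightarrow> (nat list \<Rightarrow> nat) \<Rightarrow> nat list \<Rightarrow> real" where
  "word_weight p \<sigma> i = (\<Prod>j<length i. p (\<sigma> (take j i)) (i ! j))"

definition word_map ::
    "(nat \<Rightarrow> nat \<Rightarrow> 'a \<Rightarrow> 'a) \<Rightarrow> (nat list \<Rightarrow> nat) \<Rightarrow> nat list \<Rightarrow> 'a \<Rightarrow> 'a" where
  "word_map f \<sigma> i = foldr (\<lambda>j g. f (\<sigma> (take j i)) (i ! j) \<circ> g) [0..<length i] id"

definition fractal_approx ::
    "'a set \<Rightarrow> ('a \<Rightarrow> 'a \<Rightarrow> real) \<Rightarrow> nat \<Rightarrow> (nat \<Rightarrow> nat \<Rightarrow> 'a \<Rightarrow> 'a) \<Rightarrow> (nat \<Rightarrow> nat \<Rightarrow> real) \<Rightarrow>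
     (nat list \<Rightarrow> nat) \<Rightarrow> 'a measure \<Rightarrow> nat \<Rightarrow> 'a measure" where
  "fractal_approx X d M f p \<sigma> \<nu> k =
     mixture (borel_on X d) {i \<in> lists {1..M}. length i = k} (word_weight p \<sigma>)
       (\<lambda>i. distr \<nu> (borel_on X d) (word_map f \<sigma> i))"

definition fractal_measure ::
    "'a set \<Rightarrow> ('a \<Rightarrow> 'a \<Rightarrow> real) \<Rightarrow> nat \<Rightarrow> (nat \<Rightarrow> nat \<Rightarrow> 'a \<Rightarrow> 'a) \<Rightarrow> (nat \<Rightarrow> nat \<Rightarrow> real) \<Rightarrow>
     (nat list \<Rightarrow> nat) \<Rightarrow> 'a measure" where
  "fractal_measure X d M f p \<sigma> =
     (THE \<mu>. \<forall>\<nu>\<in>prob_measures X d.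
        limitin (Metric_space.mtopology (prob_measures X d) (MK_dist X d))
          (fractal_approx X d M f p \<sigma> \<nu>) \<mu> sequentially)"

definition fractal_measures ::
    "'a set \<Rightarrow> ('a \<Rightarrow> 'a \<Rightarrow> real) \<Rightarrow> nat \<Rightarrow> nat \<Rightarrow> (nat \<Rightarrow> nat \<Rightarrow> 'a \<Rightarrow> 'a) \<Rightarrow>
     (nat \<Rightarrow> nat \<Rightarrow> real) \<Rightarrow> 'a measure set" where
  "fractal_measures X d M N f p = fractal_measure X d M f p ` code_trees M N"

definition fractal_distribution ::
    "'a set \<Rightarrow> ('a \<Rightarrow> 'a \<Rightarrow> real) \<Rightarrow> nat \<Rightarrow> nat \<Rightarrow> (nat \<Rightarrow> nat \<Rightarrow> 'a \<Rightarrow> 'a) \<Rightarrow>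
     (nat \<Rightarrow> nat \<Rightarrow> real) \<Rightarrow> (nat \<Rightarrow> real) \<Rightarrow> 'a measure measure" where
  "fractal_distribution X d M N f p P =
     distr (code_tree_measure M N P) (borel_on (prob_measures X d) (MK_dist X d))
       (fractal_measure X d M f p)"


section \<open>\<open>V\<close>-variable fractal measures\<close>

definition prob_tuples ::
    "'a set \<Rightarrow> ('a \<Rightarrow> 'a \<Rightarrow> real) \<Rightarrow> nat \<Rightarrow> (nat \<Rightarrow> 'a measure) set" where
  "prob_tuples X d V = {1..V} \<rightarrow>\<^sub>E prob_measures X d"

definition tuple_dist ::
    "'a set \<Rightarrow> ('a \<Rightarrow> 'a \<Rightarrow> real) \<Rightarrow> nat \<Rightarrow> (nat \<Rightarrow> 'a measure) \<Rightarrow> (nat \<Rightarrow> 'a measure) \<Rightarrow> real" where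
  "tuple_dist X d V \<mu> \<nu> = (MAX v\<in>{1..V}. MK_dist X d (\<mu> v) (\<nu> v))"

text \<open>For \<open>a \<in> addresses M N V\<close>, \<open>fst (a v)\<close> is $n_v$ and \<open>snd (a v) m\<close> is $v_{v,m}$.\<close>

definition addresses :: "nat \<Rightarrow> nat \<Rightarrow> nat \<Rightarrow> (nat \<Rightarrow> nat \<times> (nat \<Rightarrow> nat)) set" where
  "addresses M N V = {1..V} \<rightarrow>\<^sub>E ({1..N} \<times> ({1..M} \<rightarrow>\<^sub>E {1..V}))"

definition tuple_map ::
    "'a set \<Rightarrow> ('a \<Rightarrow> 'a \<Rightarrow> real) \<Rightarrow> nat \<Rightarrow> (nat \<Rightarrow> nat \<Rightarrow> 'a \<Rightarrow> 'a) \<Rightarrow> (nat \<Rightarrow> nat \<Rightarrow> real) \<Rightarrow>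
     nat \<Rightarrow> (nat \<Rightarrow> nat \<times> (nat \<Rightarrow> nat)) \<Rightarrow> (nat \<Rightarrow> 'a measure) \<Rightarrow> nat \<Rightarrow> 'a measure" where
  "tuple_map X d M f p V a \<mu> =
     (\<lambda>v\<in>{1..V}. mixture (borel_on X d) {1..M} (p (fst (a v)))
        (\<lambda>m. distr (\<mu> (snd (a v) m)) (borel_on X d) (f (fst (a v)) m)))"

definition V_attractor ::
    "'a set \<Rightarrow> ('a \<Rightarrow> 'a \<Rightarrow> real) \<Rightarrow> nat \<Rightarrow> nat \<Rightarrow> (nat \<Rightarrow> nat \<Rightarrow> 'a \<Rightarrow> 'a) \<Rightarrow>
     (nat \<Rightarrow> nat \<Rightarrow> real) \<Rightarrow> nat \<Rightarrow> (nat \<Rightarrow> 'a measure) set" where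
  "V_attractor X d M N f p V =
     set_attractor (prob_tuples X d V) (tuple_dist X d V) (addresses M N V)
       (tuple_map X d M f p V)"

definition V_measure ::
    "'a set \<Rightarrow> ('a \<Rightarrow> 'a \<Rightarrow> real) \<Rightarrow> nat \<Rightarrow> nat \<Rightarrow> (nat \<Rightarrow> nat \<Rightarrow> 'a \<Rightarrow> 'a) \<Rightarrow>
     (nat \<Rightarrow> nat \<Rightarrow> real) \<Rightarrow> nat \<Rightarrow> ((nat \<Rightarrow> nat \<times> (nat \<Rightarrow> nat)) \<Rightarrow> real) \<Rightarrow>
     (nat \<Rightarrow> 'a measure) measure" where
  "V_measure X d M N f p V w =
     measure_attractor (prob_tuples X d V) (tuple_dist X d V) (addresses M N V) w
       (tuple_map X d M f p V)"

definition V_fractal_measures ::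
    "'a set \<Rightarrow> ('a \<Rightarrow> 'a \<Rightarrow> real) \<Rightarrow> nat \<Rightarrow> nat \<Rightarrow> (nat \<Rightarrow> nat \<Rightarrow> 'a \<Rightarrow> 'a) \<Rightarrow>
     (nat \<Rightarrow> nat \<Rightarrow> real) \<Rightarrow> nat \<Rightarrow> 'a measure set" where
  "V_fractal_measures X d M N f p V = (\<lambda>\<mu>. \<mu> 1) ` V_attractor X d M N f p V"

definition V_fractal_distribution ::
    "'a set \<Rightarrow> ('a \<Rightarrow> 'a \<Rightarrow> real) \<Rightarrow> nat \<Rightarrow> nat \<Rightarrow> (nat \<Rightarrow> nat \<Rightarrow> 'a \<Rightarrow> 'a) \<Rightarrow>
     (nat \<Rightarrow> nat \<Rightarrow> real) \<Rightarrow> nat \<Rightarrow> ((nat \<Rightarrow> nat \<times> (nat \<Rightarrow> nat)) \<Rightarrow> real) \<Rightarrow>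
     'a measure measure" where
  "V_fractal_distribution X d M N f p V w =
     distr (V_measure X d M N f p V w) (borel_on (prob_measures X d) (MK_dist X d)) (\<lambda>\<mu>. \<mu> 1)"

end

theory Submission
  imports Defs
begin

text \<open>
  Fractal measures satisfy \<open>F \<sigma> = (\<Sum>m. p n m * f n m (F \<sigma>\<^sub>m))\<close>, where \<open>n\<close> is the root label of \<open>\<sigma>\<close>
  and \<open>\<sigma>\<^sub>m\<close> are its subtrees, so that \<open>F \<sigma>\<close> and \<open>F \<tau>\<close> have distance at most \<open>l ^ k * D\<close> when
  \<open>\<sigma>\<close> and \<open>\<tau>\<close> agree on the words of length less than \<open>k\<close>. An infinite sequence of addresses
  assigns a code tree to every buffer \<open>v\<close>: start in \<open>v\<close>, follow the pointers given by the addresses and read off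
  the labels. By self-similarity the tuples \<open>(F \<sigma>\<^sub>v)\<^sub>v\<close> that arise in this way
  form the set attractor, and their law for independent addresses is the measure attractor.
  Both limits thus reduce to the labels of the short words of the tree of buffer 1. If \<open>V\<close> is
  large, these words are likely to use distinct buffers, and then their labels are independent
  with distribution \<open>P\<close>. For the sets only the positivity of these probabilities is needed.
  No completeness of the space of measures is used: \<open>F \<sigma>\<close> is the law of
  the limit point of a random walk down the tree.
\<close>

text \<open>The same constructions are applied to \<open>X\<close>, to its probability measures, to
  measures on these and to tuples, so they are developed for arbitrary bounded metric spaces; one
  bound \<open>D\<close> of the diameter serves on all levels. None of the derived spaces is shown
  to be compact. Compact sets of measures arise only as continuous images of code spaces, and an
  attractor is obtained by exhibiting an invariant object, contraction being used for uniqueness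
  alone. Compactness of \<open>X\<close> enters through its bounded diameter and through its
  completeness, which yields the limit points of the walks. The comparison of the two distributions
  rests on one-sided estimates: every pattern of labels on the short words has probability at least
  1 - \<epsilon> times its ideal value. Since both laws have total mass 1, no matching upper bound
  has to be proved. The set limit reuses the estimate as a probabilistic existence proof: an event
  of positive probability contains an address sequence with the prescribed labels. The weights are
  auxiliary there, because the set attractor does not depend on them.\<close>

locale bounded_metric = Metric_space S d for S :: "'a set" and d :: "'a \<Rightarrow> 'a \<Rightarrow> real" +
  fixes D :: real
  assumes bounded: "\<And>x y. x \<in> S \<Longrightarrow> y \<in> S \<Longrightarrow> d x y \<le> D"
    and D_nonneg: "0 \<le> D"
begin

abbreviation "\<B> \<equiv> borel_on S d"
abbreviation "\<P> \<equiv> prob_measures S d"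
abbreviation "MK \<equiv> MK_dist S d"

lemma opens_subset: "{U. openin mtopology U} \<subseteq> Pow S"
  using openin_subset by fastforce

lemma space_borel_on [simp]: "space \<B> = S"
  unfolding borel_on_def by (rule space_measure_of[OF opens_subset])

lemma sets_borel_on: "sets \<B> = sigma_sets S {U. openin mtopology U}"
  unfolding borel_on_def by (rule sets_measure_of[OF opens_subset])

lemma open_in_borel_on: "openin mtopology U \<Longrightarrow> U \<in> sets \<B>"
  unfolding sets_borel_on by auto

lemma measurable_borel_on:
  assumes "h \<in> space A \<rightarrow> S" "\<And>U. openin mtopology U \<Longrightarrow> h -` U \<inter> space A \<in> sets A"
  shows "h \<in> measurable A \<B>"
  unfolding borel_on_def using assms opens_subset by (intro measurable_measure_of) auto

section \<open>Lipschitz test functions and the Monge-Kantorovitch distance\<close>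

definition Lip :: "real \<Rightarrow> ('a \<Rightarrow> real) \<Rightarrow> bool" where
  "Lip c g \<longleftrightarrow> (\<forall>x\<in>S. \<forall>y\<in>S. \<bar>g x - g y\<bar> \<le> c * d x y)"

lemma LipD: "Lip c g \<Longrightarrow> x \<in> S \<Longrightarrow> y \<in> S \<Longrightarrow> \<bar>g x - g y\<bar> \<le> c * d x y"
  by (simp add: Lip_def)

lemma Lip_minus: "Lip c g \<Longrightarrow> Lip c (\<lambda>x. - g x)"
  unfolding Lip_def by (metis abs_minus_commute minus_diff_minus abs_minus_cancel)

lemma Lip_divide: "Lip c g \<Longrightarrow> c > 0 \<Longrightarrow> Lip 1 (\<lambda>x. g x / c)"
  unfolding Lip_def by (simp add: diff_divide_distrib[symmetric] field_simps)

lemma MK_eq: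
  "\<mu> \<in> \<P> \<Longrightarrow> \<nu> \<in> \<P> \<Longrightarrow> MK \<mu> \<nu> = (SUP f \<in> {f. Lip 1 f}. (\<integral>x. f x \<partial>\<mu>) - (\<integral>x. f x \<partial>\<nu>))"
  by (simp add: MK_dist_def Lip_def)

lemma open_preimage_lipschitz:
  assumes "Metric_space S' d'" "g \<in> S \<rightarrow> S'" 
    and "\<And>x y. x \<in> S \<Longrightarrow> y \<in> S \<Longrightarrow> d' (g x) (g y) \<le> c * d x y"
    and U: "openin (Metric_space.mtopology S' d') U"
  shows "openin mtopology (g -` U \<inter> S)"
  unfolding openin_mtopology
proof (intro conjI allI impI)
  interpret S': Metric_space S' d' by fact
  fix x assume x: "x \<in> g -` U \<inter> S"
  then obtain r where r: "r > 0" "S'.mball (g x) r \<subseteq> U"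
    using U unfolding S'.openin_mtopology by blast
  \<comment> \<open>The constant \<open>c\<close> may be zero or negative, so it is enlarged to a
    positive one before the radius is divided by it.\<close>
  have c: "d' (g x) (g y) \<le> (\<bar>c\<bar> + 1) * d x y" if "y \<in> S" for y
    using order_trans[OF assms(3)[of x y] mult_right_mono[of c "\<bar>c\<bar> + 1" "d x y"]] x that by auto
  have "mball x (r / (\<bar>c\<bar> + 1)) \<subseteq> g -` U \<inter> S"
  proof
    fix y assume y: "y \<in> mball x (r / (\<bar>c\<bar> + 1))"
    then have "(\<bar>c\<bar> + 1) * d x y < r" by (simp add: pos_less_divide_eq mult.commute)
    then have "g y \<in> S'.mball (g x) r"
      using y c[of y] x assms(2) by auto
    then show "y \<in> g -` U \<inter> S" using r y by auto
  qed
  moreover have "r / (\<bar>c\<bar> + 1) > 0" using r by (simp add: add_nonneg_pos)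
  ultimately show "\<exists>r>0. mball x r \<subseteq> g -` U \<inter> S" by blast
qed auto

lemma Lip_measurable:
  assumes "Lip c g"
  shows "g \<in> borel_measurable \<B>"
proof (rule borel_measurableI)
  fix U :: "real set" assume "open U"
  then have "openin mtopology (g -` U \<inter> S)"
    using assms
    by (intro open_preimage_lipschitz[OF Met_TC.Metric_space_axioms, of _ c])
      (auto simp: Lip_def dist_real_def)
  then show "g -` U \<inter> space \<B> \<in> sets \<B>" by (simp add: open_in_borel_on)
qed

lemma lipschitz_measurable:
  assumes "bounded_metric S' d' D'" "g \<in> S \<rightarrow> S'" 
    and "\<And>x y. x \<in> S \<Longrightarrow> y \<in> S \<Longrightarrow> d' (g x) (g y) \<le> c * d x y"
  shows "g \<in> measurable \<B> (borel_on S' d')"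
proof -
  interpret S': bounded_metric S' d' D' by fact
  show ?thesis
    using assms open_preimage_lipschitz[OF S'.Metric_space_axioms assms(2,3)]
    by (intro S'.measurable_borel_on) (auto simp: open_in_borel_on)
qed

lemma prob_measuresD:
  assumes "\<mu> \<in> \<P>"
  shows "prob_space \<mu>" "space \<mu> = S" "sets \<mu> = sets \<B>"
  using assms by (auto simp: prob_measures_def)

lemma measurable_prob_measures: "\<mu> \<in> \<P> \<Longrightarrow> measurable \<mu> A = measurable \<B> A"
  by (rule measurable_cong_sets) (auto simp: prob_measuresD)

lemma distr_prob_measures:
  assumes "prob_space A" "g \<in> measurable A \<B>"
  shows "distr A \<B> g \<in> \<P>"
  using assms by (auto simp: prob_measures_def prob_space.prob_space_distr)

lemma Lip_bounded:
  assumes "Lip c g" "c \<ge> 0" "x \<in> S" "y \<in> S"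
  shows "\<bar>g x - g y\<bar> \<le> c * D"
  using LipD[OF assms(1,3,4)] mult_left_mono[OF bounded[OF assms(3,4)] assms(2)] by simp

lemma Lip_integrable:
  assumes "Lip c g" "c \<ge> 0" "\<mu> \<in> \<P>"
  shows "integrable \<mu> g"
proof -
  interpret prob_space \<mu> using assms(3) by (rule prob_measuresD)
  obtain x0 where x0: "x0 \<in> S" using not_empty prob_measuresD(2)[OF assms(3)] by auto
  have "norm (g x) \<le> c * D + \<bar>g x0\<bar>" if "x \<in> S" for x
    using Lip_bounded[OF assms(1,2) that x0] by auto
  then show ?thesis
    using assms Lip_measurable[OF assms(1)]
    by (intro integrable_const_bound[where B = "c * D + \<bar>g x0\<bar>"])
      (auto simp: measurable_prob_measures prob_measuresD intro!: AE_I2)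
qed

text \<open>Any two values of \<open>g\<close> differ by at most \<open>D\<close>, hence so do any
  two averages: integrate first over \<open>\<mu>\<close>, then over \<open>\<nu>\<close>. This
  bounds the set whose supremum is the distance, without which that supremum would carry no
  information.\<close>

lemma integral_Lip_diff_le:
  assumes "Lip 1 g" "\<mu> \<in> \<P>" "\<nu> \<in> \<P>"
  shows "(\<integral>x. g x \<partial>\<mu>) - (\<integral>x. g x \<partial>\<nu>) \<le> D"
proof -
  interpret m: prob_space \<mu> using assms(2) by (rule prob_measuresD)
  interpret n: prob_space \<nu> using assms(3) by (rule prob_measuresD)
  have "(\<integral>x. g x \<partial>\<mu>) - D \<le> g y" if "y \<in> S" for y
  proof -
    have "(\<integral>x. g x \<partial>\<mu>) \<le> (\<integral>x. g y + D \<partial>\<mu>)"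
      using Lip_integrable[OF assms(1) _ assms(2)] Lip_bounded[OF assms(1) _ _ that]
      by (intro integral_mono) (force simp: prob_measuresD(2)[OF assms(2)])+
    then show ?thesis by (simp add: m.prob_space)
  qed
  then have "(\<integral>x. (\<integral>x. g x \<partial>\<mu>) - D \<partial>\<nu>) \<le> (\<integral>x. g x \<partial>\<nu>)"
    using Lip_integrable[OF assms(1) _ assms(3)]
    by (intro integral_mono) (auto simp: prob_measuresD(2)[OF assms(3)])
  then show ?thesis by (simp add: n.prob_space)
qed

lemma integral_diff_le_MK:
  assumes "Lip 1 g" "\<mu> \<in> \<P>" "\<nu> \<in> \<P>"
  shows "(\<integral>x. g x \<partial>\<mu>) - (\<integral>x. g x \<partial>\<nu>) \<le> MK \<mu> \<nu>"
  unfolding MK_eq[OF assms(2,3)]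
  using assms integral_Lip_diff_le by (intro cSUP_upper bdd_aboveI2[where M = D]) auto

lemma Lip_const: "c \<ge> 0 \<Longrightarrow> Lip c (\<lambda>x. a)"
  by (simp add: Lip_def)

lemma MK_le:
  assumes "\<mu> \<in> \<P>" "\<nu> \<in> \<P>" "\<And>g. Lip 1 g \<Longrightarrow> (\<integral>x. g x \<partial>\<mu>) - (\<integral>x. g x \<partial>\<nu>) \<le> c"
  shows "MK \<mu> \<nu> \<le> c"
  unfolding MK_eq[OF assms(1,2)]
  using assms(3) Lip_const[of 1 0] by (intro cSUP_least) auto

lemma MK_bounded: "\<mu> \<in> \<P> \<Longrightarrow> \<nu> \<in> \<P> \<Longrightarrow> MK \<mu> \<nu> \<le> D"
  by (rule MK_le) (auto simp: integral_Lip_diff_le)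

lemma integral_diff_le_Lip:
  assumes "Lip c g" "c > 0" "\<mu> \<in> \<P>" "\<nu> \<in> \<P>"
  shows "(\<integral>x. g x \<partial>\<mu>) - (\<integral>x. g x \<partial>\<nu>) \<le> c * MK \<mu> \<nu>"
  using integral_diff_le_MK[OF Lip_divide[OF assms(1,2)] assms(3,4)] assms(2)
  by (simp add: diff_divide_distrib[symmetric] field_simps)

text \<open>Constant test functions give the bound on probability measures; elsewhere the distance
  has the default value 0.\<close>

lemma MK_nonneg: "0 \<le> MK \<mu> \<nu>"
  using integral_diff_le_MK[OF Lip_const[of 1 0], of \<mu> \<nu>]
  by (cases "\<mu> \<in> \<P> \<and> \<nu> \<in> \<P>") (auto simp: MK_dist_def)

lemma MK_commute: "MK \<mu> \<nu> = MK \<nu> \<mu>"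
proof -
  have "MK \<mu> \<nu> \<le> MK \<nu> \<mu>" if "\<mu> \<in> \<P>" "\<nu> \<in> \<P>" for \<mu> \<nu>
    using integral_diff_le_MK[OF Lip_minus that(2,1)] that by (intro MK_le) auto
  then show ?thesis
    by (cases "\<mu> \<in> \<P> \<and> \<nu> \<in> \<P>") (auto simp: MK_dist_def[of S d] intro: antisym)
qed

lemma MK_triangle:
  assumes "\<mu> \<in> \<P>" "\<nu> \<in> \<P>" "\<kappa> \<in> \<P>"
  shows "MK \<mu> \<kappa> \<le> MK \<mu> \<nu> + MK \<nu> \<kappa>"
  using integral_diff_le_MK[OF _ assms(1,2)] integral_diff_le_MK[OF _ assms(2,3)] assms
  by (intro MK_le) (auto, smt (verit))

text \<open>Open sets are increasing limits of the Lipschitz functions \<open>min 1 (n * d x (S - U))\<close>, so the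
  integrals of Lipschitz functions determine a Borel measure.\<close>

lemma Lipschitz_approx_open:
  assumes U: "openin mtopology U"
  obtains h where "\<And>n::nat. Lip (real n) (h n)" "\<And>n x. x \<in> S \<Longrightarrow> 0 \<le> h n x \<and> h n x \<le> 1"
    "\<And>x. x \<in> S \<Longrightarrow> (\<lambda>n. h n x) \<longlonglongrightarrow> indicat_real U x"
proof (cases "S - U = {}")
  \<comment> \<open>The distance to an empty complement would be an infimum over the empty set,
    hence the constant function.\<close>
  case True
  then show ?thesis
    by (intro that[of "\<lambda>n x. 1"]) (use True in \<open>auto simp: Lip_const indicator_def\<close>)
next
  case False
  define \<delta> where "\<delta> x = (INF y\<in>S - U. d x y)" for x
  have bdd: "bdd_below ((\<lambda>y. d x y) ` (S - U))" for x by (rule bdd_belowI2[where m = 0]) auto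
  have \<delta>_nonneg: "\<delta> x \<ge> 0" for x unfolding \<delta>_def using False by (intro cINF_greatest) auto
  have \<delta>1: "\<delta> x - \<delta> y \<le> d x y" if "x \<in> S" "y \<in> S" for x y
  proof -
    have "\<delta> x - d x y \<le> d y z" if z: "z \<in> S - U" for z
      using cINF_lower[OF bdd z, of x] triangle[of x y z] \<open>x \<in> S\<close> \<open>y \<in> S\<close> z unfolding \<delta>_def by auto
    then have "\<delta> x - d x y \<le> \<delta> y" 
      unfolding \<delta>_def[of y] using False by (intro cINF_greatest) auto
    then show ?thesis by simp
  qed
  then have \<delta>_lip: "\<bar>\<delta> x - \<delta> y\<bar> \<le> d x y" if "x \<in> S" "y \<in> S" for x y
    using that commute[of x y] by (smt (verit))
  have \<delta>_0: "\<delta> x = 0" if "x \<in> S - U" for x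
    using cINF_lower[OF bdd that, of x] \<delta>_nonneg[of x] that unfolding \<delta>_def by auto
  have \<delta>_pos: "\<delta> x > 0" if x: "x \<in> U" for x
  proof -
    obtain r where r: "r > 0" "mball x r \<subseteq> U" using x U unfolding openin_mtopology by blast
    have xS: "x \<in> S" using x U openin_subset by fastforce
    have "r \<le> d x z" if "z \<in> S - U" for z 
      using r(2) that xS by (auto simp: subset_iff not_less[symmetric])
    then have "r \<le> \<delta> x" unfolding \<delta>_def using False by (intro cINF_greatest) auto
    then show ?thesis using r by simp
  qed
  show ?thesis
  proof (rule that[of "\<lambda>n x. min 1 (real n * \<delta> x)"])
    fix n :: nat
    have "\<bar>min 1 (real n * a) - min 1 (real n * b)\<bar> \<le> real n * \<bar>a - b\<bar>" for a b :: real
    proof -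
      have "\<bar>min 1 (real n * a) - min 1 (real n * b)\<bar> \<le> \<bar>real n * a - real n * b\<bar>" by auto
      also have "\<dots> = real n * \<bar>a - b\<bar>"
        by (metis abs_mult abs_of_nat right_diff_distrib)
      finally show ?thesis .
    qed
    then show "Lip (real n) (\<lambda>x. min 1 (real n * \<delta> x))"
      unfolding Lip_def using \<delta>_lip by (meson mult_left_mono of_nat_0_le_iff order_trans)
  next
    fix n x show "0 \<le> min 1 (real n * \<delta> x) \<and> min 1 (real n * \<delta> x) \<le> 1"
      using \<delta>_nonneg by auto
  next
    fix x assume "x \<in> S"
    show "(\<lambda>n. min 1 (real n * \<delta> x)) \<longlonglongrightarrow> indicat_real U x"
    proof (cases "x \<in> U")
      case True
      have "\<forall>\<^sub>F n in sequentially. min 1 (real n * \<delta> x) = 1"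
      proof -
        obtain n0 where "1 \<le> real n0 * \<delta> x" 
          using \<delta>_pos[OF True] by (metis less_imp_le mult.commute reals_Archimedean3)
        then have "1 \<le> real n * \<delta> x" if "n \<ge> n0" for n 
          using that \<delta>_nonneg[of x] by (meson mult_right_mono of_nat_le_iff order_trans)
        then show ?thesis unfolding eventually_sequentially by (intro exI[of _ n0]) simp
      qed
      then show ?thesis using True by (simp add: tendsto_eventually)
    next
      case False
      then show ?thesis using \<delta>_0 \<open>x \<in> S\<close> by simp
    qed
  qed
qed

text \<open>One-sided inequalities suffice because \<open>- g\<close> is a test function together
  with \<open>g\<close>. Rescaling passes to all Lipschitz constants, dominated convergence to open
  sets, and these form an intersection-stable generator.\<close>

lemma measure_eqI_Lip:
  assumes "\<mu> \<in> \<P>" "\<nu> \<in> \<P>" "\<And>g. Lip 1 g \<Longrightarrow> (\<integral>x. g x \<partial>\<mu>) \<le> (\<integral>x. g x \<partial>\<nu>)"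
  shows "\<mu> = \<nu>"
proof -
  interpret m: prob_space \<mu> using assms(1) by (rule prob_measuresD)
  interpret n: prob_space \<nu> using assms(2) by (rule prob_measuresD)
  have eq1: "(\<integral>x. g x \<partial>\<mu>) = (\<integral>x. g x \<partial>\<nu>)" if "Lip 1 g" for g
    using assms(3)[OF that] assms(3)[OF Lip_minus[OF that]] by simp
  have eqc: "(\<integral>x. g x \<partial>\<mu>) = (\<integral>x. g x \<partial>\<nu>)" if "Lip (real n) g" for g n
  proof -
    \<comment> \<open>\<open>Suc n\<close> in place of \<open>n\<close>, because rescaling divides
      by the constant.\<close>
    have "Lip (real (Suc n)) g"
      using that unfolding Lip_def by (smt (verit) mult_right_mono nonneg of_nat_Suc)
    then show ?thesis using eq1[OF Lip_divide, of "real (Suc n)" g] by simp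
  qed
  have eqU: "emeasure \<mu> U = emeasure \<nu> U" if U: "openin mtopology U" for U
  proof -
    obtain h where h: "\<And>n::nat. Lip (real n) (h n)" "\<And>n x. x \<in> S \<Longrightarrow> 0 \<le> h n x \<and> h n x \<le> 1"
      "\<And>x. x \<in> S \<Longrightarrow> (\<lambda>n. h n x) \<longlonglongrightarrow> indicat_real U x"
      using Lipschitz_approx_open[OF U] by metis
    have "(\<lambda>n. \<integral>x. h n x \<partial>\<kappa>) \<longlonglongrightarrow> measure \<kappa> U" if "\<kappa> \<in> \<P>" for \<kappa>
    proof -
      interpret k: prob_space \<kappa> using that by (rule prob_measuresD)
      have Us: "U \<in> sets \<kappa>" using open_in_borel_on[OF U] that by (simp add: prob_measuresD)
      have "(\<lambda>n. \<integral>x. h n x \<partial>\<kappa>) \<longlonglongrightarrow> (\<integral>x. indicat_real U x \<partial>\<kappa>)"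
      proof (rule integral_dominated_convergence[where w = "\<lambda>x. 1"])
        show "h n \<in> borel_measurable \<kappa>" for n
          using Lip_measurable[OF h(1)] that by (simp add: measurable_prob_measures)
        show "AE x in \<kappa>. (\<lambda>n. h n x) \<longlonglongrightarrow> indicat_real U x"
          using h(3) that by (intro AE_I2) (simp add: prob_measuresD)
        show "AE x in \<kappa>. norm (h n x) \<le> 1" for n
          using h(2) that by (intro AE_I2) (simp add: prob_measuresD)
      qed (use Us in auto)
      then show ?thesis using Us sets.sets_into_space[OF Us] by (simp add: Int_absorb2)
    qed
    then have "measure \<mu> U = measure \<nu> U"
      using assms(1,2) eqc[OF h(1)] by (metis (no_types, lifting) LIMSEQ_unique ext)
    then show ?thesis by (simp add: m.emeasure_eq_measure n.emeasure_eq_measure)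
  qed
  show ?thesis
  proof (rule measure_eqI_generator_eq[where E = "{U. openin mtopology U}" and \<Omega> = S and A = "\<lambda>_. S"])
    show "Int_stable {U. openin mtopology U}" by (auto simp: Int_stable_def)
    show "{U. openin mtopology U} \<subseteq> Pow S" by (rule opens_subset)
    show "sets \<mu> = sigma_sets S {U. openin mtopology U}" "sets \<nu> = sigma_sets S {U. openin mtopology U}"
      using assms by (simp_all add: prob_measuresD sets_borel_on)
  qed (auto simp: eqU)
qed

text \<open>The measures inherit the bound \<open>D\<close>, so the locale can be interpreted again
  on them and on the measures over them. That distance 0 forces equality is the content of
  \<open>measure_eqI_Lip\<close>.\<close>

lemma bounded_metric_MK: "bounded_metric \<P> MK D"
proof unfold_locales
  fix \<mu> \<nu> assume "\<mu> \<in> \<P>" "\<nu> \<in> \<P>"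
  moreover have "\<mu> = \<nu>" if "MK \<mu> \<nu> = 0" "\<mu> \<in> \<P>" "\<nu> \<in> \<P>" for \<mu> \<nu>
    using integral_diff_le_MK[of _ \<mu> \<nu>] that by (intro measure_eqI_Lip) auto
  moreover have "MK \<mu> \<mu> \<le> 0" if "\<mu> \<in> \<P>" for \<mu> using that by (intro MK_le) auto
  ultimately show "MK \<mu> \<nu> = 0 \<longleftrightarrow> \<mu> = \<nu>" using MK_nonneg by (metis order_antisym)
qed (auto simp: MK_nonneg MK_commute MK_triangle MK_bounded D_nonneg)


text \<open>A test function composed with a \<open>c\<close>-Lipschitz map has Lipschitz constant
  \<open>c\<close>; dividing it by \<open>c\<close> gives a test function again.\<close>

lemma MK_distr_distr_le:
  assumes "bounded_metric S' d' D'" "g \<in> S \<rightarrow> S'" "c > 0"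
    and "\<And>x y. x \<in> S \<Longrightarrow> y \<in> S \<Longrightarrow> d' (g x) (g y) \<le> c * d x y"
    and "\<mu> \<in> \<P>" "\<nu> \<in> \<P>"
  shows "MK_dist S' d' (distr \<mu> (borel_on S' d') g) (distr \<nu> (borel_on S' d') g) \<le> c * MK \<mu> \<nu>"
proof -
  interpret S': bounded_metric S' d' D' by fact
  have g: "g \<in> measurable \<kappa> (borel_on S' d')" if "\<kappa> \<in> \<P>" for \<kappa>
    using lipschitz_measurable[OF assms(1,2,4)] that by (simp add: measurable_prob_measures)
  show ?thesis
  proof (rule S'.MK_le)
    fix h assume h: "S'.Lip 1 h"
    have "Lip c (\<lambda>x. h (g x))"
      unfolding Lip_def
    proof (intro ballI)
      fix x y assume xy: "x \<in> S" "y \<in> S"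
      then have "\<bar>h (g x) - h (g y)\<bar> \<le> 1 * d' (g x) (g y)" using assms(2) by (intro S'.LipD[OF h]) auto
      then show "\<bar>h (g x) - h (g y)\<bar> \<le> c * d x y" using assms(4)[OF xy] by simp
    qed
    from integral_diff_le_Lip[OF this assms(3,5,6)]
    show "(\<integral>x. h x \<partial>distr \<mu> (borel_on S' d') g) - (\<integral>x. h x \<partial>distr \<nu> (borel_on S' d') g) \<le> c * MK \<mu> \<nu>"
      using g assms(5,6) S'.Lip_measurable[OF h] by (simp add: integral_distr)
  qed (use g assms(5,6) in \<open>auto intro!: S'.distr_prob_measures prob_measuresD\<close>)
qed

text \<open>A coupling bound: random points on one probability space that are always within
  \<open>e\<close> of each other have laws within \<open>e\<close>. Convergence of points thus
  becomes convergence of measures.\<close>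

lemma MK_distr_le:
  assumes "prob_space A" "h \<in> measurable A \<B>" "h' \<in> measurable A \<B>"
    and "\<And>x. x \<in> space A \<Longrightarrow> d (h x) (h' x) \<le> e"
  shows "MK (distr A \<B> h) (distr A \<B> h') \<le> e"
proof (rule MK_le)
  interpret prob_space A by fact
  fix g assume g: "Lip 1 g"
  have int: "integrable A (\<lambda>x. g (k x))" if "k \<in> measurable A \<B>" for k
    using Lip_integrable[OF g, of "distr A \<B> k"] that assms(1) distr_prob_measures[OF assms(1) that]
      Lip_measurable[OF g] by (simp add: integrable_distr_eq)
  have "(\<integral>x. g (h x) \<partial>A) - (\<integral>x. g (h' x) \<partial>A) = (\<integral>x. g (h x) - g (h' x) \<partial>A)"
    using int assms by simp
  also have "\<dots> \<le> (\<integral>x. e \<partial>A)"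
  proof (intro integral_mono)
    fix x assume x: "x \<in> space A"
    then have "h x \<in> S" "h' x \<in> S" 
      using measurable_space[OF assms(2)] measurable_space[OF assms(3)] by auto
    then show "g (h x) - g (h' x) \<le> e" using LipD[OF g, of "h x" "h' x"] assms(4)[OF x] by auto
  qed (use int assms in auto)
  finally show "(\<integral>x. g x \<partial>distr A \<B> h) - (\<integral>x. g x \<partial>distr A \<B> h') \<le> e"
    using assms Lip_measurable[OF g] by (simp add: integral_distr prob_space)
qed (use assms in \<open>auto intro: distr_prob_measures\<close>)

end

subsection \<open>Mixtures\<close>

lemma space_mixture [simp]: "space (mixture B I w \<nu>) = space B"
  unfolding mixture_def by (rule space_measure_of) (rule sets.space_closed)

lemma sets_mixture [simp, measurable_cong]: "sets (mixture B I w \<nu>) = sets B"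
  unfolding mixture_def by (simp add: sets.space_closed sets.sigma_sets_eq)

lemma mixture_cong:
  assumes "\<And>i. i \<in> I \<Longrightarrow> w i = w' i" "\<And>i. i \<in> I \<Longrightarrow> \<nu> i = \<nu>' i"
  shows "mixture B I w \<nu> = mixture B I w' \<nu>'"
  unfolding mixture_def using assms by (simp cong: sum.cong)

text \<open>\<open>measure_of\<close> takes the prescribed values only if they are countably
  additive, which follows by exchanging the two sums.\<close>

lemma emeasure_mixture:
  fixes B :: "'b measure"
  assumes "\<And>i. i \<in> I \<Longrightarrow> sets (\<nu> i) = sets B" "E \<in> sets B"
  shows "emeasure (mixture B I w \<nu>) E = (\<Sum>i\<in>I. ennreal (w i) * emeasure (\<nu> i) E)"
proof (rule emeasure_measure_of[OF mixture_def])
  show "countably_additive (sets (mixture B I w \<nu>)) (\<lambda>E. \<Sum>i\<in>I. ennreal (w i) * emeasure (\<nu> i) E)"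
  proof (rule countably_additiveI)
    fix F :: "nat \<Rightarrow> 'b set"
    assume F: "range F \<subseteq> sets (mixture B I w \<nu>)" "disjoint_family F"
    have "(\<Sum>n. \<Sum>i\<in>I. ennreal (w i) * emeasure (\<nu> i) (F n))
        = (\<Sum>i\<in>I. \<Sum>n. ennreal (w i) * emeasure (\<nu> i) (F n))"
      by (rule suminf_sum) simp
    also have "\<dots> = (\<Sum>i\<in>I. ennreal (w i) * emeasure (\<nu> i) (\<Union>n. F n))"
      using F assms(1) by (intro sum.cong) (auto simp: ennreal_suminf_cmult suminf_emeasure)
    finally show "(\<Sum>n. \<Sum>i\<in>I. ennreal (w i) * emeasure (\<nu> i) (F n))
        = (\<Sum>i\<in>I. ennreal (w i) * emeasure (\<nu> i) (\<Union>n. F n))" .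
  qed
qed (use assms in \<open>auto simp: positive_def sets.space_closed\<close>)

lemma prob_space_mixture:
  assumes "\<And>i. i \<in> I \<Longrightarrow> sets (\<nu> i) = sets B" "\<And>i. i \<in> I \<Longrightarrow> prob_space (\<nu> i)"
    "\<And>i. i \<in> I \<Longrightarrow> w i \<ge> 0" "sum w I = 1"
  shows "prob_space (mixture B I w \<nu>)"
proof
  have "emeasure (\<nu> i) (space B) = 1" if "i \<in> I" for i
    using prob_space.emeasure_space_1[OF assms(2)[OF that]] sets_eq_imp_space_eq[OF assms(1)[OF that]]
    by simp
  then have "emeasure (mixture B I w \<nu>) (space B) = (\<Sum>i\<in>I. ennreal (w i))"
    using assms(1) by (subst emeasure_mixture) auto
  then show "emeasure (mixture B I w \<nu>) (space (mixture B I w \<nu>)) = 1"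
    using assms(3,4) by (simp add: sum_ennreal)
qed

lemma nn_integral_mixture:
  assumes \<nu>: "\<And>i. i \<in> I \<Longrightarrow> sets (\<nu> i) = sets B" and "g \<in> borel_measurable B"
  shows "(\<integral>\<^sup>+x. g x \<partial>mixture B I w \<nu>) = (\<Sum>i\<in>I. ennreal (w i) * (\<integral>\<^sup>+x. g x \<partial>\<nu> i))"
  using assms(2)
proof (induction rule: borel_measurable_induct)
  case (cong f g)
  have "(\<integral>\<^sup>+x. f x \<partial>\<nu> i) = (\<integral>\<^sup>+x. g x \<partial>\<nu> i)" if "i \<in> I" for i
    using cong(3) sets_eq_imp_space_eq[OF \<nu>[OF that]] by (intro nn_integral_cong) auto
  moreover have "(\<integral>\<^sup>+x. f x \<partial>mixture B I w \<nu>) = (\<integral>\<^sup>+x. g x \<partial>mixture B I w \<nu>)"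
    using cong(3) by (intro nn_integral_cong) auto
  ultimately show ?case using cong by simp
next
  case (set A)
  then show ?case using \<nu> by (simp add: emeasure_mixture)
next
  case (mult u c)
  have "(\<integral>\<^sup>+x. c * u x \<partial>\<nu> i) = c * (\<integral>\<^sup>+x. u x \<partial>\<nu> i)" if "i \<in> I" for i
    using mult(2) \<nu>[OF that] by (intro nn_integral_cmult) (simp cong: measurable_cong_sets)
  then show ?case using mult by (simp add: nn_integral_cmult sum_distrib_left mult.left_commute)
next
  case (add u v)
  have "(\<integral>\<^sup>+x. v x + u x \<partial>\<nu> i) = (\<integral>\<^sup>+x. v x \<partial>\<nu> i) + (\<integral>\<^sup>+x. u x \<partial>\<nu> i)" if "i \<in> I" for i
    using add \<nu>[OF that] by (intro nn_integral_add) (simp_all cong: measurable_cong_sets)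
  then show ?case using add by (simp add: nn_integral_add sum.distrib distrib_left)
next
  case (seq U)
  have eq: "(\<integral>\<^sup>+x. (SUP n. U n) x \<partial>\<kappa>) = (SUP n. \<integral>\<^sup>+x. U n x \<partial>\<kappa>)" if "sets \<kappa> = sets B" for \<kappa>
    unfolding SUP_apply using seq that
    by (intro nn_integral_monotone_convergence_SUP) (simp_all cong: measurable_cong_sets)
  have inc: "incseq (\<lambda>n. \<integral>\<^sup>+x. U n x \<partial>\<kappa>)" for \<kappa>
    using seq by (auto intro!: incseq_SucI nn_integral_mono simp: incseq_Suc_iff le_fun_def)
  have "(\<integral>\<^sup>+x. (SUP n. U n) x \<partial>mixture B I w \<nu>) = (SUP n. \<Sum>i\<in>I. ennreal (w i) * (\<integral>\<^sup>+x. U n x \<partial>\<nu> i))"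
    unfolding eq[OF sets_mixture] by (simp only: seq.IH)
  also have "\<dots> = (\<Sum>i\<in>I. SUP n. ennreal (w i) * (\<integral>\<^sup>+x. U n x \<partial>\<nu> i))"
    using inc by (intro ennreal_SUP_sum) (auto simp: incseq_def intro!: mult_left_mono)
  also have "\<dots> = (\<Sum>i\<in>I. ennreal (w i) * (\<integral>\<^sup>+x. (SUP n. U n) x \<partial>\<nu> i))"
    using \<nu> by (intro sum.cong refl) (simp only: eq SUP_mult_left_ennreal)
  finally show ?case .
qed

text \<open>The formula for nonnegative functions is applied to the positive and the negative part;
  \<open>*\<close> and \<open>**\<close> treat one sign and are used for \<open>g\<close> and for
  \<open>- g\<close>.\<close>

lemma integral_mixture:
  fixes g :: "'a \<Rightarrow> real"
  assumes "finite I" and \<nu>: "\<And>i. i \<in> I \<Longrightarrow> sets (\<nu> i) = sets B" and w: "\<And>i. i \<in> I \<Longrightarrow> w i \<ge> 0"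
    and g: "g \<in> borel_measurable B" and int: "\<And>i. i \<in> I \<Longrightarrow> integrable (\<nu> i) g"
  shows "(\<integral>x. g x \<partial>mixture B I w \<nu>) = (\<Sum>i\<in>I. w i * (\<integral>x. g x \<partial>\<nu> i))"
proof -
  have *: "enn2real (\<integral>\<^sup>+x. ennreal (h x) \<partial>mixture B I w \<nu>)
      = (\<Sum>i\<in>I. w i * enn2real (\<integral>\<^sup>+x. ennreal (h x) \<partial>\<nu> i))"
    and **: "(\<integral>\<^sup>+x. ennreal (h x) \<partial>mixture B I w \<nu>) \<noteq> \<infinity>"
    if h: "h \<in> borel_measurable B" "\<And>i. i \<in> I \<Longrightarrow> integrable (\<nu> i) h" for h :: "'a \<Rightarrow> real"
  proof -
    have fin: "(\<integral>\<^sup>+x. ennreal (h x) \<partial>\<nu> i) < \<top>" if "i \<in> I" for i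
      using h(2)[OF that] by (simp add: real_integrable_def less_top)
    have eq: "(\<integral>\<^sup>+x. ennreal (h x) \<partial>mixture B I w \<nu>) = (\<Sum>i\<in>I. ennreal (w i) * (\<integral>\<^sup>+x. ennreal (h x) \<partial>\<nu> i))"
      using h \<nu> by (simp add: nn_integral_mixture)
    show "(\<integral>\<^sup>+x. ennreal (h x) \<partial>mixture B I w \<nu>) \<noteq> \<infinity>"
      unfolding eq using assms(1) by (auto simp: ennreal_mult_eq_top_iff dest!: fin)
    have "(\<Sum>i\<in>I. ennreal (w i) * (\<integral>\<^sup>+x. ennreal (h x) \<partial>\<nu> i))
        = (\<Sum>i\<in>I. ennreal (w i * enn2real (\<integral>\<^sup>+x. ennreal (h x) \<partial>\<nu> i)))"
      using fin w by (intro sum.cong) (auto simp: ennreal_mult)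
    also have "\<dots> = ennreal (\<Sum>i\<in>I. w i * enn2real (\<integral>\<^sup>+x. ennreal (h x) \<partial>\<nu> i))"
      using w by (intro sum_ennreal) auto
    finally show "enn2real (\<integral>\<^sup>+x. ennreal (h x) \<partial>mixture B I w \<nu>)
      = (\<Sum>i\<in>I. w i * enn2real (\<integral>\<^sup>+x. ennreal (h x) \<partial>\<nu> i))"
      unfolding eq using w by (simp add: sum_nonneg)
  qed
  have g': "(\<lambda>x. - g x) \<in> borel_measurable B" using g by simp
  have int': "integrable (mixture B I w \<nu>) g"
    using **[OF g int] **[OF g'] g int by (auto simp: real_integrable_def cong: measurable_cong_sets)
  have "(\<integral>x. g x \<partial>mixture B I w \<nu>) =
    (\<Sum>i\<in>I. w i * enn2real (\<integral>\<^sup>+x. ennreal (g x) \<partial>\<nu> i)) - (\<Sum>i\<in>I. w i * enn2real (\<integral>\<^sup>+x. ennreal (- g x) \<partial>\<nu> i))"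
    using int' *[OF g int] *[OF g'] int by (simp add: real_lebesgue_integral_def)
  also have "\<dots> = (\<Sum>i\<in>I. w i * (\<integral>x. g x \<partial>\<nu> i))"
    using int by (simp add: real_lebesgue_integral_def sum_subtractf right_diff_distrib)
  finally show ?thesis .
qed

lemma distr_mixture:
  assumes "\<And>i. i \<in> I \<Longrightarrow> sets (\<nu> i) = sets B" "g \<in> measurable B C"
  shows "distr (mixture B I w \<nu>) C g = mixture C I w (\<lambda>i. distr (\<nu> i) C g)"
proof (rule measure_eqI)
  fix E assume E: "E \<in> sets (distr (mixture B I w \<nu>) C g)"
  have "emeasure (distr (\<nu> i) C g) E = emeasure (\<nu> i) (g -` E \<inter> space B)" if "i \<in> I" for i
    using E assms(2) sets_eq_imp_space_eq[OF assms(1)[OF that]] assms(1)[OF that]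
    by (subst emeasure_distr) (auto cong: measurable_cong_sets)
  then show "emeasure (distr (mixture B I w \<nu>) C g) E = emeasure (mixture C I w (\<lambda>i. distr (\<nu> i) C g)) E"
    using E assms by (simp add: emeasure_distr emeasure_mixture measurable_sets cong: measurable_cong_sets)
qed simp

context bounded_metric
begin

lemma mixture_prob_measures:
  assumes "\<And>i. i \<in> I \<Longrightarrow> \<nu> i \<in> \<P>" "\<And>i. i \<in> I \<Longrightarrow> w i \<ge> 0" "sum w I = 1"
  shows "mixture \<B> I w \<nu> \<in> \<P>"
  using assms by (auto simp: prob_measures_def intro!: prob_space_mixture)

text \<open>Integrals are linear in the measure, so the distance of mixtures with common weights is
  at most the weighted mean of the distances.\<close>

lemma MK_mixture_le:
  assumes "finite I" "\<And>i. i \<in> I \<Longrightarrow> w i \<ge> 0" "sum w I = 1"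
    "\<And>i. i \<in> I \<Longrightarrow> \<nu> i \<in> \<P>" "\<And>i. i \<in> I \<Longrightarrow> \<nu>' i \<in> \<P>" "\<And>i. i \<in> I \<Longrightarrow> MK (\<nu> i) (\<nu>' i) \<le> e"
  shows "MK (mixture \<B> I w \<nu>) (mixture \<B> I w \<nu>') \<le> e"
proof (rule MK_le)
  fix g assume g: "Lip 1 g"
  have "(\<integral>x. g x \<partial>mixture \<B> I w \<nu>) - (\<integral>x. g x \<partial>mixture \<B> I w \<nu>')
      = (\<Sum>i\<in>I. w i * ((\<integral>x. g x \<partial>\<nu> i) - (\<integral>x. g x \<partial>\<nu>' i)))"
    using assms Lip_measurable[OF g] Lip_integrable[OF g]
    by (simp add: integral_mixture prob_measuresD right_diff_distrib sum_subtractf)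
  also have "\<dots> \<le> (\<Sum>i\<in>I. w i * e)"
    using assms order_trans[OF integral_diff_le_MK[OF g assms(4,5)] assms(6)]
    by (intro sum_mono mult_left_mono) auto
  finally show "(\<integral>x. g x \<partial>mixture \<B> I w \<nu>) - (\<integral>x. g x \<partial>mixture \<B> I w \<nu>') \<le> e"
    using assms(3) by (simp add: sum_distrib_right[symmetric])
qed (use assms in \<open>auto intro!: mixture_prob_measures\<close>)

subsection \<open>Hausdorff distance and attractors\<close>

abbreviation "\<H> \<equiv> hyperspace S d"
abbreviation "HD \<equiv> hausdorff_dist S d"

lemma hyperspaceD:
  assumes "A \<in> \<H>"
  shows "A \<noteq> {}" "A \<subseteq> S" "compactin mtopology A" "closedin mtopology A"
  using assms compactin_subspace[of mtopology A] compactin_imp_closedin[OF Hausdorff_space_mtopology]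
  by (auto simp: hyperspace_def)

lemma hyperspace_approx_mem:
  assumes "A \<in> \<H>" "x \<in> S" "\<And>e. e > 0 \<Longrightarrow> \<exists>a\<in>A. d x a < e"
  shows "x \<in> A"
proof -
  have "x \<in> mtopology closure_of A"
    using assms hyperspaceD[OF assms(1)] unfolding metric_closure_of by (auto simp: commute)
  then show ?thesis using closure_of_closedin[OF hyperspaceD(4)[OF assms(1)]] by simp
qed

lemma INF_dist_le:
  assumes "\<exists>a\<in>A. d x a \<le> e" 
  shows "(INF b\<in>A. d x b) \<le> e"
proof -
  obtain a where "a \<in> A" "d x a \<le> e" using assms by auto
  then show ?thesis by (intro cINF_lower2[of "(\<lambda>b. d x b)"] bdd_belowI2[where m = 0]) auto
qed

lemma HD_le:
  assumes "A \<in> \<H>" "B \<in> \<H>" "\<And>a. a \<in> A \<Longrightarrow> \<exists>b\<in>B. d a b \<le> e" "\<And>b. b \<in> B \<Longrightarrow> \<exists>a\<in>A. d b a \<le> e"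
  shows "HD A B \<le> e"
proof -
  have "(SUP a\<in>A. INF b\<in>B. d a b) \<le> e"
    using assms hyperspaceD(1) by (intro cSUP_least INF_dist_le) auto
  moreover have "(SUP b\<in>B. INF a\<in>A. d b a) \<le> e"
    using assms hyperspaceD(1) by (intro cSUP_least INF_dist_le) auto
  ultimately show ?thesis using assms by (simp add: hausdorff_dist_def)
qed

lemma HD_commute: "HD A B = HD B A"
  by (auto simp: hausdorff_dist_def)

text \<open>The supremum over \<open>A\<close> is attainable as an upper bound only if its set is
  bounded above; \<open>D\<close> is such a bound.\<close>

lemma INF_dist_le_HD:
  assumes "A \<in> \<H>" "B \<in> \<H>" "a \<in> A"
  shows "(INF b\<in>B. d a b) \<le> HD A B"
proof -
  obtain b where b: "b \<in> B" using hyperspaceD(1)[OF assms(2)] by auto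
  have "bdd_above ((\<lambda>a. INF b\<in>B. d a b) ` A)"
    using b hyperspaceD(2)[OF assms(1)] hyperspaceD(2)[OF assms(2)] bounded
    by (intro bdd_aboveI2[where M = D] INF_dist_le bexI[OF _ b]) blast
  then have "(INF b\<in>B. d a b) \<le> (SUP a\<in>A. INF b\<in>B. d a b)"
    using assms(3) by (rule cSUP_upper2) simp
  then show ?thesis using assms by (simp add: hausdorff_dist_def)
qed

lemma HD_less:
  assumes "A \<in> \<H>" "B \<in> \<H>" "HD A B < e" "a \<in> A"
  shows "\<exists>b\<in>B. d a b < e"
  using order_le_less_trans[OF INF_dist_le_HD[OF assms(1,2,4)] assms(3)] hyperspaceD(1)[OF assms(2)]
  by (subst (asm) cINF_less_iff) (auto intro: bdd_belowI2[where m = 0])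

lemma HD_nonneg: "0 \<le> HD A B"
proof (cases "A \<in> \<H> \<and> B \<in> \<H>")
  case True
  then obtain a where "a \<in> A" using hyperspaceD(1) by auto
  then have "0 \<le> (INF b\<in>B. d a b)" using True hyperspaceD(1) by (intro cINF_greatest) auto
  then show ?thesis using INF_dist_le_HD[of A B a] True \<open>a \<in> A\<close> by auto
qed (auto simp: hausdorff_dist_def)

lemma Metric_space_HD: "Metric_space \<H> HD"
proof
  fix A B assume A: "A \<in> \<H>" and B: "B \<in> \<H>"
  have "HD A A \<le> 0" using A hyperspaceD(2)[OF A] by (intro HD_le) (force simp: subset_iff)+
  moreover have "A \<subseteq> B" if "HD A B = 0" "A \<in> \<H>" "B \<in> \<H>" for A B
    using that hyperspaceD(2)[OF that(2)] HD_less[OF that(2,3)]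
    by (auto intro!: hyperspace_approx_mem[of B])
  ultimately show "HD A B = 0 \<longleftrightarrow> A = B"
    using A B HD_nonneg[of A A] HD_commute by (metis order_antisym)
next
  fix A B C assume A: "A \<in> \<H>" and B: "B \<in> \<H>" and C: "C \<in> \<H>"
  \<comment> \<open>Nearly nearest points replace nearest ones; the slack \<open>e\<close> is
    removed at the end.\<close>
  have *: "\<exists>c\<in>C. d a c \<le> HD A B + HD B C + e" 
    if H: "e > 0" "a \<in> A" "A \<in> \<H>" "B \<in> \<H>" "C \<in> \<H>" for a e A B C
  proof -
    obtain b where b: "b \<in> B" "d a b < HD A B + e/2" 
      using HD_less[OF H(3,4) _ H(2)] H(1) by (metis less_add_same_cancel1 half_gt_zero)
    obtain c where c: "c \<in> C" "d b c < HD B C + e/2" 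
      using HD_less[OF H(4,5) _ b(1)] H(1) by (metis less_add_same_cancel1 half_gt_zero)
    have "d a c \<le> d a b + d b c"
      using H b c hyperspaceD(2) by (intro triangle) blast+
    then show ?thesis using b c by (intro bexI[of _ c]) auto
  qed
  have "HD A C \<le> HD A B + HD B C + e" if "e > 0" for e
    using *[OF that _ A B C] *[OF that _ C B A] 
    by (intro HD_le[OF A C]) (auto simp: HD_commute[of C B] HD_commute[of B A] add.commute)
  then show "HD A C \<le> HD A B + HD B C" by (rule field_le_epsilon)
qed (auto simp: HD_nonneg HD_commute)

lemma power_bound_less:
  assumes "0 \<le> c" "c < 1" "0 < (e::real)"
  obtains k where "c ^ k * D < e"
proof -
  have "(\<lambda>k. c ^ k * D) \<longlonglongrightarrow> 0 * D" using assms by (intro tendsto_intros LIMSEQ_power_zero) auto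
  then have "\<forall>\<^sub>F k in sequentially. c ^ k * D < e" using assms by (intro order_tendstoD) auto
  then show ?thesis using that by (auto simp: eventually_sequentially)
qed

text \<open>By invariance a point of \<open>A\<close> is the image of a point of \<open>A\<close>
  under \<open>k\<close> of the maps. The same maps applied to a point of \<open>B\<close> stay in
  \<open>B\<close> and end within \<open>c ^ k * D\<close>, and \<open>B\<close> is closed.
  Exchanging \<open>A\<close> and \<open>B\<close> gives the other inclusion.\<close>

lemma invariant_sets_unique:
  assumes c: "0 \<le> c" "c < 1" and g: "\<And>i. i \<in> I \<Longrightarrow> g i \<in> S \<rightarrow> S"
    "\<And>i x y. i \<in> I \<Longrightarrow> x \<in> S \<Longrightarrow> y \<in> S \<Longrightarrow> d (g i x) (g i y) \<le> c * d x y"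
    and A: "A \<in> \<H>" "A = (\<Union>i\<in>I. g i ` A)" and B: "B \<in> \<H>" "B = (\<Union>i\<in>I. g i ` B)"
  shows "A \<subseteq> B"
proof
  have *: "\<exists>y\<in>B. d x y \<le> c ^ k * D" if "x \<in> A" for x k
    using that
  proof (induction k arbitrary: x)
    case 0
    obtain y where "y \<in> B" using hyperspaceD(1)[OF B(1)] by auto
    then show ?case
      using 0 hyperspaceD(2)[OF A(1)] hyperspaceD(2)[OF B(1)] bounded
      by (intro bexI[of _ y]) (auto simp: subset_iff)
  next
    case (Suc k)
    obtain i x' where x: "i \<in> I" "x' \<in> A" "x = g i x'" using Suc(2) by (subst (asm) A(2)) auto
    obtain y where y: "y \<in> B" "d x' y \<le> c ^ k * D" using Suc(1)[OF x(2)] by auto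
    have "d (g i x') (g i y) \<le> c * d x' y"
      using x y hyperspaceD(2)[OF A(1)] hyperspaceD(2)[OF B(1)] by (intro g(2)) auto
    also have "\<dots> \<le> c * (c ^ k * D)" using y c by (intro mult_left_mono) auto
    finally have "d x (g i y) \<le> c ^ Suc k * D" using x by (simp add: mult.assoc)
    moreover have "g i y \<in> B" using B(2) x y by auto
    ultimately show ?case by auto
  qed
  fix x assume "x \<in> A"
  then show "x \<in> B"
    using * hyperspaceD(2)[OF A(1)] power_bound_less[OF c] 
    by (intro hyperspace_approx_mem[OF B(1)]) (auto, meson order_le_less_trans)
qed

lemma set_attractor_eq:
  assumes "0 \<le> c" "c < 1" and "\<And>i. i \<in> I \<Longrightarrow> g i \<in> S \<rightarrow> S"
    "\<And>i x y. i \<in> I \<Longrightarrow> x \<in> S \<Longrightarrow> y \<in> S \<Longrightarrow> d (g i x) (g i y) \<le> c * d x y"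
    and "A \<in> \<H>" "A = (\<Union>i\<in>I. g i ` A)"
  shows "set_attractor S d I g = A"
  unfolding set_attractor_def
  using invariant_sets_unique[where g = g, OF assms(1-4)] assms(5,6)
  by (intro the_equality conjI) (auto intro!: equalityI)

text \<open>Two invariant measures are fixed by one map that contracts distances by
  \<open>c\<close>, so their distance is at most \<open>c\<close> times itself. Existence is left to
  the caller, who has to exhibit \<open>\<mu>\<close>.\<close>

lemma measure_attractor_eq:
  assumes c: "0 < c" "c < 1" and g: "\<And>i. i \<in> I \<Longrightarrow> g i \<in> S \<rightarrow> S"
    "\<And>i x y. i \<in> I \<Longrightarrow> x \<in> S \<Longrightarrow> y \<in> S \<Longrightarrow> d (g i x) (g i y) \<le> c * d x y"
    and w: "finite I" "\<And>i. i \<in> I \<Longrightarrow> w i \<ge> 0" "sum w I = 1"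
    and \<mu>: "\<mu> \<in> \<P>" "\<mu> = mixture \<B> I w (\<lambda>i. distr \<mu> \<B> (g i))"
  shows "measure_attractor S d I w g = \<mu>"
  unfolding measure_attractor_def
proof (rule the_equality)
  fix \<nu> assume \<nu>: "\<nu> \<in> \<P> \<and> \<nu> = mixture \<B> I w (\<lambda>i. distr \<nu> \<B> (g i))"
  interpret MK: bounded_metric \<P> MK D by (rule bounded_metric_MK)
  have gm: "distr \<kappa> \<B> (g i) \<in> \<P>" if "i \<in> I" "\<kappa> \<in> \<P>" for i \<kappa>
    using lipschitz_measurable[OF bounded_metric_axioms g(1) g(2)] that
    by (intro distr_prob_measures) (auto simp: measurable_prob_measures prob_measuresD)
  have "MK \<mu> \<nu> = MK (mixture \<B> I w (\<lambda>i. distr \<mu> \<B> (g i))) (mixture \<B> I w (\<lambda>i. distr \<nu> \<B> (g i)))"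
    using \<mu>(2) \<nu> by simp
  also have "\<dots> \<le> c * MK \<mu> \<nu>"
    using gm \<mu> \<nu> w g c
    by (intro MK_mixture_le MK_distr_distr_le[OF bounded_metric_axioms]) auto
  finally have "(1 - c) * MK \<mu> \<nu> \<le> 0" by (simp add: algebra_simps)
  then have "MK \<mu> \<nu> \<le> 0" using c by (simp add: mult_le_0_iff)
  then have "MK \<mu> \<nu> = 0" using MK_nonneg[of \<mu> \<nu>] by simp
  then show "\<nu> = \<mu>" using MK.zero \<mu> \<nu> by blast
qed (use \<mu> in auto)

end

subsection \<open>Code spaces\<close>

text \<open>Continuity for the product of discrete topologies, phrased by finitely many coordinates.
  This form gives both measurability for the product sigma-algebra and compactness of
  images.\<close>

definition cyl_continuous ::
    "'i set \<Rightarrow> 'c set \<Rightarrow> 'a set \<Rightarrow> ('a \<Rightarrow> 'a \<Rightarrow> real) \<Rightarrow> (('i \<Rightarrow> 'c) \<Rightarrow> 'a) \<Rightarrow> bool" where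
  "cyl_continuous I C S d h \<longleftrightarrow> (\<forall>x\<in>PiE I (\<lambda>_. C). h x \<in> S) \<and>
     (\<forall>x\<in>PiE I (\<lambda>_. C). \<forall>e>0. \<exists>J. finite J \<and> J \<subseteq> I \<and>
        (\<forall>y\<in>PiE I (\<lambda>_. C). (\<forall>j\<in>J. y j = x j) \<longrightarrow> d (h x) (h y) < e))"

lemma cyl_continuousI:
  fixes J :: "nat \<Rightarrow> 'i set"
  assumes "\<And>x. x \<in> PiE I (\<lambda>_. C) \<Longrightarrow> h x \<in> S" "\<And>k. finite (J k)" "\<And>k. J k \<subseteq> I" "0 \<le> c" "c < 1"
    and "\<And>k x y. x \<in> PiE I (\<lambda>_. C) \<Longrightarrow> y \<in> PiE I (\<lambda>_. C) \<Longrightarrow> (\<And>j. j \<in> J k \<Longrightarrow> y j = x j) \<Longrightarrow>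
      d (h x) (h y) \<le> c ^ k * D"
  shows "cyl_continuous I C S d h"
  unfolding cyl_continuous_def
proof (intro conjI ballI allI impI)
  fix x and e :: real assume x: "x \<in> PiE I (\<lambda>_. C)" and "e > 0"
  have "(\<lambda>k. c ^ k * D) \<longlonglongrightarrow> 0 * D" using assms by (intro tendsto_intros LIMSEQ_power_zero) auto
  then have "\<forall>\<^sub>F k in sequentially. c ^ k * D < e" using \<open>e > 0\<close> by (intro order_tendstoD) auto
  then obtain k where "c ^ k * D < e" by (auto simp: eventually_sequentially)
  then show "\<exists>J. finite J \<and> J \<subseteq> I \<and> (\<forall>y\<in>PiE I (\<lambda>_. C). (\<forall>j\<in>J. y j = x j) \<longrightarrow> d (h x) (h y) < e)"
    using assms(2,3,6) x by (intro exI[of _ "J k"]) (auto, meson order_le_less_trans)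
qed (use assms in auto)

lemma space_eqI_sets_Pow: "sets M = Pow C \<Longrightarrow> space M = C"
  by (metis Pow_iff Pow_top sets.sets_into_space sets.top subset_antisym)

text \<open>Over a countable index set and a finite alphabet there are only countably many
  cylinders. A set that contains a cylinder around each of its points is therefore a countable union
  of cylinders.\<close>

lemma cylinder_open_in_sets:
  assumes "finite C" "countable I" and M: "\<And>i. i \<in> I \<Longrightarrow> sets (M i) = Pow C"
    and E: "E \<subseteq> PiE I (\<lambda>_. C)"
    and op: "\<And>x. x \<in> E \<Longrightarrow> \<exists>J. finite J \<and> J \<subseteq> I \<and> (\<forall>y\<in>PiE I (\<lambda>_. C). (\<forall>j\<in>J. y j = x j) \<longrightarrow> y \<in> E)"
  shows "E \<in> sets (PiM I M)"
proof -
  define K where "K = (SIGMA J:{J. finite J \<and> J \<subseteq> I}. PiE J (\<lambda>_. C))"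
  define cyl where "cyl k = {y\<in>space (PiM I M). \<forall>j\<in>fst k. y j = snd k j}" for k
  have "space (M i) = C" if "i \<in> I" for i using M[OF that] by (rule space_eqI_sets_Pow)
  then have sp: "space (PiM I M) = PiE I (\<lambda>_. C)" by (auto simp: space_PiM cong: PiE_cong)
  have "countable {J. finite J \<and> J \<subseteq> I}" using assms(2) by (rule countable_Collect_finite_subset)
  then have "countable K" unfolding K_def using assms(1)
    by (intro countable_SIGMA) (auto intro!: countable_finite finite_PiE)
  then have ctb: "countable (cyl ` {k\<in>K. cyl k \<subseteq> E})" by (intro countable_image countable_Collect) auto
  have cyl: "cyl k \<in> sets (PiM I M)" if k: "k \<in> K" for k
  proof -
    have "{y\<in>space (PiM I M). y j = snd k j} \<in> sets (PiM I M)" if "j \<in> fst k" for j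
    proof -
      have j: "j \<in> I" "snd k j \<in> C" using k that by (auto simp: K_def)
      then have "{y\<in>space (PiM I M). y j \<in> {snd k j}} \<in> sets (PiM I M)"
        using M[OF j(1)] by (intro sets_Collect_single) simp_all
      then show ?thesis by simp
    qed
    moreover have "finite (fst k)" using k by (auto simp: K_def)
    ultimately show ?thesis unfolding cyl_def by (rule sets.sets_Collect_finite_All)
  qed
  have "E = \<Union>(cyl ` {k\<in>K. cyl k \<subseteq> E})"
  proof
    show "E \<subseteq> \<Union>(cyl ` {k\<in>K. cyl k \<subseteq> E})"
    proof
      fix x assume x: "x \<in> E"
      then obtain J where J: "finite J" "J \<subseteq> I" "\<forall>y\<in>PiE I (\<lambda>_. C). (\<forall>j\<in>J. y j = x j) \<longrightarrow> y \<in> E"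
        using op[OF x] by (elim exE conjE)
      have xC: "x \<in> PiE I (\<lambda>_. C)" using x E by blast
      then have "(J, restrict x J) \<in> K" using J(1,2) by (auto simp: K_def)
      moreover have "x \<in> cyl (J, restrict x J)" using xC sp by (simp add: cyl_def)
      moreover have "cyl (J, restrict x J) \<subseteq> E"
        by (intro subsetI, rule J(3)[rule_format]) (simp_all add: cyl_def sp)
      ultimately show "x \<in> \<Union>(cyl ` {k\<in>K. cyl k \<subseteq> E})" by blast
    qed
  qed auto
  also have "\<dots> \<in> sets (PiM I M)"
    using cyl by (intro sets.countable_Union ctb) auto
  finally show ?thesis .
qed

context bounded_metric
begin

lemma cyl_continuous_measurable:
  assumes "finite C" "countable I" and M: "\<And>i. i \<in> I \<Longrightarrow> sets (M i) = Pow C"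
    and h: "cyl_continuous I C S d h"
  shows "h \<in> measurable (PiM I M) \<B>"
proof (rule measurable_borel_on)
  have "space (M i) = C" if "i \<in> I" for i using M[OF that] by (rule space_eqI_sets_Pow)
  then have sp: "space (PiM I M) = PiE I (\<lambda>_. C)" by (auto simp: space_PiM cong: PiE_cong)
  then show "h \<in> space (PiM I M) \<rightarrow> S" using h by (auto simp: cyl_continuous_def)
  fix U assume U: "openin mtopology U"
  show "h -` U \<inter> space (PiM I M) \<in> sets (PiM I M)"
  proof (rule cylinder_open_in_sets[OF assms(1,2) M])
    fix x assume x: "x \<in> h -` U \<inter> space (PiM I M)"
    then obtain r where r: "r > 0" "mball (h x) r \<subseteq> U" using U unfolding openin_mtopology by auto
    then obtain J where J: "finite J" "J \<subseteq> I"
      "\<forall>y\<in>PiE I (\<lambda>_. C). (\<forall>j\<in>J. y j = x j) \<longrightarrow> d (h x) (h y) < r"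
      using h x unfolding cyl_continuous_def sp by (meson IntD2)
    have "y \<in> h -` U \<inter> space (PiM I M)" if "y \<in> PiE I (\<lambda>_. C)" "\<forall>j\<in>J. y j = x j" for y
    proof -
      have "h y \<in> mball (h x) r" using h that J x sp by (auto simp: cyl_continuous_def)
      then show ?thesis using r that sp by auto
    qed
    then show "\<exists>J. finite J \<and> J \<subseteq> I \<and> (\<forall>y\<in>PiE I (\<lambda>_. C). (\<forall>j\<in>J. y j = x j) \<longrightarrow> y \<in> h -` U \<inter> space (PiM I M))"
      using J by blast
  qed (auto simp: sp)
qed

text \<open>By Tychonoff the code space over a finite alphabet is compact, and so is its continuous
  image. This puts the fractal sets and the attractors into the hyperspaces, although the target is
  not known to be compact.\<close>

lemma cyl_continuous_image_hyperspace:
  assumes "finite C" "C \<noteq> {}" and h: "cyl_continuous I C S d h"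
  shows "h ` PiE I (\<lambda>_. C) \<in> \<H>"
proof -
  let ?T = "product_topology (\<lambda>_. discrete_topology C) I"
  have "continuous_map ?T mtopology h"
    unfolding continuous_map_to_metric
  proof (intro ballI allI impI)
    fix x and e :: real assume x: "x \<in> topspace ?T" and e: "e > 0"
    then obtain J where J: "finite J" "J \<subseteq> I"
      "\<forall>y\<in>PiE I (\<lambda>_. C). (\<forall>j\<in>J. y j = x j) \<longrightarrow> d (h x) (h y) < e"
      using h unfolding cyl_continuous_def topspace_product_topology topspace_discrete_topology by meson
    let ?U = "PiE I (\<lambda>i. if i \<in> J then {x i} else C)"
    have "finite {i \<in> I. (if i \<in> J then {x i} else C) \<noteq> topspace (discrete_topology C)}"
      by (rule finite_subset[OF _ J(1)]) auto
    then have "openin ?T ?U" unfolding openin_PiE_gen using x J(2) by auto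
    moreover have "x \<in> ?U" using x by (auto simp: PiE_iff)
    moreover have sub: "?U \<subseteq> PiE I (\<lambda>_. C)" using x J(2) by (intro PiE_mono) (auto simp: PiE_iff)
    moreover have "h y \<in> mball (h x) e" if y: "y \<in> ?U" for y
    proof -
      have yx: "\<forall>j\<in>J. y j = x j"
      proof
        fix j assume "j \<in> J"
        then show "y j = x j" using PiE_mem[OF y, of j] J(2) by auto
      qed
      have yC: "y \<in> PiE I (\<lambda>_. C)" using y sub by blast
      have "x \<in> PiE I (\<lambda>_. C)" using x by simp
      then have "h x \<in> S" "h y \<in> S" using h yC unfolding cyl_continuous_def by blast+
      moreover have "d (h x) (h y) < e" using J(3) yC yx by blast
      ultimately show ?thesis by simp
    qed
    ultimately show "\<exists>U. openin ?T U \<and> x \<in> U \<and> (\<forall>y\<in>U. h y \<in> mball (h x) e)"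
      by (intro exI[of _ ?U] conjI ballI)
  qed
  moreover have "compact_space ?T"
    using assms(1) by (simp add: compact_space_product_topology compact_space_discrete_topology)
  ultimately have "compactin mtopology (h ` topspace ?T)"
    by (intro image_compactin) (auto simp: compact_space_def)
  then show ?thesis using assms(2) by (auto simp: hyperspace_def PiE_eq_empty_iff)
qed

end

text \<open>Total probability over the first letter: it is independent of the remaining ones, which
  have law \<open>Q\<close> again. For address sequences this gives both the invariance of the
  measure attractor and the recursion over the levels of a tree.\<close>

lemma measure_PiM_shift:
  fixes C :: "'c set" and w :: "'c \<Rightarrow> real"
  defines "Q \<equiv> PiM (UNIV :: nat set) (\<lambda>_. point_measure C (\<lambda>c. ennreal (w c)))"
  assumes C: "finite C" "\<And>c. c \<in> C \<Longrightarrow> w c \<ge> 0" "sum w C = 1" and E: "E \<in> sets Q"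
  shows "emeasure Q E = (\<Sum>c\<in>C. ennreal (w c) * emeasure Q {a\<in>space Q. case_nat c a \<in> E})"
    and "c \<in> C \<Longrightarrow> {a\<in>space Q. case_nat c a \<in> E} \<in> sets Q"
proof -
  let ?M = "point_measure C (\<lambda>c. ennreal (w c))"
  interpret M: prob_space ?M using C by (intro prob_space_point_measure) auto
  interpret sequence_space ?M ..
  have m: "(\<lambda>(s, \<omega>). case_nat s \<omega>) \<in> measurable (?M \<Otimes>\<^sub>M Q) Q"
    unfolding Q_def by measurable
  let ?E = "(\<lambda>(s, \<omega>). case_nat s \<omega>) -` E \<inter> space (?M \<Otimes>\<^sub>M Q)"
  have sE: "?E \<in> sets (?M \<Otimes>\<^sub>M Q)" using m E by (rule measurable_sets)
  have P: "Pair c -` ?E = {a\<in>space Q. case_nat c a \<in> E}" if "c \<in> C" for c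
    using that by (auto simp: space_pair_measure space_point_measure)
  interpret Q: prob_space Q unfolding Q_def by (rule prob_space_axioms)
  have "emeasure Q E = emeasure (distr (?M \<Otimes>\<^sub>M Q) Q (\<lambda>(s, \<omega>). case_nat s \<omega>)) E"
    unfolding Q_def PiM_iter ..
  also have "\<dots> = emeasure (?M \<Otimes>\<^sub>M Q) ?E" using m E by (rule emeasure_distr)
  also have "\<dots> = (\<integral>\<^sup>+c. emeasure Q (Pair c -` ?E) \<partial>?M)" using sE by (rule Q.emeasure_pair_measure_alt)
  also have "\<dots> = (\<Sum>c\<in>C. ennreal (w c) * emeasure Q (Pair c -` ?E))"
    using C(1) by (rule nn_integral_point_measure_finite)
  finally show "emeasure Q E = (\<Sum>c\<in>C. ennreal (w c) * emeasure Q {a\<in>space Q. case_nat c a \<in> E})"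
    using P by simp
  show "{a\<in>space Q. case_nat c a \<in> E} \<in> sets Q" if "c \<in> C"
    using sets_Pair1[OF sE, of c] P[OF that] by simp
qed

subsection \<open>Fractal measures of a superIFS\<close>

definition subtree :: "(nat list \<Rightarrow> nat) \<Rightarrow> nat \<Rightarrow> nat list \<Rightarrow> nat" where
  "subtree \<sigma> m = (\<lambda>i. \<sigma> (m # i))"

lemma word_weight_Nil [simp]: "word_weight p \<sigma> [] = 1"
  by (simp add: word_weight_def)

lemma word_weight_Cons [simp]:
  "word_weight p \<sigma> (m # i) = p (\<sigma> []) m * word_weight p (subtree \<sigma> m) i"
  by (simp add: word_weight_def subtree_def prod.lessThan_Suc_shift del: prod.lessThan_Suc)

lemma word_map_Nil [simp]: "word_map f \<sigma> [] = id"
  by (simp add: word_map_def)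

lemma word_map_Cons [simp]:
  "word_map f \<sigma> (m # i) = f (\<sigma> []) m \<circ> word_map f (subtree \<sigma> m) i"
proof -
  have "[0..<length (m # i)] = 0 # map Suc [0..<length i]"
    by (simp add: upt_conv_Cons map_Suc_upt del: upt_Suc)
  then show ?thesis unfolding word_map_def subtree_def by (simp add: foldr_map comp_def del: upt_Suc)
qed

lemma word_map_append:
  "word_map f \<sigma> (i @ j) = word_map f \<sigma> i \<circ> word_map f (\<lambda>t. \<sigma> (i @ t)) j"
  by (induction i arbitrary: \<sigma>) (auto simp: subtree_def comp_assoc)

section \<open>Random walks down a code tree\<close>

primrec walk :: "(nat list \<Rightarrow> nat) \<Rightarrow> nat \<Rightarrow> nat list" where
  "walk \<omega> 0 = []"
| "walk \<omega> (Suc k) = walk \<omega> k @ [\<omega> (walk \<omega> k)]"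

lemma length_walk [simp]: "length (walk \<omega> k) = k"
  by (induction k) auto

lemma walk_add: "\<exists>j. walk \<omega> (k + n) = walk \<omega> k @ j"
  by (induction n) auto

text \<open>One condition for each proper prefix of \<open>i\<close>: the event that the walk
  follows \<open>i\<close> is a cylinder, whose probability is a product.\<close>

lemma walk_eq_iff:
  assumes "length i = k"
  shows "walk \<omega> k = i \<longleftrightarrow> (\<forall>j<k. \<omega> (take j i) = i ! j)"
proof
  assume walk: "walk \<omega> k = i"
  have pre: "walk \<omega> j = take j i" if "j \<le> k" for j
    using walk_add[of \<omega> j "k - j"] that walk by auto
  show "\<forall>j<k. \<omega> (take j i) = i ! j"
  proof (intro allI impI)
    fix j assume j: "j < k"
    have "take j i @ [\<omega> (take j i)] = take (Suc j) i" using pre[of "Suc j"] pre[of j] j by simp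
    then show "\<omega> (take j i) = i ! j" using j assms by (simp add: take_Suc_conv_app_nth)
  qed
next
  assume \<omega>: "\<forall>j<k. \<omega> (take j i) = i ! j"
  have "walk \<omega> j = take j i" if "j \<le> k" for j
    using that
  proof (induction j)
    case (Suc j)
    then show ?case using \<omega> assms by (simp add: take_Suc_conv_app_nth)
  qed simp
  then show "walk \<omega> k = i" using assms by simp
qed

definition words :: "nat \<Rightarrow> nat \<Rightarrow> nat list set" where
  "words M k = {i \<in> lists {1..M}. length i = k}"

text \<open>The labels at words of length less than \<open>k\<close> are exactly those that enter
  the maps and weights of words of length \<open>k\<close>.\<close>

definition short_words :: "nat \<Rightarrow> nat \<Rightarrow> nat list set" where
  "short_words M k = {i \<in> lists {1..M}. length i < k}"

lemma finite_words [simp]: "finite (words M k)"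
  using finite_lists_length_eq[of "{1..M}" k] by (simp add: words_def lists_eq_set conj_commute)

lemma finite_short_words [simp]: "finite (short_words M k)"
  by (rule finite_subset[OF _ finite_lists_length_le[of "{1..M}" k]])
    (auto simp: short_words_def)

lemma short_words_subset: "short_words M k \<subseteq> lists {1..M}"
  by (auto simp: short_words_def)

lemma words_0 [simp]: "words M 0 = {[]}"
  by (auto simp: words_def)

lemma words_Suc: "words M (Suc k) = (\<lambda>(m, i). m # i) ` ({1..M} \<times> words M k)"
  by (auto simp: words_def length_Suc_conv image_iff)

lemma sum_words_Suc:
  "(\<Sum>i\<in>words M (Suc k). h i) = (\<Sum>m\<in>{1..M}. \<Sum>i\<in>words M k. h (m # i))"
  unfolding words_Suc sum.cartesian_product
  by (subst sum.reindex) (auto simp: inj_on_def case_prod_unfold)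

lemma walk_in_words:
  assumes "\<omega> \<in> lists {1..M} \<rightarrow> {1..M}"
  shows "walk \<omega> k \<in> words M k"
proof -
  have "walk \<omega> k \<in> lists {1..M}" using assms by (induction k) auto
  then show ?thesis by (simp add: words_def)
qed

lemma countable_words: "countable (lists {1..M :: nat})"
  by simp

text \<open>The choices are indexed by words and not by time. At time \<open>k\<close> the law of
  the next letter depends on the word reached so far; at a fixed word it is fixed, so a product
  measure suffices.\<close>

definition walk_measure ::
    "nat \<Rightarrow> (nat \<Rightarrow> nat \<Rightarrow> real) \<Rightarrow> (nat list \<Rightarrow> nat) \<Rightarrow> (nat list \<Rightarrow> nat) measure" where
  "walk_measure M p \<sigma> = PiM (lists {1..M}) (\<lambda>t. point_measure {1..M} (\<lambda>m. ennreal (p (\<sigma> t) m)))"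

section \<open>The approximants, their limit and its self-similarity\<close>

locale superIFS = bounded_metric X d D for X :: "'a set" and d :: "'a \<Rightarrow> 'a \<Rightarrow> real" and D :: real +
  fixes M N :: nat and f :: "nat \<Rightarrow> nat \<Rightarrow> 'a \<Rightarrow> 'a" and l :: real and p :: "nat \<Rightarrow> nat \<Rightarrow> real"
  assumes compact: "compact_space mtopology" and nonempty: "X \<noteq> {}"
    and M1: "M \<ge> 1" and N1: "N \<ge> 1" and l: "0 < l" "l < 1"
    and f_in: "\<And>n m. n \<in> {1..N} \<Longrightarrow> m \<in> {1..M} \<Longrightarrow> f n m \<in> X \<rightarrow> X"
    and f_lip: "\<And>n m x y. n \<in> {1..N} \<Longrightarrow> m \<in> {1..M} \<Longrightarrow> x \<in> X \<Longrightarrow> y \<in> X \<Longrightarrow>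
           d (f n m x) (f n m y) \<le> l * d x y"
    and p_nonneg: "\<And>n m. n \<in> {1..N} \<Longrightarrow> m \<in> {1..M} \<Longrightarrow> p n m \<ge> 0"
    and p_sum: "\<And>n. n \<in> {1..N} \<Longrightarrow> (\<Sum>m\<in>{1..M}. p n m) = 1"
begin

abbreviation "\<Omega> \<equiv> code_trees M N"
abbreviation "approx \<equiv> fractal_approx X d M f p"
abbreviation "F \<equiv> fractal_measure X d M f p"

text \<open>One level of the construction. It appears in the recursion of the approximants, in the
  self-similarity of the limit and in each component of \<open>tuple_map\<close>.\<close>

definition step :: "nat \<Rightarrow> (nat \<Rightarrow> 'a measure) \<Rightarrow> 'a measure" where
  "step n u = mixture \<B> {1..M} (p n) (\<lambda>m. distr (u m) \<B> (f n m))"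

lemma step_cong: "(\<And>m. m \<in> {1..M} \<Longrightarrow> u m = u' m) \<Longrightarrow> step n u = step n u'"
  unfolding step_def by (intro mixture_cong) auto

lemma f_measurable: "n \<in> {1..N} \<Longrightarrow> m \<in> {1..M} \<Longrightarrow> f n m \<in> measurable \<B> \<B>"
  using lipschitz_measurable[OF bounded_metric_axioms f_in f_lip] by blast

lemma distr_f_in:
  "n \<in> {1..N} \<Longrightarrow> m \<in> {1..M} \<Longrightarrow> \<mu> \<in> \<P> \<Longrightarrow> distr \<mu> \<B> (f n m) \<in> \<P>"
  using f_measurable by (intro distr_prob_measures) (auto simp: measurable_prob_measures prob_measuresD)

lemma step_in:
  "n \<in> {1..N} \<Longrightarrow> (\<And>m. m \<in> {1..M} \<Longrightarrow> u m \<in> \<P>) \<Longrightarrow> step n u \<in> \<P>"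
  unfolding step_def using p_nonneg p_sum distr_f_in by (intro mixture_prob_measures) auto

lemma MK_step_le:
  assumes n: "n \<in> {1..N}" and u: "\<And>m. m \<in> {1..M} \<Longrightarrow> u m \<in> \<P>" "\<And>m. m \<in> {1..M} \<Longrightarrow> u' m \<in> \<P>"
    and e: "\<And>m. m \<in> {1..M} \<Longrightarrow> MK (u m) (u' m) \<le> e"
  shows "MK (step n u) (step n u') \<le> l * e"
  unfolding step_def
proof (rule MK_mixture_le)
  fix m assume m: "m \<in> {1..M}"
  have "MK (distr (u m) \<B> (f n m)) (distr (u' m) \<B> (f n m)) \<le> l * MK (u m) (u' m)"
    using m n u l by (intro MK_distr_distr_le[OF bounded_metric_axioms] f_in f_lip)
  also have "\<dots> \<le> l * e" using e[OF m] l by simp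
  finally show "MK (distr (u m) \<B> (f n m)) (distr (u' m) \<B> (f n m)) \<le> l * e" .
qed (use assms p_nonneg p_sum distr_f_in in auto)

lemma tree_label: "\<sigma> \<in> \<Omega> \<Longrightarrow> i \<in> lists {1..M} \<Longrightarrow> \<sigma> i \<in> {1..N}"
  unfolding code_trees_def by (rule PiE_mem)

lemma tree_root: "\<sigma> \<in> \<Omega> \<Longrightarrow> \<sigma> [] \<in> {1..N}"
  by (rule tree_label) simp_all

lemma subtree_in: "\<sigma> \<in> \<Omega> \<Longrightarrow> m \<in> {1..M} \<Longrightarrow> subtree \<sigma> m \<in> \<Omega>"
  unfolding code_trees_def subtree_def by (auto simp: PiE_iff extensional_def)

lemma word_weight_nonneg: "\<sigma> \<in> \<Omega> \<Longrightarrow> i \<in> lists {1..M} \<Longrightarrow> 0 \<le> word_weight p \<sigma> i"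
proof (induction i arbitrary: \<sigma>)
  case (Cons m i)
  then show ?case using p_nonneg[OF tree_root, of \<sigma> m] subtree_in[of \<sigma> m] by simp
qed simp

lemma word_map_in:
  "\<sigma> \<in> \<Omega> \<Longrightarrow> i \<in> lists {1..M} \<Longrightarrow> x \<in> X \<Longrightarrow> word_map f \<sigma> i x \<in> X"
proof (induction i arbitrary: \<sigma>)
  case (Cons m i)
  then have "word_map f (subtree \<sigma> m) i x \<in> X" using subtree_in by auto
  then show ?case using f_in[OF tree_root, of \<sigma> m] Cons by auto
qed simp

lemma word_map_dist:
  assumes "\<sigma> \<in> \<Omega>" "i \<in> lists {1..M}" "x \<in> X" "y \<in> X"
  shows "d (word_map f \<sigma> i x) (word_map f \<sigma> i y) \<le> l ^ length i * D"
  using assms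
proof (induction i arbitrary: \<sigma>)
  case Nil
  then show ?case using bounded by simp
next
  case (Cons m i)
  then have s: "subtree \<sigma> m \<in> \<Omega>" and i: "i \<in> lists {1..M}" and m: "m \<in> {1..M}"
    using subtree_in by auto
  have "d (word_map f \<sigma> (m # i) x) (word_map f \<sigma> (m # i) y)
      \<le> l * d (word_map f (subtree \<sigma> m) i x) (word_map f (subtree \<sigma> m) i y)"
    using f_lip[OF tree_root[OF Cons.prems(1)] m word_map_in[OF s i assms(3)] word_map_in[OF s i assms(4)]]
    by simp
  also have "\<dots> \<le> l * (l ^ length i * D)" using Cons.IH[OF s i assms(3,4)] l by simp
  finally show ?case by (simp add: mult.assoc)
qed

lemma word_map_measurable:
  "\<sigma> \<in> \<Omega> \<Longrightarrow> i \<in> lists {1..M} \<Longrightarrow> word_map f \<sigma> i \<in> measurable \<B> \<B>"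
proof (induction i arbitrary: \<sigma>)
  case (Cons m i)
  then have "word_map f (subtree \<sigma> m) i \<in> measurable \<B> \<B>" using subtree_in by auto
  moreover have "f (\<sigma> []) m \<in> measurable \<B> \<B>" using Cons by (intro f_measurable tree_root) auto
  ultimately show ?case unfolding word_map_Cons by (rule measurable_comp)
qed (simp add: id_def)

lemma approx_eq:
  "approx \<sigma> \<nu> k = mixture \<B> (words M k) (word_weight p \<sigma>) (\<lambda>i. distr \<nu> \<B> (word_map f \<sigma> i))"
  unfolding fractal_approx_def words_def ..

lemma approx_0:
  assumes "\<nu> \<in> \<P>"
  shows "approx \<sigma> \<nu> 0 = \<nu>"
proof (rule measure_eqI)
  show "sets (approx \<sigma> \<nu> 0) = sets \<nu>" using assms by (simp add: approx_eq prob_measuresD)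
  fix E assume "E \<in> sets (approx \<sigma> \<nu> 0)"
  then have E: "E \<in> sets \<B>" by (simp add: approx_eq)
  have "E \<subseteq> space \<nu>" using E assms sets.sets_into_space by (force simp: prob_measuresD)
  then show "emeasure (approx \<sigma> \<nu> 0) E = emeasure \<nu> E"
    using E assms unfolding approx_eq
    by (subst emeasure_mixture)
      (auto simp: emeasure_distr measurable_prob_measures id_def vimage_def Int_absorb2)
qed

text \<open>The level is split off at the root by removing the first letter of each word. What
  remains are approximants of the subtrees, so inductions on \<open>k\<close> run over all trees at
  once.\<close>

lemma approx_Suc:
  assumes \<sigma>: "\<sigma> \<in> \<Omega>" and \<nu>: "\<nu> \<in> \<P>"
  shows "approx \<sigma> \<nu> (Suc k) = step (\<sigma> []) (\<lambda>m. approx (subtree \<sigma> m) \<nu> k)"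
proof (rule measure_eqI)
  show "sets (approx \<sigma> \<nu> (Suc k)) = sets (step (\<sigma> []) (\<lambda>m. approx (subtree \<sigma> m) \<nu> k))"
    by (simp add: approx_eq step_def)
  fix E assume "E \<in> sets (approx \<sigma> \<nu> (Suc k))"
  then have E: "E \<in> sets \<B>" by (simp add: approx_eq)
  have wordD: "m \<in> {1..M}" "i \<in> lists {1..M}" if "m \<in> {1..M}" "i \<in> words M k" for m i
    using that by (auto simp: words_def)
  have inner: "emeasure (distr (approx (subtree \<sigma> m) \<nu> k) \<B> (f (\<sigma> []) m)) E
      = (\<Sum>i\<in>words M k. ennreal (word_weight p (subtree \<sigma> m) i) *
          emeasure (distr \<nu> \<B> (word_map f \<sigma> (m # i))) E)" if m: "m \<in> {1..M}" for m
  proof -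
    have fm: "f (\<sigma> []) m \<in> measurable \<B> \<B>" using m \<sigma> by (intro f_measurable tree_root)
    have "distr (distr \<nu> \<B> (word_map f (subtree \<sigma> m) i)) \<B> (f (\<sigma> []) m)
        = distr \<nu> \<B> (word_map f \<sigma> (m # i))" if "i \<in> words M k" for i
      using fm word_map_measurable[OF subtree_in[OF \<sigma> m] wordD(2)[OF m that]] \<nu>
      by (simp add: distr_distr measurable_prob_measures)
    then show ?thesis unfolding approx_eq
      using fm E by (subst distr_mixture) (simp_all add: emeasure_mixture)
  qed
  have "emeasure (approx \<sigma> \<nu> (Suc k)) E
    = (\<Sum>m\<in>{1..M}. \<Sum>i\<in>words M k. ennreal (word_weight p \<sigma> (m # i)) * 
        emeasure (distr \<nu> \<B> (word_map f \<sigma> (m # i))) E)"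
    unfolding approx_eq using E by (subst emeasure_mixture) (simp_all only: sets_distr sum_words_Suc)
  also have "\<dots> = (\<Sum>m\<in>{1..M}. ennreal (p (\<sigma> []) m) * (\<Sum>i\<in>words M k. 
      ennreal (word_weight p (subtree \<sigma> m) i) * emeasure (distr \<nu> \<B> (word_map f \<sigma> (m # i))) E))"
    unfolding sum_distrib_left
  proof (intro sum.cong refl)
    fix m i assume mi: "m \<in> {1..M}" "i \<in> words M k"
    show "ennreal (word_weight p \<sigma> (m # i)) * emeasure (distr \<nu> \<B> (word_map f \<sigma> (m # i))) E
      = ennreal (p (\<sigma> []) m) * (ennreal (word_weight p (subtree \<sigma> m) i) *
          emeasure (distr \<nu> \<B> (word_map f \<sigma> (m # i))) E)"
      using p_nonneg[OF tree_root[OF \<sigma>] mi(1)] word_weight_nonneg[OF subtree_in[OF \<sigma> mi(1)] wordD(2)[OF mi]]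
      by (simp only: word_weight_Cons ennreal_mult mult.assoc)
  qed
  also have "\<dots> = emeasure (step (\<sigma> []) (\<lambda>m. approx (subtree \<sigma> m) \<nu> k)) E"
    unfolding step_def using E inner by (subst emeasure_mixture) simp_all
  finally show "emeasure (approx \<sigma> \<nu> (Suc k)) E
      = emeasure (step (\<sigma> []) (\<lambda>m. approx (subtree \<sigma> m) \<nu> k)) E" .
qed

lemma approx_in: "\<sigma> \<in> \<Omega> \<Longrightarrow> \<nu> \<in> \<P> \<Longrightarrow> approx \<sigma> \<nu> k \<in> \<P>"
proof (induction k arbitrary: \<sigma>)
  case (Suc k)
  then show ?case unfolding approx_Suc[OF Suc.prems] by (intro step_in tree_root Suc.IH subtree_in)
qed (simp add: approx_0)

text \<open>Each level contracts by \<open>l\<close>, so the starting measure is gradually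
  forgotten; this makes the limit independent of it.\<close>

lemma MK_approx_le:
  "\<sigma> \<in> \<Omega> \<Longrightarrow> \<nu> \<in> \<P> \<Longrightarrow> \<nu>' \<in> \<P> \<Longrightarrow> MK (approx \<sigma> \<nu> k) (approx \<sigma> \<nu>' k) \<le> l ^ k * D"
proof (induction k arbitrary: \<sigma>)
  case 0
  then show ?case by (simp add: approx_0 MK_bounded)
next
  case (Suc k)
  then have "MK (approx \<sigma> \<nu> (Suc k)) (approx \<sigma> \<nu>' (Suc k)) \<le> l * (l ^ k * D)"
    unfolding approx_Suc[OF Suc.prems(1,2)] approx_Suc[OF Suc.prems(1,3)]
    by (intro MK_step_le tree_root approx_in subtree_in Suc.IH)
  then show ?case by (simp add: mult.assoc)
qed

lemma prob_space_choice: "n \<in> {1..N} \<Longrightarrow> prob_space (point_measure {1..M} (\<lambda>m. ennreal (p n m)))"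
  using p_nonneg p_sum sum_ennreal[of "{1..M}" "p n"] by (intro prob_space_point_measure) simp_all

lemma prob_space_walk_measure:
  assumes "\<sigma> \<in> \<Omega>"
  shows "prob_space (walk_measure M p \<sigma>)"
  unfolding walk_measure_def using tree_label[OF assms]
  by (intro prob_space_PiM prob_space_choice)

lemma space_walk_measure: "space (walk_measure M p \<sigma>) = (lists {1..M} \<rightarrow>\<^sub>E {1..M})"
  by (simp add: walk_measure_def space_PiM space_point_measure)

lemma measurable_walk_measure:
  assumes "cyl_continuous (lists {1..M}) {1..M} X d h"
  shows "h \<in> measurable (walk_measure M p \<sigma>) \<B>"
  unfolding walk_measure_def
  using assms by (intro cyl_continuous_measurable countable_words) (simp_all add: sets_point_measure)

text \<open>The proper prefixes of \<open>i\<close> are distinct words, so the choices made at them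
  are independent, and their probabilities multiply to the word weight.\<close>

lemma emeasure_walk:
  assumes \<sigma>: "\<sigma> \<in> \<Omega>" and i: "i \<in> words M k"
  shows "{\<omega> \<in> space (walk_measure M p \<sigma>). walk \<omega> k = i} \<in> sets (walk_measure M p \<sigma>)"
    and "emeasure (walk_measure M p \<sigma>) {\<omega> \<in> space (walk_measure M p \<sigma>). walk \<omega> k = i}
      = ennreal (word_weight p \<sigma> i)"
proof -
  let ?M = "\<lambda>t. point_measure {1..M} (\<lambda>m. ennreal (p (\<sigma> t) m))"
  \<comment> \<open>A prefix \<open>t\<close> of \<open>i\<close> is followed by the letter
    \<open>i ! length t\<close>.\<close>
  let ?J = "(\<lambda>j. take j i) ` {..<k}" and ?A = "\<lambda>t. {i ! length t}"
  have len: "length i = k" and iM: "set i \<subseteq> {1..M}" using i by (auto simp: words_def)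
  have J: "?J \<subseteq> lists {1..M}" using iM by (auto dest: in_set_takeD)
  have iA: "i ! length t \<in> {1..M}" if "t \<in> ?J" for t
    using that len iM by (auto simp: nth_mem subset_iff)
  have eq: "{\<omega> \<in> space (walk_measure M p \<sigma>). walk \<omega> k = i} = prod_emb (lists {1..M}) ?M ?J (PiE ?J ?A)"
  proof -
    have "restrict \<omega> ?J \<in> PiE ?J ?A \<longleftrightarrow> (\<forall>j<k. \<omega> (take j i) = i ! j)" for \<omega> :: "nat list \<Rightarrow> nat"
      using len unfolding restrict_PiE_iff by (auto simp: min_def)
    then show ?thesis
      unfolding walk_eq_iff[OF len] by (auto simp: prod_emb_def walk_measure_def space_PiM)
  qed
  have ps: "prob_space (?M t)" if "t \<in> lists {1..M}" for t
    using tree_label[OF \<sigma> that] by (rule prob_space_choice)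
  show "{\<omega> \<in> space (walk_measure M p \<sigma>). walk \<omega> k = i} \<in> sets (walk_measure M p \<sigma>)"
    unfolding eq unfolding walk_measure_def using J iA
    by (intro sets_PiM_I) (auto simp: sets_point_measure)
  have "emeasure (walk_measure M p \<sigma>) {\<omega> \<in> space (walk_measure M p \<sigma>). walk \<omega> k = i}
      = (\<Prod>t\<in>?J. emeasure (?M t) (?A t))"
    unfolding eq unfolding walk_measure_def using J iA
    by (intro emeasure_PiM_emb ps) (auto simp: sets_point_measure)
  also have "\<dots> = (\<Prod>t\<in>?J. ennreal (p (\<sigma> t) (i ! length t)))"
    using iA by (intro prod.cong refl) (subst emeasure_point_measure_finite, auto)
  also have "\<dots> = (\<Prod>j<k. ennreal (p (\<sigma> (take j i)) (i ! j)))"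
    using len by (subst prod.reindex) (auto simp: inj_on_def intro!: prod.cong, metis length_take min.absorb4)
  also have "\<dots> = ennreal (word_weight p \<sigma> i)"
    unfolding word_weight_def len
  proof (rule prod_ennreal)
    fix j assume j: "j \<in> {..<k}"
    then have "take j i \<in> lists {1..M}" "i ! j \<in> {1..M}" using J iA[of "take j i"] len by auto
    then show "0 \<le> p (\<sigma> (take j i)) (i ! j)" by (intro p_nonneg tree_label[OF \<sigma>])
  qed
  finally show "emeasure (walk_measure M p \<sigma>) {\<omega> \<in> space (walk_measure M p \<sigma>). walk \<omega> k = i}
      = ennreal (word_weight p \<sigma> i)" .
qed

lemma walk_in_lists:
  assumes "\<omega> \<in> lists {1..M} \<rightarrow>\<^sub>E {1..M}"
  shows "walk \<omega> k \<in> words M k" "walk \<omega> k \<in> lists {1..M}"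
proof -
  show "walk \<omega> k \<in> words M k" using assms by (intro walk_in_words) auto
  then show "walk \<omega> k \<in> lists {1..M}" by (simp add: words_def)
qed

lemma walk_cong:
  assumes "\<omega> \<in> lists {1..M} \<rightarrow>\<^sub>E {1..M}" "\<And>t. t \<in> short_words M k \<Longrightarrow> \<omega>' t = \<omega> t"
  shows "walk \<omega>' k = walk \<omega> k"
proof -
  have "walk \<omega>' j = walk \<omega> j" if "j \<le> k" for j
    using that
  proof (induction j)
    case (Suc j)
    then have "walk \<omega> j \<in> short_words M k"
      using walk_in_lists[OF assms(1), of j] by (simp add: short_words_def)
    then show ?case using Suc assms(2) by simp
  qed simp
  then show ?thesis by simp
qed

text \<open>All approximants started in a point mass become laws of points on one common probability
  space, where they can be compared pointwise.\<close>

lemma law_of_walk_point: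
  fixes k :: nat
  assumes \<sigma>: "\<sigma> \<in> \<Omega>" and x0: "x0 \<in> X"
  defines "h \<equiv> \<lambda>\<omega>. word_map f \<sigma> (walk \<omega> k) x0"
  shows "h \<in> measurable (walk_measure M p \<sigma>) \<B>"
    and "distr (walk_measure M p \<sigma>) \<B> h = approx \<sigma> (return \<B> x0) k"
proof -
  have "cyl_continuous (lists {1..M}) {1..M} X d h"
    unfolding cyl_continuous_def
  proof (intro conjI ballI allI impI)
    fix \<omega> assume \<omega>: "\<omega> \<in> lists {1..M} \<rightarrow>\<^sub>E {1..M}"
    then show hX: "h \<omega> \<in> X" unfolding h_def by (intro word_map_in walk_in_lists \<sigma> x0)
    fix e :: real assume "e > 0"
    then have "d (h \<omega>) (h \<omega>') < e" if "\<forall>t\<in>short_words M k. \<omega>' t = \<omega> t" for \<omega>'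
      using walk_cong[OF \<omega>, of k \<omega>'] that hX by (simp add: h_def)
    then show "\<exists>J. finite J \<and> J \<subseteq> lists {1..M} \<and>
        (\<forall>y\<in>lists {1..M} \<rightarrow>\<^sub>E {1..M}. (\<forall>j\<in>J. y j = \<omega> j) \<longrightarrow> d (h \<omega>) (h y) < e)"
      using finite_short_words[of M k] by (intro exI[of _ "short_words M k"]) (auto simp: short_words_def)
  qed
  then show meas: "h \<in> measurable (walk_measure M p \<sigma>) \<B>" by (rule measurable_walk_measure)
  let ?Q = "walk_measure M p \<sigma>"
  show "distr ?Q \<B> h = approx \<sigma> (return \<B> x0) k"
  proof (rule measure_eqI)
    fix E assume "E \<in> sets (distr ?Q \<B> h)"
    then have E: "E \<in> sets \<B>" by simp
    define G where "G i = {\<omega> \<in> space ?Q. walk \<omega> k = i}" for i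
    define W where "W = {i \<in> words M k. word_map f \<sigma> i x0 \<in> E}"
    have "h -` E \<inter> space ?Q = (\<Union>i\<in>W. G i)"
      using walk_in_lists by (auto simp: h_def G_def W_def space_walk_measure)
    then have "emeasure (distr ?Q \<B> h) E = emeasure ?Q (\<Union>i\<in>W. G i)"
      using E meas by (simp add: emeasure_distr)
    also have "\<dots> = (\<Sum>i\<in>W. emeasure ?Q (G i))"
      using emeasure_walk(1)[OF \<sigma>] unfolding G_def W_def
      by (intro sum_emeasure[symmetric]) (auto simp: disjoint_family_on_def)
    also have "\<dots> = (\<Sum>i\<in>W. ennreal (word_weight p \<sigma> i))"
      using emeasure_walk(2)[OF \<sigma>] by (intro sum.cong) (auto simp: G_def W_def)
    also have "\<dots> = (\<Sum>i\<in>words M k. ennreal (word_weight p \<sigma> i) * indicator E (word_map f \<sigma> i x0))"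
      unfolding W_def by (intro sum.mono_neutral_cong_left) auto
    also have "\<dots> = (\<Sum>i\<in>words M k. ennreal (word_weight p \<sigma> i) *
        emeasure (distr (return \<B> x0) \<B> (word_map f \<sigma> i)) E)"
    proof (intro sum.cong refl)
      fix i assume "i \<in> words M k"
      then have "word_map f \<sigma> i \<in> measurable \<B> \<B>"
        using \<sigma> by (intro word_map_measurable) (auto simp: words_def)
      then have "distr (return \<B> x0) \<B> (word_map f \<sigma> i) = return \<B> (word_map f \<sigma> i x0)"
        using x0 by (intro distr_return) auto
      then show "ennreal (word_weight p \<sigma> i) * indicator E (word_map f \<sigma> i x0) =
        ennreal (word_weight p \<sigma> i) * emeasure (distr (return \<B> x0) \<B> (word_map f \<sigma> i)) E"
        using E by simp
    qed
    also have "\<dots> = emeasure (approx \<sigma> (return \<B> x0) k) E"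
      unfolding approx_eq using E by (subst emeasure_mixture) simp_all
    finally show "emeasure (distr ?Q \<B> h) E = emeasure (approx \<sigma> (return \<B> x0) k) E" .
  qed (simp add: approx_eq)
qed

text \<open>The walk after \<open>k + n\<close> steps extends the word reached after
  \<open>k\<close> steps. Both points thus lie in the image of \<open>X\<close> under the map of
  that word, whose diameter is at most \<open>l ^ k * D\<close>. The limit exists as the compact
  space \<open>X\<close> is complete.\<close>

lemma walk_points_limit:
  assumes \<sigma>: "\<sigma> \<in> \<Omega>" and x0: "x0 \<in> X"
  obtains h where "cyl_continuous (lists {1..M}) {1..M} X d h"
    "\<And>\<omega> k. \<omega> \<in> lists {1..M} \<rightarrow>\<^sub>E {1..M} \<Longrightarrow> d (word_map f \<sigma> (walk \<omega> k) x0) (h \<omega>) \<le> l ^ k * D"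
proof -
  let ?S = "lists {1..M} \<rightarrow>\<^sub>E {1..M}"
  define x where "x \<omega> k = word_map f \<sigma> (walk \<omega> k) x0" for \<omega> k
  have xX: "x \<omega> k \<in> X" if "\<omega> \<in> ?S" for \<omega> k
    unfolding x_def using that by (intro word_map_in walk_in_lists \<sigma> x0)
  have dist: "d (x \<omega> k) (x \<omega> (k + n)) \<le> l ^ k * D" if \<omega>: "\<omega> \<in> ?S" for \<omega> k n
  proof -
    obtain j where j: "walk \<omega> (k + n) = walk \<omega> k @ j" using walk_add by blast
    have jl: "j \<in> lists {1..M}" "walk \<omega> k \<in> lists {1..M}" 
      using walk_in_lists(2)[OF \<omega>, of "k + n"] j by (simp_all add: walk_in_lists \<omega>)
    \<comment> \<open>The part of the code tree below the word reached after \<open>k\<close>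
      steps.\<close>
    define \<tau> where "\<tau> t = \<sigma> (walk \<omega> k @ t)" for t
    have "\<tau> \<in> \<Omega>" using \<sigma> jl(2) unfolding \<tau>_def code_trees_def by (auto simp: PiE_iff extensional_def)
    then have "word_map f \<tau> j x0 \<in> X" using jl x0 by (intro word_map_in)
    then show ?thesis
      using word_map_dist[OF \<sigma> jl(2) x0] 
      unfolding x_def j word_map_append \<tau>_def by simp
  qed
  have ex: "\<exists>y. limitin mtopology (x \<omega>) y sequentially" if \<omega>: "\<omega> \<in> ?S" for \<omega>
  proof -
    have "MCauchy (x \<omega>)"
      unfolding MCauchy_def
    proof (intro conjI allI impI)
      fix e :: real assume "e > 0"
      then obtain k where k: "l ^ k * D < e / 2" using power_bound_less[of l "e/2"] l by auto
      have "d (x \<omega> n) (x \<omega> n') < e" if "k \<le> n" "k \<le> n'" for n n'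
        using dist[OF \<omega>, of k "n - k"] dist[OF \<omega>, of k "n' - k"] k that
          triangle''[OF xX xX xX, OF \<omega> \<omega> \<omega>, of n n' k] by auto
      then show "\<exists>N. \<forall>n n'. N \<le> n \<longrightarrow> N \<le> n' \<longrightarrow> d (x \<omega> n) (x \<omega> n') < e" by blast
    qed (use xX \<omega> in auto)
    then show ?thesis using compact_space_imp_mcomplete[OF compact] by (simp add: mcomplete_def)
  qed
  define h where "h \<omega> = (SOME y. limitin mtopology (x \<omega>) y sequentially)" for \<omega>
  have lim: "limitin mtopology (x \<omega>) (h \<omega>) sequentially" if "\<omega> \<in> ?S" for \<omega>
    unfolding h_def using someI_ex[OF ex[OF that]] .
  have hX: "h \<omega> \<in> X" if "\<omega> \<in> ?S" for \<omega> using limitin_mspace[OF lim[OF that]] .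
  have dh: "d (x \<omega> k) (h \<omega>) \<le> l ^ k * D" if \<omega>: "\<omega> \<in> ?S" for \<omega> k
  proof (rule field_le_epsilon)
    fix e :: real assume "e > 0"
    then obtain n0 where n0: "\<And>n. n \<ge> n0 \<Longrightarrow> d (x \<omega> n) (h \<omega>) < e"
      using lim[OF \<omega>] unfolding limit_metric_sequentially by blast
    show "d (x \<omega> k) (h \<omega>) \<le> l ^ k * D + e"
      using n0[of "k + n0"] dist[OF \<omega>, of k n0] 
        triangle[OF xX xX hX, OF \<omega> \<omega> \<omega>, of k "k + n0"] by simp
  qed
  have "cyl_continuous (lists {1..M}) {1..M} X d h"
  \<comment> \<open>Twice \<open>D\<close>: both limit points are compared with the common point
    after \<open>k\<close> steps.\<close>
  proof (rule cyl_continuousI[where J = "short_words M" and c = l and D = "2 * D"])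
    fix k \<omega> \<omega>' assume \<omega>: "\<omega> \<in> ?S" "\<omega>' \<in> ?S" and eq: "\<And>j. j \<in> short_words M k \<Longrightarrow> \<omega>' j = \<omega> j"
    have "x \<omega>' k = x \<omega> k" unfolding x_def using walk_cong[OF \<omega>(1) eq] by simp
    then show "d (h \<omega>) (h \<omega>') \<le> l ^ k * (2 * D)"
      using dh[OF \<omega>(1), of k] dh[OF \<omega>(2), of k]
        triangle''[OF hX xX hX, OF \<omega>(1) \<omega>(1) \<omega>(2), of k] by simp
  qed (use hX l in \<open>simp_all add: short_words_subset[simplified]\<close>)
  then show ?thesis using that dh unfolding x_def by blast
qed

text \<open>The limit is the law of the limit point of the walk. One \<open>D\<close> pays for
  replacing \<open>\<nu>\<close> by a point mass, the other for the distance between the walk after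
  \<open>k\<close> steps and its limit.\<close>

lemma approx_limit_exists:
  assumes \<sigma>: "\<sigma> \<in> \<Omega>"
  obtains \<mu> where "\<mu> \<in> \<P>" "\<And>\<nu> k. \<nu> \<in> \<P> \<Longrightarrow> MK (approx \<sigma> \<nu> k) \<mu> \<le> l ^ k * (2 * D)"
proof -
  interpret MK: bounded_metric \<P> MK D by (rule bounded_metric_MK)
  obtain x0 where x0: "x0 \<in> X" using nonempty by blast
  obtain h where h: "cyl_continuous (lists {1..M}) {1..M} X d h"
    "\<And>\<omega> k. \<omega> \<in> lists {1..M} \<rightarrow>\<^sub>E {1..M} \<Longrightarrow> d (word_map f \<sigma> (walk \<omega> k) x0) (h \<omega>) \<le> l ^ k * D"
    using walk_points_limit[OF \<sigma> x0] by blast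
  let ?Q = "walk_measure M p \<sigma>"
  have hm: "h \<in> measurable ?Q \<B>" using h(1) by (rule measurable_walk_measure)
  have \<mu>: "distr ?Q \<B> h \<in> \<P>" using prob_space_walk_measure[OF \<sigma>] hm by (rule distr_prob_measures)
  have ret: "return \<B> x0 \<in> \<P>" using x0 by (simp add: prob_measures_def prob_space_return)
  show ?thesis
  proof (rule that[OF \<mu>])
    fix \<nu> k assume \<nu>: "\<nu> \<in> \<P>"
    have "MK (approx \<sigma> (return \<B> x0) k) (distr ?Q \<B> h) \<le> l ^ k * D"
      unfolding law_of_walk_point(2)[OF \<sigma> x0, symmetric] 
      using prob_space_walk_measure[OF \<sigma>] law_of_walk_point(1)[OF \<sigma> x0] hm h(2)
      by (intro MK_distr_le) (simp_all add: space_walk_measure)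
    then show "MK (approx \<sigma> \<nu> k) (distr ?Q \<B> h) \<le> l ^ k * (2 * D)"
      using MK_approx_le[OF \<sigma> \<nu> ret, of k] 
        MK_triangle[OF approx_in[OF \<sigma> \<nu>] approx_in[OF \<sigma> ret] \<mu>, of k k] by simp
  qed
qed

text \<open>The definite description asks for one limit that serves all starting measures; the bound
  of \<open>approx_limit_exists\<close> holds for each \<open>\<nu>\<close> with the same
  \<open>\<mu>\<close>, and limits in a metric space are unique.\<close>

lemma F_props:
  assumes \<sigma>: "\<sigma> \<in> \<Omega>"
  shows F_in: "F \<sigma> \<in> \<P>" and MK_approx_F: "\<nu> \<in> \<P> \<Longrightarrow> MK (approx \<sigma> \<nu> k) (F \<sigma>) \<le> l ^ k * (2 * D)"
proof -
  interpret MK: bounded_metric \<P> MK D by (rule bounded_metric_MK)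
  obtain \<mu> where \<mu>: "\<mu> \<in> \<P>" "\<And>\<nu> k. \<nu> \<in> \<P> \<Longrightarrow> MK (approx \<sigma> \<nu> k) \<mu> \<le> l ^ k * (2 * D)"
    using approx_limit_exists[OF \<sigma>] by blast
  have lim: "limitin MK.mtopology (approx \<sigma> \<nu>) \<mu> sequentially" if \<nu>: "\<nu> \<in> \<P>" for \<nu>
    unfolding MK.limit_metric_sequentially
  proof (intro conjI allI impI \<mu>)
    fix e :: real assume "e > 0"
    then obtain k where k: "l ^ k * D < e / 2" using power_bound_less[of l "e/2"] l by auto
    have "approx \<sigma> \<nu> n \<in> \<P> \<and> MK (approx \<sigma> \<nu> n) \<mu> < e" if "n \<ge> k" for n
    proof -
      have "l ^ n * D \<le> l ^ k * D"
        using that l D_nonneg by (intro mult_right_mono power_decreasing) auto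
      then show ?thesis using \<mu>(2)[OF \<nu>, of n] k approx_in[OF \<sigma> \<nu>] by simp
    qed
    then show "\<exists>K. \<forall>n\<ge>K. approx \<sigma> \<nu> n \<in> \<P> \<and> MK (approx \<sigma> \<nu> n) \<mu> < e" by blast
  qed
  have "F \<sigma> = \<mu>"
    unfolding fractal_measure_def
  proof (rule the_equality)
    fix \<mu>' assume "\<forall>\<nu>\<in>\<P>. limitin MK.mtopology (approx \<sigma> \<nu>) \<mu>' sequentially"
    then show "\<mu>' = \<mu>" using lim \<mu>(1) MK.limitin_metric_unique by (meson trivial_limit_sequentially)
  qed (use lim in blast)
  then show "F \<sigma> \<in> \<P>" "\<nu> \<in> \<P> \<Longrightarrow> MK (approx \<sigma> \<nu> k) (F \<sigma>) \<le> l ^ k * (2 * D)" using \<mu> by auto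
qed

text \<open>The approximants satisfy the recursion exactly, and \<open>step\<close> is continuous,
  so the limit satisfies it as well. \<open>F \<sigma>\<close> itself is taken as the starting
  measure.\<close>

lemma F_self_similar:
  assumes \<sigma>: "\<sigma> \<in> \<Omega>"
  shows "F \<sigma> = step (\<sigma> []) (\<lambda>m. F (subtree \<sigma> m))"
proof -
  interpret MK: bounded_metric \<P> MK D by (rule bounded_metric_MK)
  let ?R = "step (\<sigma> []) (\<lambda>m. F (subtree \<sigma> m))"
  have R: "?R \<in> \<P>" using \<sigma> by (intro step_in tree_root F_in subtree_in)
  have \<nu>: "F \<sigma> \<in> \<P>" using F_in[OF \<sigma>] .
  have "MK (F \<sigma>) ?R \<le> 0 + e" if "e > 0" for e
  proof -
    \<comment> \<open>Two distances of at most \<open>2 * (l ^ k * D)\<close> have to add up to less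
      than \<open>e\<close>.\<close>
    obtain k where k: "l ^ k * D < e / 4" using power_bound_less[of l "e/4"] l \<open>e > 0\<close> by auto
    have "MK (approx \<sigma> (F \<sigma>) (Suc k)) ?R \<le> l * (l ^ k * (2 * D))"
      unfolding approx_Suc[OF \<sigma> \<nu>] using \<sigma> \<nu>
      by (intro MK_step_le tree_root approx_in F_in subtree_in MK_approx_F)
    moreover have "MK (F \<sigma>) (approx \<sigma> (F \<sigma>) (Suc k)) \<le> l * (l ^ k * (2 * D))"
      using MK_approx_F[OF \<sigma> \<nu>, of "Suc k"] MK_commute[of "F \<sigma>"] by (simp add: mult.assoc)
    moreover have "l * (l ^ k * D) \<le> l ^ k * D" using l D_nonneg by (simp add: mult_left_le_one_le)
    ultimately show ?thesis
      using MK_triangle[OF \<nu> approx_in[OF \<sigma> \<nu>] R, of "Suc k"] k by simp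
  qed
  then have "MK (F \<sigma>) ?R \<le> 0" by (rule field_le_epsilon)
  then show ?thesis using MK.zero[OF \<nu> R] MK_nonneg[of "F \<sigma>" ?R] by simp
qed

lemma MK_F_le:
  assumes "\<sigma> \<in> \<Omega>" "\<tau> \<in> \<Omega>" "\<And>t. t \<in> short_words M k \<Longrightarrow> \<tau> t = \<sigma> t"
  shows "MK (F \<sigma>) (F \<tau>) \<le> l ^ k * D"
  using assms
proof (induction k arbitrary: \<sigma> \<tau>)
  case 0
  then show ?case by (simp add: MK_bounded F_in)
next
  case (Suc k)
  have root: "\<tau> [] = \<sigma> []" using Suc.prems(3)[of "[]"] by (simp add: short_words_def)
  have sub: "subtree \<tau> m t = subtree \<sigma> m t" if "m \<in> {1..M}" "t \<in> short_words M k" for m t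
    using that Suc.prems(3)[of "m # t"] by (simp add: short_words_def subtree_def)
  have "MK (F \<sigma>) (F \<tau>) \<le> l * (l ^ k * D)"
    unfolding F_self_similar[OF Suc.prems(1)] F_self_similar[OF Suc.prems(2)] root
    using Suc.prems(1,2) sub by (intro MK_step_le tree_root F_in subtree_in Suc.IH)
  then show ?case by (simp add: mult.assoc)
qed

lemma F_cyl_continuous: "cyl_continuous (lists {1..M}) {1..N} \<P> MK F"
  using l F_in MK_F_le unfolding code_trees_def
  by (intro cyl_continuousI[where J = "short_words M" and c = l and D = D])
      (simp_all add: short_words_subset[simplified])

lemma fractal_measures_hyperspace: "fractal_measures X d M N f p \<in> hyperspace \<P> MK"
proof -
  interpret MK: bounded_metric \<P> MK D by (rule bounded_metric_MK)
  show ?thesis unfolding fractal_measures_def code_trees_def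
    using F_cyl_continuous N1 by (intro MK.cyl_continuous_image_hyperspace) auto
qed

end

subsection \<open>Code trees read off from address sequences\<close>

text \<open>Level \<open>t\<close> of the tree is governed by \<open>a t\<close>. The root belongs
  to \<open>a 0\<close>, the map of the tuple IFS that is applied last, so prepending an address
  adds a level on top.\<close>

primrec vlabel :: "nat list \<Rightarrow> (nat \<Rightarrow> nat \<Rightarrow> nat \<times> (nat \<Rightarrow> nat)) \<Rightarrow> nat \<Rightarrow> nat" where
  "vlabel [] a v = fst (a 0 v)"
| "vlabel (m # i) a v = vlabel i (\<lambda>t. a (Suc t)) (snd (a 0 v) m)"

definition vtree :: "nat \<Rightarrow> (nat \<Rightarrow> nat \<Rightarrow> nat \<times> (nat \<Rightarrow> nat)) \<Rightarrow> nat \<Rightarrow> nat list \<Rightarrow> nat" where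
  "vtree M a v = (\<lambda>i\<in>lists {1..M}. vlabel i a v)"

lemma vlabel_cong: "(\<And>t. t < k \<Longrightarrow> a' t = a t) \<Longrightarrow> length i < k \<Longrightarrow> vlabel i a' v = vlabel i a v"
proof (induction i arbitrary: a a' v k)
  case (Cons m i)
  have "vlabel i (\<lambda>t. a' (Suc t)) u = vlabel i (\<lambda>t. a (Suc t)) u" for u
    by (rule Cons.IH[of "k - 1"]) (use Cons.prems(2) in \<open>auto intro: Cons.prems(1)\<close>)
  moreover have "a' 0 = a 0" using Cons.prems by (intro Cons.prems(1)) auto
  ultimately show ?case by simp
qed simp

lemma vtree_cong:
  "(\<And>t. t < k \<Longrightarrow> a' t = a t) \<Longrightarrow> i \<in> short_words M k \<Longrightarrow> vtree M a' v i = vtree M a v i"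
  using vlabel_cong[of k a' a i v] by (simp add: vtree_def short_words_def)

lemma vtree_case_nat_Nil [simp]: "vtree M (case_nat b a) v [] = fst (b v)"
  by (simp add: vtree_def)

text \<open>Prepending an address turns the old trees into subtrees of the new ones. This links
  self-similarity of \<open>F\<close> to \<open>tuple_map\<close> and drives the induction over the
  depth in \<open>tree_event_step\<close>.\<close>

lemma subtree_vtree_case_nat [simp]:
  "m \<in> {1..M} \<Longrightarrow> subtree (vtree M (case_nat b a) v) m = vtree M a (snd (b v) m)"
  by (auto simp: vtree_def subtree_def fun_eq_iff)

lemma case_nat_shift: "case_nat (a 0) (\<lambda>t. a (Suc t)) = a"
  by (auto simp: fun_eq_iff split: nat.split)

lemma finite_addresses: "finite (addresses M N V)"
  unfolding addresses_def by (intro finite_PiE finite_cartesian_product) auto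

lemma addresses_nonempty: "N \<ge> 1 \<Longrightarrow> addresses M N V \<noteq> {}"
  unfolding addresses_def by (auto simp: PiE_eq_empty_iff)

lemma addressesD:
  assumes "b \<in> addresses M N V" "v \<in> {1..V}"
  shows "fst (b v) \<in> {1..N}" "m \<in> {1..M} \<Longrightarrow> snd (b v) m \<in> {1..V}"
proof -
  have "b v \<in> {1..N} \<times> ({1..M} \<rightarrow>\<^sub>E {1..V})"
    using assms unfolding addresses_def by (rule PiE_mem)
  then show "fst (b v) \<in> {1..N}" "m \<in> {1..M} \<Longrightarrow> snd (b v) m \<in> {1..V}" by (auto simp: mem_Times_iff)
qed

abbreviation address_seqs :: "nat \<Rightarrow> nat \<Rightarrow> nat \<Rightarrow> (nat \<Rightarrow> nat \<Rightarrow> nat \<times> (nat \<Rightarrow> nat)) set" where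
  "address_seqs M N V \<equiv> UNIV \<rightarrow>\<^sub>E addresses M N V"

lemma vtree_in:
  assumes "a \<in> address_seqs M N V" "v \<in> {1..V}"
  shows "vtree M a v \<in> code_trees M N"
proof -
  have "vlabel i a v \<in> {1..N}" if "i \<in> lists {1..M}" for i
    using that assms
  proof (induction i arbitrary: a v)
    case Nil
    then show ?case using addressesD(1)[of "a 0" M N V v] by auto
  next
    case (Cons m i)
    then show ?case using addressesD(2)[of "a 0" M N V v m] by (simp add: Cons.IH PiE_iff)
  qed
  then show ?thesis unfolding vtree_def code_trees_def by (intro restrict_PiE_iff[THEN iffD2]) blast
qed

definition address_measure ::
    "nat \<Rightarrow> nat \<Rightarrow> nat \<Rightarrow> ((nat \<Rightarrow> nat \<times> (nat \<Rightarrow> nat)) \<Rightarrow> real) \<Rightarrow>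
     (nat \<Rightarrow> nat \<Rightarrow> nat \<times> (nat \<Rightarrow> nat)) measure" where
  "address_measure M N V w = PiM UNIV (\<lambda>_. point_measure (addresses M N V) (\<lambda>b. ennreal (w b)))"

lemma space_address_measure [simp]: "space (address_measure M N V w) = address_seqs M N V"
  by (simp add: address_measure_def space_PiM space_point_measure)

lemma prob_space_address_measure:
  assumes "\<And>b. b \<in> addresses M N V \<Longrightarrow> w b \<ge> 0" "sum w (addresses M N V) = 1"
  shows "prob_space (address_measure M N V w)"
  unfolding address_measure_def
  using finite_addresses assms by (intro prob_space_PiM prob_space_point_measure) (simp_all add: sum_ennreal)

lemma (in bounded_metric) address_measurable:
  "cyl_continuous UNIV (addresses M N V) S d h \<Longrightarrow> h \<in> measurable (address_measure M N V w) \<B>"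
  unfolding address_measure_def
  by (rule cyl_continuous_measurable[OF finite_addresses]) (simp_all add: sets_point_measure)

section \<open>The IFS of tuples and its attractors\<close>

context superIFS
begin

lemma tuple_dist_le_iff:
  assumes "V \<ge> 1"
  shows "tuple_dist X d V \<mu> \<nu> \<le> c \<longleftrightarrow> (\<forall>v\<in>{1..V}. MK (\<mu> v) (\<nu> v) \<le> c)"
  unfolding tuple_dist_def using assms by (subst Max_le_iff) auto

lemma bounded_metric_tuples:
  assumes V: "V \<ge> 1"
  shows "bounded_metric (prob_tuples X d V) (tuple_dist X d V) D"
proof -
  interpret MK: bounded_metric \<P> MK D by (rule bounded_metric_MK)
  have comp: "MK (\<mu> v) (\<nu> v) \<le> tuple_dist X d V \<mu> \<nu>" if "v \<in> {1..V}" for \<mu> \<nu> v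
    using tuple_dist_le_iff[OF V, of \<mu> \<nu> "tuple_dist X d V \<mu> \<nu>"] that by blast
  have in_P: "\<mu> v \<in> \<P>" if "\<mu> \<in> prob_tuples X d V" "v \<in> {1..V}" for \<mu> v
    using that unfolding prob_tuples_def by (rule PiE_mem)
  have nonneg: "0 \<le> tuple_dist X d V \<mu> \<nu>" for \<mu> \<nu>
    using V by (intro order_trans[OF MK_nonneg comp[of 1]]) simp
  show ?thesis
  proof
    fix \<mu> \<nu> show "0 \<le> tuple_dist X d V \<mu> \<nu>" by (rule nonneg)
    show "tuple_dist X d V \<mu> \<nu> = tuple_dist X d V \<nu> \<mu>" unfolding tuple_dist_def by (simp add: MK_commute)
  next
    fix \<mu> \<nu> assume \<mu>: "\<mu> \<in> prob_tuples X d V" and \<nu>: "\<nu> \<in> prob_tuples X d V"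
    show "tuple_dist X d V \<mu> \<nu> \<le> D"
      unfolding tuple_dist_le_iff[OF V] by (intro ballI MK_bounded in_P[OF \<mu>] in_P[OF \<nu>])
    show "tuple_dist X d V \<mu> \<nu> = 0 \<longleftrightarrow> \<mu> = \<nu>"
    proof
      assume 0: "tuple_dist X d V \<mu> \<nu> = 0"
      show "\<mu> = \<nu>"
      proof (rule PiE_ext[OF \<mu>[unfolded prob_tuples_def] \<nu>[unfolded prob_tuples_def]])
        fix v assume v: "v \<in> {1..V}"
        then have "MK (\<mu> v) (\<nu> v) = 0" using comp[OF v, of \<mu> \<nu>] 0 MK_nonneg[of "\<mu> v" "\<nu> v"] by simp
        then show "\<mu> v = \<nu> v" using MK.zero[OF in_P[OF \<mu> v] in_P[OF \<nu> v]] by simp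
      qed
    next
      assume "\<mu> = \<nu>"
      then have "tuple_dist X d V \<mu> \<nu> \<le> 0"
        unfolding tuple_dist_le_iff[OF V] using in_P[OF \<mu>] MK.mdist_zero by simp
      then show "tuple_dist X d V \<mu> \<nu> = 0" using nonneg[of \<mu> \<nu>] by simp
    qed
  next
    fix \<mu> \<nu> \<kappa> assume *: "\<mu> \<in> prob_tuples X d V" "\<nu> \<in> prob_tuples X d V" "\<kappa> \<in> prob_tuples X d V"
    show "tuple_dist X d V \<mu> \<kappa> \<le> tuple_dist X d V \<mu> \<nu> + tuple_dist X d V \<nu> \<kappa>"
      unfolding tuple_dist_le_iff[OF V]
    proof
      fix v assume v: "v \<in> {1..V}"
      show "MK (\<mu> v) (\<kappa> v) \<le> tuple_dist X d V \<mu> \<nu> + tuple_dist X d V \<nu> \<kappa>"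
        using MK_triangle[OF in_P[OF *(1) v] in_P[OF *(2) v] in_P[OF *(3) v]]
          comp[OF v, of \<mu> \<nu>] comp[OF v, of \<nu> \<kappa>] by simp
    qed
  qed (rule D_nonneg)
qed

lemma tuple_map_eq:
  "tuple_map X d M f p V b \<mu> = (\<lambda>v\<in>{1..V}. step (fst (b v)) (\<lambda>m. \<mu> (snd (b v) m)))"
  unfolding tuple_map_def step_def ..

lemma tuple_map_in:
  assumes "b \<in> addresses M N V"
  shows "tuple_map X d M f p V b \<in> prob_tuples X d V \<rightarrow> prob_tuples X d V"
proof
  fix \<mu> assume \<mu>: "\<mu> \<in> prob_tuples X d V"
  have "step (fst (b v)) (\<lambda>m. \<mu> (snd (b v) m)) \<in> \<P>" if "v \<in> {1..V}" for v
    by (intro step_in addressesD(1)[OF assms that] PiE_mem[OF \<mu>[unfolded prob_tuples_def]]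
        addressesD(2)[OF assms that])
  then show "tuple_map X d M f p V b \<mu> \<in> prob_tuples X d V"
    unfolding tuple_map_eq prob_tuples_def by (intro restrict_PiE_iff[THEN iffD2]) blast
qed

lemma tuple_map_lip:
  assumes V: "V \<ge> 1" and b: "b \<in> addresses M N V"
    and \<mu>: "\<mu> \<in> prob_tuples X d V" and \<nu>: "\<nu> \<in> prob_tuples X d V"
  shows "tuple_dist X d V (tuple_map X d M f p V b \<mu>) (tuple_map X d M f p V b \<nu>) \<le> l * tuple_dist X d V \<mu> \<nu>"
  unfolding tuple_dist_le_iff[OF V] tuple_map_eq
proof
  fix v assume v: "v \<in> {1..V}"
  have "MK (step (fst (b v)) (\<lambda>m. \<mu> (snd (b v) m))) (step (fst (b v)) (\<lambda>m. \<nu> (snd (b v) m)))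
      \<le> l * tuple_dist X d V \<mu> \<nu>"
  proof (rule MK_step_le)
    fix m assume "m \<in> {1..M}"
    then have m: "snd (b v) m \<in> {1..V}" by (rule addressesD[OF b v])
    show "\<mu> (snd (b v) m) \<in> \<P>" "\<nu> (snd (b v) m) \<in> \<P>"
      using PiE_mem[OF \<mu>[unfolded prob_tuples_def] m] PiE_mem[OF \<nu>[unfolded prob_tuples_def] m] .
    show "MK (\<mu> (snd (b v) m)) (\<nu> (snd (b v) m)) \<le> tuple_dist X d V \<mu> \<nu>"
      using tuple_dist_le_iff[OF V, of \<mu> \<nu> "tuple_dist X d V \<mu> \<nu>"] m by blast
  qed (rule addressesD(1)[OF b v])
  then show "MK ((\<lambda>v\<in>{1..V}. step (fst (b v)) (\<lambda>m. \<mu> (snd (b v) m))) v)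
      ((\<lambda>v\<in>{1..V}. step (fst (b v)) (\<lambda>m. \<nu> (snd (b v) m))) v) \<le> l * tuple_dist X d V \<mu> \<nu>"
    using v by simp
qed

text \<open>The code map of the IFS of tuples: the point with address sequence
  \<open>a\<close>.\<close>

definition \<Phi> :: "nat \<Rightarrow> (nat \<Rightarrow> nat \<Rightarrow> nat \<times> (nat \<Rightarrow> nat)) \<Rightarrow> nat \<Rightarrow> 'a measure" where
  "\<Phi> V a = (\<lambda>v\<in>{1..V}. F (vtree M a v))"

lemma \<Phi>_in: "a \<in> address_seqs M N V \<Longrightarrow> \<Phi> V a \<in> prob_tuples X d V"
  unfolding \<Phi>_def prob_tuples_def using F_in[OF vtree_in]
  by (intro restrict_PiE_iff[THEN iffD2]) blast

lemma case_nat_address_seqs: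
  "a \<in> address_seqs M N V \<Longrightarrow> b \<in> addresses M N V \<Longrightarrow> case_nat b a \<in> address_seqs M N V"
  by (auto simp: PiE_iff split: nat.split)

text \<open>The code map carries prepending an address to applying the corresponding map; both
  attractors are identified by this relation.\<close>

lemma tuple_map_\<Phi>:
  assumes a: "a \<in> address_seqs M N V" and b: "b \<in> addresses M N V"
  shows "tuple_map X d M f p V b (\<Phi> V a) = \<Phi> V (case_nat b a)"
  unfolding tuple_map_eq \<Phi>_def
proof (rule restrict_ext)
  fix v assume v: "v \<in> {1..V}"
  have "F (vtree M (case_nat b a) v) = step (fst (b v)) (\<lambda>m. F (subtree (vtree M (case_nat b a) v) m))"
    using F_self_similar[OF vtree_in[OF case_nat_address_seqs[OF a b] v]] by simp
  also have "\<dots> = step (fst (b v)) (\<lambda>m. (\<lambda>v\<in>{1..V}. F (vtree M a v)) (snd (b v) m))"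
    using addressesD(2)[OF b v] by (intro step_cong) simp
  finally show "step (fst (b v)) (\<lambda>m. (\<lambda>v\<in>{1..V}. F (vtree M a v)) (snd (b v) m))
      = F (vtree M (case_nat b a) v)" ..
qed

lemma MK_vtree_le:
  assumes "a \<in> address_seqs M N V" "a' \<in> address_seqs M N V" "v \<in> {1..V}" "\<And>t. t < k \<Longrightarrow> a' t = a t"
  shows "MK (F (vtree M a v)) (F (vtree M a' v)) \<le> l ^ k * D"
  by (rule MK_F_le[OF vtree_in[OF assms(1,3)] vtree_in[OF assms(2,3)] vtree_cong[OF assms(4)]])

lemma \<Phi>_cyl_continuous:
  assumes V: "V \<ge> 1"
  shows "cyl_continuous UNIV (addresses M N V) (prob_tuples X d V) (tuple_dist X d V) (\<Phi> V)"
proof (rule cyl_continuousI[where J = "\<lambda>k. {..<k}" and c = l and D = D])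
  fix k a a' assume "a \<in> address_seqs M N V" "a' \<in> address_seqs M N V" "\<And>j. j \<in> {..<k} \<Longrightarrow> a' j = a j"
  then have "MK (F (vtree M a v)) (F (vtree M a' v)) \<le> l ^ k * D" if "v \<in> {1..V}" for v
    by (intro MK_vtree_le[OF _ _ that]) simp_all
  then show "tuple_dist X d V (\<Phi> V a) (\<Phi> V a') \<le> l ^ k * D"
    unfolding tuple_dist_le_iff[OF V] by (simp add: \<Phi>_def)
qed (use l \<Phi>_in in simp_all)

lemma vtree_F_cyl_continuous:
  assumes V: "V \<ge> 1"
  shows "cyl_continuous UNIV (addresses M N V) \<P> MK (\<lambda>a. F (vtree M a 1))"
proof (rule cyl_continuousI[where J = "\<lambda>k. {..<k}" and c = l and D = D])
  fix k a a' assume "a \<in> address_seqs M N V" "a' \<in> address_seqs M N V" "\<And>j. j \<in> {..<k} \<Longrightarrow> a' j = a j"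
  then show "MK (F (vtree M a 1)) (F (vtree M a' 1)) \<le> l ^ k * D"
    using V by (intro MK_vtree_le) simp_all
qed (use l V F_in[OF vtree_in] in simp_all)

text \<open>Every address sequence is its head prepended to its tail, so the image of the code map
  is invariant; its compactness comes from the code space.\<close>

lemma V_attractor_eq:
  assumes V: "V \<ge> 1"
  shows "V_attractor X d M N f p V = \<Phi> V ` address_seqs M N V"
proof -
  interpret T: bounded_metric "prob_tuples X d V" "tuple_dist X d V" D by (rule bounded_metric_tuples[OF V])
  have inv: "\<Phi> V ` address_seqs M N V =
      (\<Union>b\<in>addresses M N V. tuple_map X d M f p V b ` \<Phi> V ` address_seqs M N V)" (is "?L = ?R")
  proof
    show "?L \<subseteq> ?R"
    proof
      fix \<mu> assume "\<mu> \<in> ?L"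
      then obtain a where a: "a \<in> address_seqs M N V" "\<mu> = \<Phi> V a" by blast
      have "a 0 \<in> addresses M N V" "(\<lambda>t. a (Suc t)) \<in> address_seqs M N V" using a(1) by (auto simp: PiE_iff)
      moreover from this have "\<mu> = tuple_map X d M f p V (a 0) (\<Phi> V (\<lambda>t. a (Suc t)))"
        by (simp add: tuple_map_\<Phi> a(2) case_nat_shift)
      ultimately show "\<mu> \<in> ?R" by blast
    qed
    show "?R \<subseteq> ?L" using tuple_map_\<Phi> case_nat_address_seqs by auto
  qed
  show ?thesis
    unfolding V_attractor_def
  proof (rule T.set_attractor_eq[where c = l])
    show "\<Phi> V ` address_seqs M N V \<in> hyperspace (prob_tuples X d V) (tuple_dist X d V)"
      using N1 \<Phi>_cyl_continuous[OF V]
      by (intro T.cyl_continuous_image_hyperspace finite_addresses addresses_nonempty)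
  qed (use l inv tuple_map_in tuple_map_lip[OF V] in simp_all)
qed

lemma V_fractal_measures_eq:
  assumes V: "V \<ge> 1"
  shows "V_fractal_measures X d M N f p V = (\<lambda>a. F (vtree M a 1)) ` address_seqs M N V"
  using V by (simp add: V_fractal_measures_def V_attractor_eq image_image \<Phi>_def)

lemma V_fractal_measures_hyperspace:
  assumes V: "V \<ge> 1"
  shows "V_fractal_measures X d M N f p V \<in> hyperspace \<P> MK"
proof -
  interpret MK: bounded_metric \<P> MK D by (rule bounded_metric_MK)
  show ?thesis unfolding V_fractal_measures_eq[OF V]
    using vtree_F_cyl_continuous[OF V] N1
    by (intro MK.cyl_continuous_image_hyperspace finite_addresses addresses_nonempty)
qed

text \<open>The head of a sequence of independent addresses has weights \<open>w\<close> and is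
  independent of the tail, which has the law of the whole sequence. Conditioning on the head is the
  invariance equation.\<close>

lemma V_measure_eq:
  assumes V: "V \<ge> 1" and w: "\<And>b. b \<in> addresses M N V \<Longrightarrow> w b \<ge> 0" "sum w (addresses M N V) = 1"
  shows "V_measure X d M N f p V w =
    distr (address_measure M N V w) (borel_on (prob_tuples X d V) (tuple_dist X d V)) (\<Phi> V)"
proof -
  interpret T: bounded_metric "prob_tuples X d V" "tuple_dist X d V" D by (rule bounded_metric_tuples[OF V])
  let ?Q = "address_measure M N V w"
  let ?A = "addresses M N V"
  have \<Phi>m: "\<Phi> V \<in> measurable ?Q T.\<B>" using \<Phi>_cyl_continuous[OF V] by (rule T.address_measurable)
  have tm: "tuple_map X d M f p V b \<in> measurable T.\<B> T.\<B>" if "b \<in> ?A" for b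
    using tuple_map_in[OF that] tuple_map_lip[OF V that]
    by (intro T.lipschitz_measurable[OF T.bounded_metric_axioms, where c = l])
  have in_P: "distr ?Q T.\<B> (\<Phi> V) \<in> prob_measures (prob_tuples X d V) (tuple_dist X d V)"
    using prob_space_address_measure[OF w] \<Phi>m by (intro T.distr_prob_measures)
  show ?thesis
    unfolding V_measure_def
  proof (rule T.measure_attractor_eq[where c = l])
    show "distr ?Q T.\<B> (\<Phi> V) = mixture T.\<B> ?A w (\<lambda>b. distr (distr ?Q T.\<B> (\<Phi> V)) T.\<B> (tuple_map X d M f p V b))"
    proof (rule measure_eqI)
      fix E assume "E \<in> sets (distr ?Q T.\<B> (\<Phi> V))"
      then have E: "E \<in> sets T.\<B>" by simp
      have sE: "\<Phi> V -` E \<inter> space ?Q \<in> sets ?Q" using \<Phi>m E by (rule measurable_sets)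
      have "emeasure (distr ?Q T.\<B> (\<Phi> V)) E = emeasure ?Q (\<Phi> V -` E \<inter> space ?Q)"
        using \<Phi>m E by (rule emeasure_distr)
      also have "\<dots> = (\<Sum>b\<in>?A. ennreal (w b) * emeasure ?Q {a\<in>space ?Q. case_nat b a \<in> \<Phi> V -` E \<inter> space ?Q})"
        using sE unfolding address_measure_def
        by (intro measure_PiM_shift(1) finite_addresses w)
      also have "\<dots> = (\<Sum>b\<in>?A. ennreal (w b) *
          emeasure (distr (distr ?Q T.\<B> (\<Phi> V)) T.\<B> (tuple_map X d M f p V b)) E)"
      proof (intro sum.cong refl)
        fix b assume b: "b \<in> ?A"
        have "{a\<in>space ?Q. case_nat b a \<in> \<Phi> V -` E \<inter> space ?Q}
            = (tuple_map X d M f p V b \<circ> \<Phi> V) -` E \<inter> space ?Q"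
          using tuple_map_\<Phi>[OF _ b] case_nat_address_seqs[OF _ b] by (auto simp: comp_def)
        then show "ennreal (w b) * emeasure ?Q {a\<in>space ?Q. case_nat b a \<in> \<Phi> V -` E \<inter> space ?Q} =
          ennreal (w b) * emeasure (distr (distr ?Q T.\<B> (\<Phi> V)) T.\<B> (tuple_map X d M f p V b)) E"
          using tm[OF b] \<Phi>m E by (simp add: distr_distr emeasure_distr measurable_comp)
      qed
      also have "\<dots> = emeasure (mixture T.\<B> ?A w (\<lambda>b. distr (distr ?Q T.\<B> (\<Phi> V)) T.\<B> (tuple_map X d M f p V b))) E"
        using E by (subst emeasure_mixture) simp_all
      finally show "emeasure (distr ?Q T.\<B> (\<Phi> V)) E = emeasure (mixture T.\<B> ?A w
          (\<lambda>b. distr (distr ?Q T.\<B> (\<Phi> V)) T.\<B> (tuple_map X d M f p V b))) E" .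
    qed simp
  qed (use l in_P w tuple_map_in tuple_map_lip[OF V] in \<open>simp_all add: finite_addresses\<close>)
qed

lemma V_fractal_distribution_eq:
  assumes V: "V \<ge> 1" and w: "\<And>b. b \<in> addresses M N V \<Longrightarrow> w b \<ge> 0" "sum w (addresses M N V) = 1"
  shows "V_fractal_distribution X d M N f p V w =
    distr (address_measure M N V w) (borel_on \<P> MK) (\<lambda>a. F (vtree M a 1))"
proof -
  interpret T: bounded_metric "prob_tuples X d V" "tuple_dist X d V" D by (rule bounded_metric_tuples[OF V])
  have \<Phi>m: "\<Phi> V \<in> measurable (address_measure M N V w) T.\<B>"
    using \<Phi>_cyl_continuous[OF V] by (rule T.address_measurable)
  have 1: "1 \<in> {1..V}" using V by simp
  \<comment> \<open>For the maximum metric the first component is a 1-Lipschitz function of the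
    tuple.\<close>
  have "(\<lambda>\<mu>. \<mu> 1) \<in> measurable T.\<B> (borel_on \<P> MK)"
  proof (rule T.lipschitz_measurable[OF bounded_metric_MK, where c = 1])
    show "(\<lambda>\<mu>. \<mu> 1) \<in> prob_tuples X d V \<rightarrow> \<P>" unfolding prob_tuples_def using PiE_mem[OF _ 1] by (rule funcsetI)
    show "MK (\<mu> 1) (\<nu> 1) \<le> 1 * tuple_dist X d V \<mu> \<nu>" for \<mu> \<nu>
      using tuple_dist_le_iff[OF V, of \<mu> \<nu> "tuple_dist X d V \<mu> \<nu>"] 1 by auto
  qed
  moreover have "V_measure X d M N f p V w = distr (address_measure M N V w) T.\<B> (\<Phi> V)"
    by (rule V_measure_eq[OF V w])
  ultimately show ?thesis
    unfolding V_fractal_distribution_def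
    using \<Phi>m V by (simp add: distr_distr comp_def \<Phi>_def)
qed

end

subsection \<open>Independence of the labels of short words\<close>

text \<open>The weights of the theorem: \<open>V\<close> labels with law \<open>P\<close> and
  \<open>M * V\<close> uniform pointers, all independent.\<close>

definition uniform_weight :: "nat \<Rightarrow> (nat \<Rightarrow> real) \<Rightarrow> nat \<Rightarrow> (nat \<Rightarrow> nat \<times> (nat \<Rightarrow> nat)) \<Rightarrow> real" where
  "uniform_weight M P V b = (\<Prod>v\<in>{1..V}. P (fst (b v))) / real V ^ (M * V)"

definition box :: "nat \<Rightarrow> nat \<Rightarrow> (nat \<Rightarrow> nat set) \<Rightarrow> (nat \<Rightarrow> nat \<Rightarrow> nat set) \<Rightarrow> (nat \<Rightarrow> nat \<times> (nat \<Rightarrow> nat)) set" where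
  "box M V L Y = (\<Pi>\<^sub>E v\<in>{1..V}. L v \<times> (\<Pi>\<^sub>E m\<in>{1..M}. Y v m))"

text \<open>Independence of all labels and pointers: the weight is a product over the buffers, so
  its sum over a product set factorises.\<close>

lemma sum_uniform_weight_box:
  assumes "\<And>v. v \<in> {1..V} \<Longrightarrow> finite (L v)" "\<And>v m. v \<in> {1..V} \<Longrightarrow> m \<in> {1..M} \<Longrightarrow> finite (Y v m)"
  shows "(\<Sum>b\<in>box M V L Y. uniform_weight M P V b) =
    (\<Prod>v\<in>{1..V}. \<Sum>n\<in>L v. P n) * (\<Prod>(v, m)\<in>{1..V} \<times> {1..M}. real (card (Y v m)) / real V)"
proof -
  have "(\<Sum>b\<in>box M V L Y. uniform_weight M P V b)
      = (\<Sum>b\<in>box M V L Y. \<Prod>v\<in>{1..V}. P (fst (b v)) / real V ^ M)"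
    by (simp add: uniform_weight_def prod_dividef power_mult)
  also have "\<dots> = (\<Prod>v\<in>{1..V}. \<Sum>x\<in>L v \<times> (\<Pi>\<^sub>E m\<in>{1..M}. Y v m). P (fst x) / real V ^ M)"
    unfolding box_def using assms
    by (intro prod_sum_PiE[symmetric] finite_cartesian_product finite_PiE) auto
  also have "\<dots> = (\<Prod>v\<in>{1..V}. (\<Sum>n\<in>L v. P n) * (\<Prod>m\<in>{1..M}. real (card (Y v m)) / real V))"
  proof (intro prod.cong refl)
    fix v assume v: "v \<in> {1..V}"
    have "(\<Sum>x\<in>L v \<times> (\<Pi>\<^sub>E m\<in>{1..M}. Y v m). P (fst x) / real V ^ M)
        = (\<Sum>n\<in>L v. \<Sum>y\<in>(\<Pi>\<^sub>E m\<in>{1..M}. Y v m). P n / real V ^ M)"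
      unfolding sum.cartesian_product by (simp add: case_prod_beta)
    also have "\<dots> = (\<Sum>n\<in>L v. P n) * (real (card (\<Pi>\<^sub>E m\<in>{1..M}. Y v m)) / real V ^ M)"
      by (simp add: sum_distrib_right sum_divide_distrib mult.commute)
    also have "real (card (\<Pi>\<^sub>E m\<in>{1..M}. Y v m)) / real V ^ M = (\<Prod>m\<in>{1..M}. real (card (Y v m)) / real V)"
      by (simp add: card_PiE prod_dividef)
    finally show "(\<Sum>x\<in>L v \<times> (\<Pi>\<^sub>E m\<in>{1..M}. Y v m). P (fst x) / real V ^ M) =
        (\<Sum>n\<in>L v. P n) * (\<Prod>m\<in>{1..M}. real (card (Y v m)) / real V)" .
  qed
  finally show ?thesis by (simp add: prod.distrib prod.cartesian_product)
qed

section \<open>Probabilities of prescribed labels\<close>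

definition tree_event ::
    "nat \<Rightarrow> nat \<Rightarrow> nat \<Rightarrow> nat \<Rightarrow> nat set \<Rightarrow> (nat \<Rightarrow> nat list \<Rightarrow> nat) \<Rightarrow> (nat \<Rightarrow> nat \<Rightarrow> nat \<times> (nat \<Rightarrow> nat)) set" where
  "tree_event M N V k R s =
    {a \<in> address_seqs M N V. \<forall>v\<in>R. \<forall>t\<in>short_words M k. vtree M a v t = s v t}"

lemma tree_event_sets: "tree_event M N V k R s \<in> sets (address_measure M N V w)"
  unfolding address_measure_def
proof (rule cylinder_open_in_sets[OF finite_addresses])
  fix a assume a: "a \<in> tree_event M N V k R s"
  have "a' \<in> tree_event M N V k R s" if "a' \<in> address_seqs M N V" "\<forall>j\<in>{..<k}. a' j = a j" for a'
    using that a vtree_cong[of k a' a _ M] by (simp add: tree_event_def)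
  then show "\<exists>J. finite J \<and> J \<subseteq> UNIV \<and> (\<forall>a'\<in>address_seqs M N V. (\<forall>j\<in>J. a' j = a j) \<longrightarrow> a' \<in> tree_event M N V k R s)"
    by (intro exI[of _ "{..<k}"]) simp
qed (auto simp: sets_point_measure tree_event_def)

lemma short_words_0 [simp]: "short_words M 0 = {}"
  by (simp add: short_words_def)

lemma short_words_Suc:
  "short_words M (Suc k) = insert [] ((\<lambda>(m, t). m # t) ` ({1..M} \<times> short_words M k))"
proof
  show "short_words M (Suc k) \<subseteq> insert [] ((\<lambda>(m, t). m # t) ` ({1..M} \<times> short_words M k))"
  proof
    fix i assume "i \<in> short_words M (Suc k)"
    then show "i \<in> insert [] ((\<lambda>(m, t). m # t) ` ({1..M} \<times> short_words M k))"
      by (cases i) (auto simp: short_words_def)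
  qed
qed (auto simp: short_words_def)

lemma prod_short_words_Suc:
  fixes h :: "nat list \<Rightarrow> real"
  shows "(\<Prod>t\<in>short_words M (Suc k). h t) = h [] * (\<Prod>m\<in>{1..M}. \<Prod>t\<in>short_words M k. h (m # t))"
  unfolding short_words_Suc prod.cartesian_product
  by (subst prod.insert) (auto simp: prod.reindex inj_on_def case_prod_unfold)

locale label_weights =
  fixes M N :: nat and P :: "nat \<Rightarrow> real"
  assumes P_pos: "\<And>n. n \<in> {1..N} \<Longrightarrow> P n > 0" and P_sum: "(\<Sum>n\<in>{1..N}. P n) = 1"
begin

lemma uniform_weight_nonneg:
  assumes "b \<in> addresses M N V"
  shows "0 \<le> uniform_weight M P V b"
  unfolding uniform_weight_def
  using P_pos[OF addressesD(1)[OF assms]] by (intro divide_nonneg_nonneg prod_nonneg) (auto intro: less_imp_le)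

lemma addresses_box: "addresses M N V = box M V (\<lambda>_. {1..N}) (\<lambda>_ _. {1..V})"
  by (simp add: addresses_def box_def)

lemma sum_uniform_weight: 
  assumes "V \<ge> 1"
  shows "(\<Sum>b\<in>addresses M N V. uniform_weight M P V b) = 1"
  unfolding addresses_box using assms by (subst sum_uniform_weight_box) (simp_all add: P_sum[simplified] case_prod_unfold)

definition rooted :: "nat \<Rightarrow> nat set \<Rightarrow> (nat \<Rightarrow> nat list \<Rightarrow> nat) \<Rightarrow> (nat \<Rightarrow> nat \<times> (nat \<Rightarrow> nat)) set" where
  "rooted V R s = {b \<in> addresses M N V. \<forall>v\<in>R. fst (b v) = s v []}"

context
  fixes V :: nat and R :: "nat set" and s :: "nat \<Rightarrow> nat list \<Rightarrow> nat"
  assumes V: "V \<ge> 1" and R: "R \<subseteq> {1..V}" and s: "\<And>v. v \<in> R \<Longrightarrow> s v [] \<in> {1..N}"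
begin

text \<open>Labels outside \<open>R\<close> are free and their weights sum to 1, so only the
  prescribed labels and the restrictions on the pointers leave a factor.\<close>

lemma sum_rooted_box:
  assumes "\<And>v m. v \<in> {1..V} \<Longrightarrow> m \<in> {1..M} \<Longrightarrow> Y v m \<subseteq> {1..V}"
  shows "(\<Sum>b\<in>{b\<in>rooted V R s. \<forall>v\<in>{1..V}. \<forall>m\<in>{1..M}. snd (b v) m \<in> Y v m}. uniform_weight M P V b)
    = (\<Prod>v\<in>R. P (s v [])) * (\<Prod>(v, m)\<in>{1..V} \<times> {1..M}. real (card (Y v m)) / real V)"
proof -
  let ?L = "\<lambda>v. if v \<in> R then {s v []} else {1..N}"
  have eq: "{b\<in>rooted V R s. \<forall>v\<in>{1..V}. \<forall>m\<in>{1..M}. snd (b v) m \<in> Y v m} = box M V ?L Y"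
  proof (rule set_eqI)
    fix b
    have "b \<in> box M V ?L Y \<longleftrightarrow> b \<in> extensional {1..V} \<and>
      (\<forall>v\<in>{1..V}. fst (b v) \<in> ?L v \<and> snd (b v) \<in> extensional {1..M} \<and> (\<forall>m\<in>{1..M}. snd (b v) m \<in> Y v m))"
      unfolding box_def PiE_iff mem_Times_iff by blast
    also have "\<dots> \<longleftrightarrow> b \<in> extensional {1..V} \<and> (\<forall>v\<in>{1..V}. fst (b v) \<in> {1..N} \<and> snd (b v) \<in> extensional {1..M} \<and>
       (\<forall>m\<in>{1..M}. snd (b v) m \<in> {1..V})) \<and> (\<forall>v\<in>R. fst (b v) = s v []) \<and> (\<forall>v\<in>{1..V}. \<forall>m\<in>{1..M}. snd (b v) m \<in> Y v m)"
      (is "?l = ?r")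
    proof
      assume l: ?l
      show ?r
      proof (intro conjI ballI)
        fix v assume v: "v \<in> {1..V}"
        then have "fst (b v) \<in> ?L v" using l by blast
        then show "fst (b v) \<in> {1..N}" using s[of v] by (auto split: if_splits)
        fix m assume m: "m \<in> {1..M}"
        show "snd (b v) m \<in> Y v m" "snd (b v) m \<in> {1..V}" using l v m assms[OF v m] by blast+
      next
        fix v assume v: "v \<in> R"
        then have "fst (b v) \<in> ?L v" using l R by blast
        then show "fst (b v) = s v []" using v by simp
      qed (use l in blast)+
    next
      assume ?r
      then show ?l by simp
    qed
    also have "\<dots> \<longleftrightarrow> b \<in> {b\<in>rooted V R s. \<forall>v\<in>{1..V}. \<forall>m\<in>{1..M}. snd (b v) m \<in> Y v m}"
      unfolding rooted_def addresses_def PiE_iff mem_Times_iff by blast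
    finally show "b \<in> {b\<in>rooted V R s. \<forall>v\<in>{1..V}. \<forall>m\<in>{1..M}. snd (b v) m \<in> Y v m} \<longleftrightarrow> b \<in> box M V ?L Y" by (rule sym)
  qed
  have "(\<Prod>v\<in>{1..V}. \<Sum>n\<in>?L v. P n) = (\<Prod>v\<in>{1..V}. if v \<in> R then P (s v []) else 1)"
    using P_sum by (intro prod.cong) auto
  also have "\<dots> = (\<Prod>v\<in>R. P (s v []))"
    using R by (simp add: prod.If_cases Int_absorb1)
  finally have *: "(\<Prod>v\<in>{1..V}. \<Sum>n\<in>?L v. P n) = (\<Prod>v\<in>R. P (s v []))" .
  have fin: "finite (Y v m)" if "v \<in> {1..V}" "m \<in> {1..M}" for v m
    using finite_subset[OF assms[OF that]] by simp
  show ?thesis unfolding eq by (subst sum_uniform_weight_box) (simp_all only: fin * if_split finite.intros finite_atLeastAtMost simp_thms)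
qed

lemma sum_rooted: "(\<Sum>b\<in>rooted V R s. uniform_weight M P V b) = (\<Prod>v\<in>R. P (s v []))"
proof -
  have "{b\<in>rooted V R s. \<forall>v\<in>{1..V}. \<forall>m\<in>{1..M}. snd (b v) m \<in> {1..V}} = rooted V R s"
    using addressesD(2)[of _ M N V] unfolding rooted_def by blast
  then show ?thesis using sum_rooted_box[of "\<lambda>_ _. {1..V}"] V by (simp add: case_prod_unfold)
qed

lemma finite_rooted: "finite (rooted V R s)"
  unfolding rooted_def by (rule finite_subset[OF _ finite_addresses]) blast

lemma rooted_weight_nonneg: "b \<in> rooted V R s \<Longrightarrow> 0 \<le> uniform_weight M P V b"
  unfolding rooted_def using uniform_weight_nonneg by blast

text \<open>Two different pointers take a common value \<open>u\<close> with probability 1/V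
  squared, and there are \<open>V\<close> values; the pointers are independent of the
  labels.\<close>

lemma sum_rooted_pair:
  assumes xy: "x \<in> R \<times> {1..M}" "y \<in> R \<times> {1..M}" "x \<noteq> y"
  shows "(\<Sum>b\<in>{b\<in>rooted V R s. snd (b (fst x)) (snd x) = snd (b (fst y)) (snd y)}. uniform_weight M P V b)
    = (\<Prod>v\<in>R. P (s v [])) / real V"
proof -
  \<comment> \<open>\<open>Y u\<close> forces the two chosen pointers to be \<open>u\<close> and
    leaves all others free.\<close>
  define Y where "Y u v m = (if (v, m) \<in> {x, y} then {u} else {1..V})" for u v m :: nat
  define H where "H u = {b\<in>rooted V R s. \<forall>v\<in>{1..V}. \<forall>m\<in>{1..M}. snd (b v) m \<in> Y u v m}" for u
  have xyV: "fst x \<in> {1..V}" "fst y \<in> {1..V}" "snd x \<in> {1..M}" "snd y \<in> {1..M}" using xy R by auto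
  have sub: "{x, y} \<subseteq> {1..V} \<times> {1..M}" using xyV by (simp add: mem_Times_iff)
  have H: "H u = {b\<in>rooted V R s. snd (b (fst x)) (snd x) = u \<and> snd (b (fst y)) (snd y) = u}" for u
  proof (intro set_eqI iffI)
    fix b assume b: "b \<in> H u"
    then have "snd (b (fst x)) (snd x) \<in> Y u (fst x) (snd x)" "snd (b (fst y)) (snd y) \<in> Y u (fst y) (snd y)"
      using xyV unfolding H_def by blast+
    then show "b \<in> {b\<in>rooted V R s. snd (b (fst x)) (snd x) = u \<and> snd (b (fst y)) (snd y) = u}"
      using b by (simp add: Y_def H_def)
  next
    fix b assume b: "b \<in> {b\<in>rooted V R s. snd (b (fst x)) (snd x) = u \<and> snd (b (fst y)) (snd y) = u}"
    have "snd (b v) m \<in> Y u v m" if "v \<in> {1..V}" "m \<in> {1..M}" for v m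
    proof (cases "(v, m) \<in> {x, y}")
      case True
      then show ?thesis using b by (auto simp: Y_def)
    next
      case False
      have "b \<in> addresses M N V" using b unfolding rooted_def by blast
      then have "snd (b v) m \<in> {1..V}" using that(2) by (rule addressesD(2)[OF _ that(1)])
      then show ?thesis using False by (simp only: Y_def if_False)
    qed
    then show "b \<in> H u" using b unfolding H_def by blast
  qed
  have "{b\<in>rooted V R s. snd (b (fst x)) (snd x) = snd (b (fst y)) (snd y)} = (\<Union>u\<in>{1..V}. H u)"
  proof (intro set_eqI iffI)
    fix b assume b: "b \<in> {b\<in>rooted V R s. snd (b (fst x)) (snd x) = snd (b (fst y)) (snd y)}"
    then have "b \<in> addresses M N V" unfolding rooted_def by blast
    then have "snd (b (fst x)) (snd x) \<in> {1..V}" using xyV(3) by (rule addressesD(2)[OF _ xyV(1)])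
    then show "b \<in> (\<Union>u\<in>{1..V}. H u)" using b unfolding H by (intro UN_I) simp_all
  qed (auto simp: H)
  then have "(\<Sum>b\<in>{b\<in>rooted V R s. snd (b (fst x)) (snd x) = snd (b (fst y)) (snd y)}. uniform_weight M P V b)
      = (\<Sum>u\<in>{1..V}. \<Sum>b\<in>H u. uniform_weight M P V b)"
    using finite_rooted by (simp only:, intro sum.UNION_disjoint) (auto simp: H)
  also have "\<dots> = (\<Sum>u\<in>{1..V}. (\<Prod>v\<in>R. P (s v [])) * (1 / real V)\<^sup>2)"
  proof (intro sum.cong refl)
    fix u assume u: "u \<in> {1..V}"
    have "(\<Sum>b\<in>H u. uniform_weight M P V b) = (\<Prod>v\<in>R. P (s v [])) *
      (\<Prod>(v, m)\<in>{1..V} \<times> {1..M}. real (card (Y u v m)) / real V)"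
      unfolding H_def using u by (intro sum_rooted_box) (auto simp: Y_def)
    also have "(\<Prod>(v, m)\<in>{1..V} \<times> {1..M}. real (card (Y u v m)) / real V)
        = (\<Prod>z\<in>{1..V} \<times> {1..M}. if z \<in> {x, y} then 1 / real V else 1)"
      using V by (intro prod.cong) (auto simp: Y_def)
    also have "\<dots> = (\<Prod>z\<in>{x, y}. 1 / real V)"
      using sub by (subst prod.If_cases) (simp_all only: Collect_mem_eq Int_absorb1 prod.neutral_const mult_1_right finite_cartesian_product finite_atLeastAtMost)
    also have "\<dots> = (1 / real V)\<^sup>2" using xy(3) by (simp add: power2_eq_square)
    finally show "(\<Sum>b\<in>H u. uniform_weight M P V b) = (\<Prod>v\<in>R. P (s v [])) * (1 / real V)\<^sup>2" .
  qed
  also have "\<dots> = (\<Prod>v\<in>R. P (s v [])) / real V" using V by (simp add: power2_eq_square)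
  finally show ?thesis .
qed

text \<open>A union bound as in the birthday problem, over the ordered pairs of distinct pointers
  among the \<open>card R * M\<close> pointers of \<open>R\<close>. Without a collision the next
  level is read from as many distinct buffers.\<close>

lemma sum_rooted_inj:
  "(\<Sum>b\<in>{b\<in>rooted V R s. inj_on (\<lambda>x. snd (b (fst x)) (snd x)) (R \<times> {1..M})}. uniform_weight M P V b)
    \<ge> (1 - (real (card R * M))\<^sup>2 / real V) * (\<Prod>v\<in>R. P (s v []))"
proof -
  let ?w = "uniform_weight M P V"
  let ?T = "R \<times> {1..M}"
  let ?T2 = "{z \<in> ?T \<times> ?T. fst z \<noteq> snd z}"
  let ?C = "\<lambda>z. {b\<in>rooted V R s. snd (b (fst (fst z))) (snd (fst z)) = snd (b (fst (snd z))) (snd (snd z))}"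
  let ?inj = "{b\<in>rooted V R s. inj_on (\<lambda>x. snd (b (fst x)) (snd x)) ?T}"
  define \<pi> where "\<pi> = (\<Prod>v\<in>R. P (s v []))"
  have fR: "finite R" using R by (rule finite_subset) simp
  have \<pi>: "\<pi> \<ge> 0" unfolding \<pi>_def using P_pos[OF s] by (intro prod_nonneg) (simp add: less_imp_le)
  have "rooted V R s - ?inj \<subseteq> (\<Union>z\<in>?T2. ?C z)"
  proof
    fix b assume b: "b \<in> rooted V R s - ?inj"
    then have "\<not> inj_on (\<lambda>x. snd (b (fst x)) (snd x)) ?T" by blast
    then obtain x y where xy: "x \<in> ?T" "y \<in> ?T" "x \<noteq> y" "snd (b (fst x)) (snd x) = snd (b (fst y)) (snd y)"
      unfolding inj_on_def by blast
    then have "(x, y) \<in> ?T2" "b \<in> ?C (x, y)" using b by simp_all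
    then show "b \<in> (\<Union>z\<in>?T2. ?C z)" by blast
  qed
  then have "sum ?w (rooted V R s - ?inj) \<le> sum ?w (\<Union>z\<in>?T2. ?C z)"
    using finite_rooted fR by (intro sum_mono2) (auto intro: rooted_weight_nonneg)
  also have "\<dots> \<le> (\<Sum>z\<in>?T2. sum ?w (?C z))"
  proof -
    have fT2: "finite ?T2" using fR by simp
    show ?thesis
      using fT2
    proof (induction rule: finite_induct)
      case (insert z F)
      have "sum ?w (?C z \<union> (\<Union>z\<in>F. ?C z)) \<le> sum ?w (?C z) + sum ?w (\<Union>z\<in>F. ?C z)"
      proof -
        have "sum ?w (?C z \<union> (\<Union>z\<in>F. ?C z)) + sum ?w (?C z \<inter> (\<Union>z\<in>F. ?C z)) = sum ?w (?C z) + sum ?w (\<Union>z\<in>F. ?C z)"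
          using finite_rooted insert(1) by (intro sum.union_inter) auto
        moreover have "0 \<le> sum ?w (?C z \<inter> (\<Union>z\<in>F. ?C z))" by (intro sum_nonneg) (simp add: rooted_weight_nonneg)
        ultimately show ?thesis by linarith
      qed
      then show ?case using insert by simp
    qed simp
  qed
  also have "\<dots> = (\<Sum>z\<in>?T2. \<pi> / real V)"
    unfolding \<pi>_def by (intro sum.cong refl sum_rooted_pair) auto
  also have "\<dots> \<le> (real (card R * M))\<^sup>2 * (\<pi> / real V)"
  proof -
    have "card ?T2 \<le> card (?T \<times> ?T)" using fR by (intro card_mono) auto
    then have "real (card ?T2) \<le> (real (card R * M))\<^sup>2"
      by (simp add: card_cartesian_product power2_eq_square flip: of_nat_mult)
    then have "real (card ?T2) * (\<pi> / real V) \<le> (real (card R * M))\<^sup>2 * (\<pi> / real V)"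
      using \<pi> by (intro mult_right_mono) auto
    then show ?thesis by simp
  qed
  finally have "sum ?w (rooted V R s - ?inj) \<le> (real (card R * M))\<^sup>2 * (\<pi> / real V)" .
  moreover have "sum ?w (rooted V R s - ?inj) = sum ?w (rooted V R s) - sum ?w ?inj"
    using finite_rooted by (intro sum_diff) auto
  ultimately show ?thesis using sum_rooted unfolding \<pi>_def[symmetric] by (simp add: algebra_simps)
qed

end


lemma measure_address_shift:
  assumes V: "V \<ge> 1" and E: "E \<in> sets (address_measure M N V (uniform_weight M P V))"
  defines "Q \<equiv> address_measure M N V (uniform_weight M P V)"
  shows "measure Q E = (\<Sum>b\<in>addresses M N V. uniform_weight M P V b * measure Q {a\<in>space Q. case_nat b a \<in> E})"
    and "b \<in> addresses M N V \<Longrightarrow> {a\<in>space Q. case_nat b a \<in> E} \<in> sets Q"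
proof -
  interpret Q: prob_space Q unfolding Q_def
    using uniform_weight_nonneg sum_uniform_weight[OF V] by (rule prob_space_address_measure)
  note shift = measure_PiM_shift[OF finite_addresses uniform_weight_nonneg sum_uniform_weight[OF V],
      folded address_measure_def, OF _ E, folded Q_def]
  have "emeasure Q E = (\<Sum>b\<in>addresses M N V. ennreal (uniform_weight M P V b) * emeasure Q {a\<in>space Q. case_nat b a \<in> E})"
    by (rule shift(1))
  also have "\<dots> = (\<Sum>b\<in>addresses M N V. ennreal (uniform_weight M P V b * measure Q {a\<in>space Q. case_nat b a \<in> E}))"
    by (intro sum.cong refl) (simp add: Q.emeasure_eq_measure ennreal_mult uniform_weight_nonneg)
  also have "\<dots> = ennreal (\<Sum>b\<in>addresses M N V. uniform_weight M P V b * measure Q {a\<in>space Q. case_nat b a \<in> E})"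
    by (intro sum_ennreal mult_nonneg_nonneg uniform_weight_nonneg) simp_all
  finally show "measure Q E = (\<Sum>b\<in>addresses M N V. uniform_weight M P V b * measure Q {a\<in>space Q. case_nat b a \<in> E})"
    by (simp add: Q.emeasure_eq_measure sum_nonneg uniform_weight_nonneg)
  show "b \<in> addresses M N V \<Longrightarrow> {a\<in>space Q. case_nat b a \<in> E} \<in> sets Q" by (rule shift(2))
qed

lemma P_tree_pos:
  assumes "\<sigma> \<in> code_trees M N"
  shows "0 < (\<Prod>t\<in>short_words M k. P (\<sigma> t))"
proof (rule prod_pos)
  fix t assume "t \<in> short_words M k"
  then have "\<sigma> t \<in> {1..N}"
    using assms unfolding code_trees_def short_words_def by (blast intro: PiE_mem)
  then show "0 < P (\<sigma> t)" by (rule P_pos)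
qed

text \<open>Condition on the first address. If the roots have the right labels and their pointers do
  not collide, each buffer that is reached has to show just one prescribed subtree, and the
  hypothesis for depth \<open>k\<close> applies to these buffers. One factor 1 - \<delta> pays for
  collisions, the other comes from that hypothesis.\<close>

lemma tree_event_step:
  fixes R :: "nat set"
  assumes V: "V \<ge> 1" and R: "R \<subseteq> {1..V}" and s: "\<And>v. v \<in> R \<Longrightarrow> s v \<in> code_trees M N"
    and \<delta>: "0 \<le> \<delta>" "\<delta> \<le> 1" and large: "(real (card R * M))\<^sup>2 / real V \<le> \<delta>"
  defines "Q \<equiv> address_measure M N V (uniform_weight M P V)"
  assumes IH: "\<And>R' s'. R' \<subseteq> {1..V} \<Longrightarrow> card R' = card R * M \<Longrightarrow> (\<And>v. v \<in> R' \<Longrightarrow> s' v \<in> code_trees M N) \<Longrightarrow>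
      (1 - \<delta>) * (\<Prod>v\<in>R'. \<Prod>t\<in>short_words M k. P (s' v t)) \<le> measure Q (tree_event M N V k R' s')"
  shows "(1 - \<delta>) * (1 - \<delta>) * (\<Prod>v\<in>R. \<Prod>t\<in>short_words M (Suc k). P (s v t))
    \<le> measure Q (tree_event M N V (Suc k) R s)"
proof -
  interpret Q: prob_space Q unfolding Q_def
    using uniform_weight_nonneg sum_uniform_weight[OF V] by (rule prob_space_address_measure)
  let ?T = "R \<times> {1..M}" and ?E = "tree_event M N V (Suc k) R s" and ?w = "uniform_weight M P V"
  define K where "K = (\<Prod>x\<in>?T. \<Prod>t\<in>short_words M k. P (subtree (s (fst x)) (snd x) t))"
  let ?shift = "\<lambda>b. {a\<in>space Q. case_nat b a \<in> ?E}"
  let ?G = "{b\<in>rooted V R s. inj_on (\<lambda>x. snd (b (fst x)) (snd x)) ?T}"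
  have root: "s v [] \<in> {1..N}" if "v \<in> R" for v
    using s[OF that] unfolding code_trees_def by (rule PiE_mem) simp
  have sub: "subtree (s (fst x)) (snd x) \<in> code_trees M N" if "x \<in> ?T" for x
  proof -
    have x: "s (fst x) \<in> code_trees M N" "snd x \<in> {1..M}" using s that by auto
    then show ?thesis unfolding code_trees_def subtree_def by (auto simp: PiE_iff extensional_def)
  qed
  have K: "0 \<le> K" unfolding K_def using P_tree_pos[OF sub] by (intro prod_nonneg less_imp_le)
  have GA: "b \<in> addresses M N V" if "b \<in> rooted V R s" for b
    using that unfolding rooted_def by blast
  have GR: "fst (b v) = s v []" if "b \<in> rooted V R s" "v \<in> R" for b v
    using that unfolding rooted_def by blast
  have low: "(1 - \<delta>) * K \<le> measure Q (?shift b)" if b: "b \<in> ?G" for b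
  proof -
    define g where "g x = snd (b (fst x)) (snd x)" for x :: "nat \<times> nat"
    have inj: "inj_on g ?T" and bG: "b \<in> rooted V R s" using b unfolding g_def by simp_all
    \<comment> \<open>The subtree that buffer \<open>u\<close> has to show: \<open>g\<close> maps a
      root and a letter to the buffer pointed to, and its inverse recovers them.\<close>
    define s' where "s' u = (let x = the_inv_into ?T g u in subtree (s (fst x)) (snd x))" for u
    have s'g: "s' (g x) = subtree (s (fst x)) (snd x)" if "x \<in> ?T" for x
      unfolding s'_def Let_def the_inv_into_f_f[OF inj that] ..
    have gV: "g ` ?T \<subseteq> {1..V}"
    proof
      fix u assume "u \<in> g ` ?T"
      then obtain x where x: "x \<in> ?T" "u = g x" by blast
      then have "fst x \<in> {1..V}" "snd x \<in> {1..M}" using R by auto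
      then show "u \<in> {1..V}" unfolding x(2) g_def by (rule addressesD(2)[OF GA[OF bG]])
    qed
    have "(1 - \<delta>) * (\<Prod>v\<in>g ` ?T. \<Prod>t\<in>short_words M k. P (s' v t)) \<le> measure Q (tree_event M N V k (g ` ?T) s')"
    proof (rule IH[OF gV])
      show "card (g ` ?T) = card R * M" using inj by (simp add: card_image card_cartesian_product)
      show "s' v \<in> code_trees M N" if "v \<in> g ` ?T" for v using that sub s'g by auto
    qed
    also have "(\<Prod>v\<in>g ` ?T. \<Prod>t\<in>short_words M k. P (s' v t)) = K"
      unfolding K_def prod.reindex[OF inj] comp_def by (intro prod.cong refl) (simp only: s'g)
    also have "measure Q (tree_event M N V k (g ` ?T) s') \<le> measure Q (?shift b)"
    proof (rule Q.finite_measure_mono)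
      show "?shift b \<in> sets Q"
        unfolding Q_def by (rule measure_address_shift(2)[OF V tree_event_sets GA[OF bG]])
      show "tree_event M N V k (g ` ?T) s' \<subseteq> ?shift b"
      proof
        fix a assume a: "a \<in> tree_event M N V k (g ` ?T) s'"
        then have aS: "a \<in> address_seqs M N V" unfolding tree_event_def by blast
        have "vtree M (case_nat b a) v t = s v t" if v: "v \<in> R" and t: "t \<in> short_words M (Suc k)" for v t
        proof (cases t)
          case Nil
          then show ?thesis using GR[OF bG v] by simp
        next
          case (Cons m u)
          then have m: "m \<in> {1..M}" and u: "u \<in> short_words M k" using t by (auto simp: short_words_def)
          have vm: "(v, m) \<in> ?T" using v m by blast
          have "vtree M (case_nat b a) v t = vtree M a (g (v, m)) u"
            using subtree_vtree_case_nat[OF m, of b a v, unfolded subtree_def, THEN fun_cong, of u]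
            by (simp add: Cons g_def)
          also have "\<dots> = s' (g (v, m)) u" using a vm u unfolding tree_event_def by blast
          finally show ?thesis unfolding s'g[OF vm] by (simp add: subtree_def Cons)
        qed
        moreover have "case_nat b a \<in> address_seqs M N V"
          using aS GA[OF bG] by (auto simp: PiE_iff split: nat.split)
        ultimately have "case_nat b a \<in> ?E" unfolding tree_event_def by blast
        then show "a \<in> ?shift b" using aS by (simp add: Q_def)
      qed
    qed
    finally show ?thesis .
  qed
  have fG: "finite ?G" using finite_rooted[where s = s, OF V R root] by simp
  have "(1 - \<delta>) * (\<Prod>v\<in>R. P (s v [])) \<le> (1 - (real (card R * M))\<^sup>2 / real V) * (\<Prod>v\<in>R. P (s v []))"
    using large P_pos[OF root] by (intro mult_right_mono prod_nonneg) (auto intro: less_imp_le)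
  also have "\<dots> \<le> sum ?w ?G" by (rule sum_rooted_inj[where s = s, OF V R root])
  finally have sumG: "(1 - \<delta>) * (\<Prod>v\<in>R. P (s v [])) \<le> sum ?w ?G" .
  have "(\<Prod>v\<in>R. \<Prod>t\<in>short_words M (Suc k). P (s v t)) = (\<Prod>v\<in>R. P (s v [])) * K"
    using prod.cartesian_product[of "\<lambda>v m. \<Prod>t\<in>short_words M k. P (s v (m # t))" "{1..M}" R]
    by (simp only: K_def prod_short_words_Suc prod.distrib subtree_def case_prod_unfold)
  then have "(1 - \<delta>) * (1 - \<delta>) * (\<Prod>v\<in>R. \<Prod>t\<in>short_words M (Suc k). P (s v t))
      = ((1 - \<delta>) * (\<Prod>v\<in>R. P (s v []))) * ((1 - \<delta>) * K)" by simp
  also have "\<dots> \<le> sum ?w ?G * ((1 - \<delta>) * K)" using sumG \<delta> K by (intro mult_right_mono) auto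
  also have "\<dots> = (\<Sum>b\<in>?G. ?w b * ((1 - \<delta>) * K))" by (simp add: sum_distrib_right)
  also have "\<dots> \<le> (\<Sum>b\<in>?G. ?w b * measure Q (?shift b))"
    using low GA by (intro sum_mono mult_left_mono uniform_weight_nonneg) auto
  also have "\<dots> \<le> (\<Sum>b\<in>addresses M N V. ?w b * measure Q (?shift b))"
    using GA by (intro sum_mono2 finite_addresses mult_nonneg_nonneg uniform_weight_nonneg) auto
  also have "\<dots> = measure Q ?E" unfolding Q_def by (rule measure_address_shift(1)[OF V tree_event_sets, symmetric])
  finally show ?thesis .
qed

text \<open>For large \<open>V\<close> the buffers that are read by the short words are likely to be distinct, and
  then the labels of these words are independent. The induction needs several roots at once,
  because the subtrees of one root have \<open>M\<close> roots.\<close>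

lemma tree_event_prob:
  assumes "0 < \<epsilon>" "\<epsilon> \<le> 1"
  shows "\<exists>V0\<ge>1. \<forall>V\<ge>V0. \<forall>R s. R \<subseteq> {1..V} \<longrightarrow> card R = r \<longrightarrow> (\<forall>v\<in>R. s v \<in> code_trees M N) \<longrightarrow>
    (1 - \<epsilon>) * (\<Prod>v\<in>R. \<Prod>t\<in>short_words M k. P (s v t))
      \<le> measure (address_measure M N V (uniform_weight M P V)) (tree_event M N V k R s)"
  using assms
proof (induction k arbitrary: r \<epsilon>)
  case 0
  have "1 - \<epsilon> \<le> measure (address_measure M N V (uniform_weight M P V)) (tree_event M N V 0 R s)"
    if V: "V \<ge> 1" for V R s
  proof -
    interpret prob_space "address_measure M N V (uniform_weight M P V)"
      using uniform_weight_nonneg sum_uniform_weight[OF V] by (rule prob_space_address_measure)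
    have "tree_event M N V 0 R s = space (address_measure M N V (uniform_weight M P V))"
      by (simp add: tree_event_def)
    then show ?thesis using prob_space 0 by simp
  qed
  then show ?case by (intro exI[of _ 1]) simp
next
  case (Suc k)
  \<comment> \<open>The \<open>r\<close> roots have \<open>r * M\<close> subtrees. The threshold
    must be uniform in the set of buffers and in the prescribed trees, because both change with the
    first address.\<close>
  obtain V1 where V1: "V1 \<ge> 1" "\<forall>V\<ge>V1. \<forall>R s. R \<subseteq> {1..V} \<longrightarrow> card R = r * M \<longrightarrow> (\<forall>v\<in>R. s v \<in> code_trees M N) \<longrightarrow>
    (1 - \<epsilon> / 2) * (\<Prod>v\<in>R. \<Prod>t\<in>short_words M k. P (s v t))
      \<le> measure (address_measure M N V (uniform_weight M P V)) (tree_event M N V k R s)"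
    using Suc.IH[of "\<epsilon> / 2" "r * M"] Suc.prems by auto
  \<comment> \<open>From \<open>V2\<close> on, the probability of a collision is at most
    \<open>\<epsilon> / 2\<close>; the two losses of \<open>\<epsilon> / 2\<close> combine to at
    most \<open>\<epsilon>\<close>.\<close>
  obtain V2 :: nat where V2: "(real (r * M))\<^sup>2 / (\<epsilon> / 2) \<le> real V2" using real_arch_simple by blast
  show ?case
  proof (intro exI[of _ "max V1 V2"] conjI allI impI)
    fix V R s assume V: "max V1 V2 \<le> V" and R: "R \<subseteq> {1..V}" "card R = r" "\<forall>v\<in>R. s v \<in> code_trees M N"
    have V': "V \<ge> 1" using V V1(1) by simp
    have "(real (r * M))\<^sup>2 / (\<epsilon> / 2) \<le> real V" using V2 V by simp
    then have large: "(real (r * M))\<^sup>2 / real V \<le> \<epsilon> / 2" using V' Suc.prems by (simp add: field_simps)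
    have "(1 - \<epsilon> / 2) * (1 - \<epsilon> / 2) * (\<Prod>v\<in>R. \<Prod>t\<in>short_words M (Suc k). P (s v t))
      \<le> measure (address_measure M N V (uniform_weight M P V)) (tree_event M N V (Suc k) R s)"
      using R V' V1(2) V Suc.prems large by (intro tree_event_step) simp_all
    moreover have "(1 - \<epsilon>) * (\<Prod>v\<in>R. \<Prod>t\<in>short_words M (Suc k). P (s v t))
        \<le> (1 - \<epsilon> / 2) * (1 - \<epsilon> / 2) * (\<Prod>v\<in>R. \<Prod>t\<in>short_words M (Suc k). P (s v t))"
    proof (rule mult_right_mono)
      show "1 - \<epsilon> \<le> (1 - \<epsilon> / 2) * (1 - \<epsilon> / 2)" by (simp add: algebra_simps)
      show "0 \<le> (\<Prod>v\<in>R. \<Prod>t\<in>short_words M (Suc k). P (s v t))"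
        using P_tree_pos[OF R(3)[rule_format]] by (intro prod_nonneg less_imp_le)
    qed
    ultimately show "(1 - \<epsilon>) * (\<Prod>v\<in>R. \<Prod>t\<in>short_words M (Suc k). P (s v t))
      \<le> measure (address_measure M N V (uniform_weight M P V)) (tree_event M N V (Suc k) R s)" by linarith
  qed (use V1 in simp)
qed

end

subsection \<open>Convergence\<close>

text \<open>Up to \<open>\<delta>\<close> each integrand is a function \<open>H\<close> of a
  variable with finitely many values. As \<open>H\<close> is nonnegative, lower bounds for the
  probabilities under \<open>B\<close> suffice, and the defect is at most \<epsilon> * C because the
  probabilities under \<open>A\<close> sum to 1.\<close>

lemma integral_diff_le_of_discretization:
  fixes h :: "'a \<Rightarrow> real" and h' :: "'b \<Rightarrow> real" and H :: "'s \<Rightarrow> real"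
  assumes A: "prob_space A" and B: "prob_space B" and K: "finite K"
    and r: "\<And>x. x \<in> space A \<Longrightarrow> r x \<in> K" "\<And>s. s \<in> K \<Longrightarrow> {x\<in>space A. r x = s} \<in> sets A"
    and r': "\<And>x. x \<in> space B \<Longrightarrow> r' x \<in> K" "\<And>s. s \<in> K \<Longrightarrow> {x\<in>space B. r' x = s} \<in> sets B"
    and h: "integrable A h" "\<And>x. x \<in> space A \<Longrightarrow> h x \<le> H (r x) + \<delta>"
    and h': "integrable B h'" "\<And>x. x \<in> space B \<Longrightarrow> H (r' x) \<le> h' x + \<delta>"
    and H: "\<And>s. s \<in> K \<Longrightarrow> 0 \<le> H s" "\<And>s. s \<in> K \<Longrightarrow> H s \<le> C" and \<epsilon>: "0 \<le> \<epsilon>"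
    and le: "\<And>s. s \<in> K \<Longrightarrow> (1 - \<epsilon>) * measure A {x\<in>space A. r x = s} \<le> measure B {x\<in>space B. r' x = s}"
  shows "(\<integral>x. h x \<partial>A) - (\<integral>x. h' x \<partial>B) \<le> 2 * \<delta> + \<epsilon> * C"
proof -
  interpret A: prob_space A by fact
  interpret B: prob_space B by fact
  \<comment> \<open>Stated for a general space \<open>Q\<close>, as it is used for \<open>A\<close>
    and \<open>B\<close>; the choice \<open>G = 1\<close> yields the total mass.\<close>
  have disc: "integrable Q (\<lambda>x. G (q x)) \<and> (\<integral>x. G (q x) \<partial>Q) = (\<Sum>s\<in>K. G s * measure Q {x\<in>space Q. q x = s})"
    if Q: "prob_space Q" and q: "\<And>x. x \<in> space Q \<Longrightarrow> q x \<in> K" "\<And>s. s \<in> K \<Longrightarrow> {x\<in>space Q. q x = s} \<in> sets Q"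
    for Q :: "'z measure" and q and G :: "'s \<Rightarrow> real"
  proof -
    interpret Q: prob_space Q by fact
    have eq: "G (q x) = (\<Sum>s\<in>K. G s * indicator {x\<in>space Q. q x = s} x)" if x: "x \<in> space Q" for x
    proof -
      have "(\<Sum>s\<in>K. G s * indicator {x\<in>space Q. q x = s} x) = (\<Sum>s\<in>K. if s = q x then G s else 0)"
        using x by (intro sum.cong) (auto simp: indicator_def)
      then show ?thesis using q(1)[OF x] K by simp
    qed
    have int: "integrable Q (\<lambda>x. G s * indicator {x\<in>space Q. q x = s} x)" if "s \<in> K" for s
      using q(2)[OF that] by (intro integrable_mult_right) (simp add: Q.emeasure_eq_measure)
    have "integrable Q (\<lambda>x. G (q x)) \<longleftrightarrow> integrable Q (\<lambda>x. \<Sum>s\<in>K. G s * indicator {x\<in>space Q. q x = s} x)"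
      using eq by (intro Bochner_Integration.integrable_cong) auto
    moreover have "(\<integral>x. G (q x) \<partial>Q) = (\<integral>x. (\<Sum>s\<in>K. G s * indicator {x\<in>space Q. q x = s} x) \<partial>Q)"
      using eq by (intro Bochner_Integration.integral_cong) auto
    moreover have "(\<integral>x. (\<Sum>s\<in>K. G s * indicator {x\<in>space Q. q x = s} x) \<partial>Q)
        = (\<Sum>s\<in>K. G s * measure Q {x\<in>space Q. q x = s})"
      using int q(2) by (subst Bochner_Integration.integral_sum) (auto intro!: sum.cong simp: Int_absorb2)
    ultimately show ?thesis using int by (simp add: Bochner_Integration.integrable_sum)
  qed
  have dA: "integrable A (\<lambda>x. H (r x))" "(\<integral>x. H (r x) \<partial>A) = (\<Sum>s\<in>K. H s * measure A {x\<in>space A. r x = s})"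
    using disc[OF A r, of H] by simp_all
  have dB: "integrable B (\<lambda>x. H (r' x))" "(\<integral>x. H (r' x) \<partial>B) = (\<Sum>s\<in>K. H s * measure B {x\<in>space B. r' x = s})"
    using disc[OF B r', of H] by simp_all
  have 1: "(\<Sum>s\<in>K. measure A {x\<in>space A. r x = s}) = 1"
    using disc[OF A r, of "\<lambda>_. 1"] A.prob_space by simp
  have "(\<integral>x. h x \<partial>A) \<le> (\<integral>x. H (r x) + \<delta> \<partial>A)" using h dA by (intro integral_mono) auto
  then have hA: "(\<integral>x. h x \<partial>A) \<le> (\<Sum>s\<in>K. H s * measure A {x\<in>space A. r x = s}) + \<delta>"
    using dA A.prob_space by simp
  have "(\<integral>x. H (r' x) \<partial>B) \<le> (\<integral>x. h' x + \<delta> \<partial>B)" using h' dB by (intro integral_mono) auto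
  then have hB: "(\<Sum>s\<in>K. H s * measure B {x\<in>space B. r' x = s}) \<le> (\<integral>x. h' x \<partial>B) + \<delta>"
    using dB h' B.prob_space by simp
  have "(\<Sum>s\<in>K. H s * measure A {x\<in>space A. r x = s}) - (\<Sum>s\<in>K. H s * measure B {x\<in>space B. r' x = s})
      = (\<Sum>s\<in>K. H s * (measure A {x\<in>space A. r x = s} - measure B {x\<in>space B. r' x = s}))"
    by (simp add: sum_subtractf right_diff_distrib)
  also have "\<dots> \<le> (\<Sum>s\<in>K. C * (\<epsilon> * measure A {x\<in>space A. r x = s}))"
  proof (intro sum_mono)
    fix s assume s: "s \<in> K"
    have "H s * (measure A {x\<in>space A. r x = s} - measure B {x\<in>space B. r' x = s})
        \<le> H s * (\<epsilon> * measure A {x\<in>space A. r x = s})"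
      using le[OF s] H(1)[OF s] by (intro mult_left_mono) (simp_all add: algebra_simps)
    also have "\<dots> \<le> C * (\<epsilon> * measure A {x\<in>space A. r x = s})"
      using H(2)[OF s] \<epsilon> by (intro mult_right_mono) simp_all
    finally show "H s * (measure A {x\<in>space A. r x = s} - measure B {x\<in>space B. r' x = s})
        \<le> C * (\<epsilon> * measure A {x\<in>space A. r x = s})" .
  qed
  also have "\<dots> = C * \<epsilon> * (\<Sum>s\<in>K. measure A {x\<in>space A. r x = s})" by (simp add: sum_distrib_left mult.assoc)
  finally show ?thesis using hA hB 1 by (simp add: mult.commute)
qed

text \<open>A representative code tree for each pattern of labels on the short words, so that
  \<open>F\<close> can be evaluated at the pattern. The label 1 elsewhere is an arbitrary admissible
  one.\<close>

definition tree_extension :: "nat \<Rightarrow> nat \<Rightarrow> (nat list \<Rightarrow> nat) \<Rightarrow> nat list \<Rightarrow> nat" where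
  "tree_extension M k s = (\<lambda>t\<in>lists {1..M}. if t \<in> short_words M k then s t else 1)"

lemma tree_extension_eq: "t \<in> short_words M k \<Longrightarrow> tree_extension M k s t = s t"
  using subsetD[OF short_words_subset] by (simp add: tree_extension_def)

lemma tree_extension_in:
  assumes "s \<in> short_words M k \<rightarrow>\<^sub>E {1..N}" "N \<ge> 1"
  shows "tree_extension M k s \<in> code_trees M N"
  unfolding tree_extension_def code_trees_def
proof (intro restrict_PiE_iff[THEN iffD2] ballI)
  fix t show "(if t \<in> short_words M k then s t else 1) \<in> {1..N}"
    using PiE_mem[OF assms(1), of t] assms(2) by simp
qed

section \<open>The cylinder probabilities of random code trees\<close>

context label_weights
begin

lemma prob_space_label: "prob_space (point_measure {1..N} (\<lambda>n. ennreal (P n)))"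
  using P_pos P_sum sum_ennreal[of "{1..N}" P]
  by (intro prob_space_point_measure) (simp_all add: less_imp_le)

lemma prob_space_code_tree_measure: "prob_space (code_tree_measure M N P)"
  unfolding code_tree_measure_def by (intro prob_space_PiM prob_space_label)

lemma space_code_tree_measure: "space (code_tree_measure M N P) = code_trees M N"
  by (simp add: code_tree_measure_def space_PiM space_point_measure code_trees_def)

lemma measure_code_tree_cylinder:
  assumes s: "s \<in> short_words M k \<rightarrow>\<^sub>E {1..N}"
  shows "{\<sigma>\<in>code_trees M N. restrict \<sigma> (short_words M k) = s} \<in> sets (code_tree_measure M N P)"
    and "measure (code_tree_measure M N P) {\<sigma>\<in>code_trees M N. restrict \<sigma> (short_words M k) = s}
      = (\<Prod>t\<in>short_words M k. P (s t))"
proof -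
  let ?M = "\<lambda>_::nat list. point_measure {1..N} (\<lambda>n. ennreal (P n))" and ?J = "short_words M k"
  have sN: "s t \<in> {1..N}" if "t \<in> ?J" for t using s that by (rule PiE_mem)
  have sing: "(\<Pi>\<^sub>E t\<in>?J. {s t}) = {s}" using PiE_singleton[of s ?J] s by (simp add: PiE_iff)
  have eq: "{\<sigma>\<in>code_trees M N. restrict \<sigma> ?J = s} = prod_emb (lists {1..M}) ?M ?J (\<Pi>\<^sub>E t\<in>?J. {s t})"
    unfolding sing by (auto simp: prod_emb_def code_trees_def space_point_measure)
  show "{\<sigma>\<in>code_trees M N. restrict \<sigma> ?J = s} \<in> sets (code_tree_measure M N P)"
    unfolding eq unfolding code_tree_measure_def
    using sN by (intro sets_PiM_I short_words_subset finite_short_words) (simp add: sets_point_measure)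
  have "emeasure (code_tree_measure M N P) {\<sigma>\<in>code_trees M N. restrict \<sigma> ?J = s}
      = (\<Prod>t\<in>?J. emeasure (?M t) {s t})"
    unfolding eq unfolding code_tree_measure_def
    using sN by (intro emeasure_PiM_emb prob_space_label short_words_subset finite_short_words)
      (simp add: sets_point_measure)
  also have "\<dots> = (\<Prod>t\<in>?J. ennreal (P (s t)))"
    using sN by (intro prod.cong refl) (subst emeasure_point_measure_finite, simp_all)
  also have "\<dots> = ennreal (\<Prod>t\<in>?J. P (s t))"
    using P_pos[OF sN] by (intro prod_ennreal less_imp_le)
  finally show "measure (code_tree_measure M N P) {\<sigma>\<in>code_trees M N. restrict \<sigma> ?J = s}
      = (\<Prod>t\<in>?J. P (s t))"
    using P_pos[OF sN] by (simp add: measure_def prod_nonneg less_imp_le)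
qed

end

section \<open>The limits of the sets and of the distributions\<close>

locale random_superIFS = superIFS X d D M N f l p + label_weights M N P
  for X :: "'a set" and d D M N f l p P
begin

text \<open>The trees of buffers are code trees, so \<open>V\<close>-variable measures are fractal
  measures and one inclusion is exact. For the approximation in the other direction it is enough to
  realise the short words of a given tree.\<close>

lemma fractal_sets_limit:
  "limitin (Metric_space.mtopology (hyperspace \<P> MK) (hausdorff_dist \<P> MK))
    (\<lambda>V. V_fractal_measures X d M N f p V) (fractal_measures X d M N f p) sequentially"
proof -
  interpret PP: bounded_metric \<P> MK D by (rule bounded_metric_MK)
  interpret HH: Metric_space "hyperspace \<P> MK" "hausdorff_dist \<P> MK" by (rule PP.Metric_space_HD)
  show ?thesis
    unfolding HH.limit_metric_sequentially
  proof (intro conjI allI impI)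
    show "fractal_measures X d M N f p \<in> hyperspace \<P> MK" by (rule fractal_measures_hyperspace)
    fix e :: real assume "e > 0"
    then obtain k where k: "l ^ k * D < e" using power_bound_less[of l e] l by auto
    \<comment> \<open>Any \<epsilon> below 1 would do: only positivity of the lower bound
      matters.\<close>
    have half: "0 < (1/2::real)" "1/2 \<le> (1::real)" by simp_all
    obtain V0 where V0: "V0 \<ge> 1" "\<forall>V\<ge>V0. \<forall>R s. R \<subseteq> {1..V} \<longrightarrow> card R = 1 \<longrightarrow> (\<forall>v\<in>R. s v \<in> code_trees M N) \<longrightarrow>
        (1 - 1/2) * (\<Prod>v\<in>R. \<Prod>t\<in>short_words M k. P (s v t))
          \<le> measure (address_measure M N V (uniform_weight M P V)) (tree_event M N V k R s)"
      using tree_event_prob[OF half, of 1 k] by (elim exE conjE)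
    show "\<exists>K. \<forall>V\<ge>K. V_fractal_measures X d M N f p V \<in> hyperspace \<P> MK \<and>
        hausdorff_dist \<P> MK (V_fractal_measures X d M N f p V) (fractal_measures X d M N f p) < e"
    proof (intro exI[of _ V0] allI impI conjI)
      fix V assume "V \<ge> V0"
      then have V: "V \<ge> 1" using V0(1) by simp
      show HV: "V_fractal_measures X d M N f p V \<in> hyperspace \<P> MK" by (rule V_fractal_measures_hyperspace[OF V])
      have 1: "1 \<in> {1..V}" using V by simp
      have "hausdorff_dist \<P> MK (V_fractal_measures X d M N f p V) (fractal_measures X d M N f p) \<le> l ^ k * D"
      proof (rule PP.HD_le[OF HV fractal_measures_hyperspace])
        fix \<mu> assume "\<mu> \<in> V_fractal_measures X d M N f p V"
        then obtain a where a: "a \<in> address_seqs M N V" "\<mu> = F (vtree M a 1)"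
          unfolding V_fractal_measures_eq[OF V] by blast
        have "\<mu> \<in> fractal_measures X d M N f p"
          unfolding fractal_measures_def a(2) by (intro imageI vtree_in[OF a(1) 1])
        moreover have "MK \<mu> \<mu> \<le> l ^ k * D"
          unfolding a(2) by (intro MK_F_le vtree_in[OF a(1) 1] refl)
        ultimately show "\<exists>\<nu>\<in>fractal_measures X d M N f p. MK \<mu> \<nu> \<le> l ^ k * D" by blast
      next
        fix \<mu> assume "\<mu> \<in> fractal_measures X d M N f p"
        then obtain \<sigma> where \<sigma>: "\<sigma> \<in> code_trees M N" "\<mu> = F \<sigma>" unfolding fractal_measures_def by blast
        have "0 < (1 - 1/2) * (\<Prod>v\<in>{1::nat}. \<Prod>t\<in>short_words M k. P (\<sigma> t))"
          using P_tree_pos[OF \<sigma>(1), of k] by simp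
        also have "\<dots> \<le> measure (address_measure M N V (uniform_weight M P V)) (tree_event M N V k {1} (\<lambda>_. \<sigma>))"
          using V0(2)[rule_format, OF \<open>V \<ge> V0\<close>, of "{1}" "\<lambda>_. \<sigma>"] 1 \<sigma>(1) by simp
        \<comment> \<open>Existence from positive probability: some address sequence shows the
          labels of \<open>\<sigma>\<close> on the short words.\<close>
        finally have "tree_event M N V k {1} (\<lambda>_. \<sigma>) \<noteq> {}" by (metis measure_empty order_less_irrefl)
        then obtain a where a: "a \<in> address_seqs M N V" "\<forall>t\<in>short_words M k. vtree M a 1 t = \<sigma> t"
          unfolding tree_event_def by blast
        have "MK (F \<sigma>) (F (vtree M a 1)) \<le> l ^ k * D"
          using a(2) by (intro MK_F_le \<sigma>(1) vtree_in[OF a(1) 1]) simp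
        then show "\<exists>\<nu>\<in>V_fractal_measures X d M N f p V. MK \<mu> \<nu> \<le> l ^ k * D"
          unfolding V_fractal_measures_eq[OF V] \<sigma>(2) using a(1) by blast
      qed
      then show "hausdorff_dist \<P> MK (V_fractal_measures X d M N f p V) (fractal_measures X d M N f p) < e"
        using k by simp
    qed
  qed
qed

lemma F_measurable: "F \<in> measurable (code_tree_measure M N P) (borel_on \<P> MK)"
proof -
  interpret PP: bounded_metric \<P> MK D by (rule bounded_metric_MK)
  show ?thesis unfolding code_tree_measure_def
    using F_cyl_continuous
    by (intro PP.cyl_continuous_measurable[OF _ countable_words]) (simp_all add: sets_point_measure)
qed

text \<open>The finite variable is the pattern of labels on the short words. It determines
  \<open>F\<close> up to \<open>l ^ k * D\<close>, which enters once on each side; a test function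
  oscillates by at most \<open>D\<close>.\<close>

lemma fractal_distributions_close:
  fixes k :: nat
  assumes V: "V \<ge> 1" and \<epsilon>: "0 \<le> \<epsilon>"
    and le: "\<And>s. s \<in> code_trees M N \<Longrightarrow> (1 - \<epsilon>) * (\<Prod>t\<in>short_words M k. P (s t))
      \<le> measure (address_measure M N V (uniform_weight M P V)) (tree_event M N V k {1} (\<lambda>_. s))"
  shows "MK_dist \<P> MK (fractal_distribution X d M N f p P)
      (distr (address_measure M N V (uniform_weight M P V)) (borel_on \<P> MK) (\<lambda>a. F (vtree M a 1)))
    \<le> 2 * (l ^ k * D) + \<epsilon> * (2 * D)"
proof -
  interpret PP: bounded_metric \<P> MK D by (rule bounded_metric_MK)
  let ?A = "code_tree_measure M N P" and ?B = "address_measure M N V (uniform_weight M P V)"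
  let ?h' = "\<lambda>a. F (vtree M a 1)"
  have A: "prob_space ?A" by (rule prob_space_code_tree_measure)
  have B: "prob_space ?B"
    using uniform_weight_nonneg sum_uniform_weight[OF V] by (rule prob_space_address_measure)
  interpret A: prob_space ?A by (rule A)
  interpret B: prob_space ?B by (rule B)
  have Fm': "?h' \<in> measurable ?B (borel_on \<P> MK)"
    using vtree_F_cyl_continuous[OF V] by (rule PP.address_measurable)
  have dA: "distr ?A (borel_on \<P> MK) F \<in> prob_measures \<P> MK" using A F_measurable by (rule PP.distr_prob_measures)
  have dB: "distr ?B (borel_on \<P> MK) ?h' \<in> prob_measures \<P> MK" using B Fm' by (rule PP.distr_prob_measures)
  have 1: "1 \<in> {1..V}" using V by simp
  define ext where "ext = tree_extension M k"
  let ?K = "short_words M k \<rightarrow>\<^sub>E {1..N}"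
  have ext: "ext s \<in> \<Omega>" if "s \<in> ?K" for s unfolding ext_def using that N1 by (rule tree_extension_in)
  have ext_eq: "ext s t = s t" if "t \<in> short_words M k" for s t
    unfolding ext_def using that by (rule tree_extension_eq)
  have restr: "restrict \<sigma> (short_words M k) \<in> ?K" if "\<sigma> \<in> \<Omega>" for \<sigma>
    using tree_label[OF that] short_words_subset by (intro restrict_PiE_iff[THEN iffD2] ballI) blast
  have close: "MK (F \<sigma>) (F (ext (restrict \<sigma> (short_words M k)))) \<le> l ^ k * D" if "\<sigma> \<in> \<Omega>" for \<sigma>
    using that by (intro MK_F_le ext restr) (simp_all add: ext_eq)
  show ?thesis
    unfolding fractal_distribution_def
  proof (rule PP.MK_le[OF dA dB])
    fix g assume g: "PP.Lip 1 g"
    have gm: "g \<in> borel_measurable (borel_on \<P> MK)" using g by (rule PP.Lip_measurable)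
    have "(\<lambda>t\<in>lists {1..M}. 1) \<in> \<Omega>"
      using N1 unfolding code_trees_def by (intro restrict_PiE_iff[THEN iffD2]) simp
    then obtain \<sigma>0 where \<sigma>0: "\<sigma>0 \<in> \<Omega>" ..
    \<comment> \<open>Subtracting \<open>c\<close> puts \<open>H\<close> between 0 and
      \<open>2 * D\<close>, as the one-sided comparison requires. The constant cancels because both
      laws have mass 1.\<close>
    define c where "c = g (F \<sigma>0) - D"
    define H where "H s = g (F (ext s)) - c" for s
    have gF: "\<bar>g (F \<sigma>) - g (F \<tau>)\<bar> \<le> MK (F \<sigma>) (F \<tau>)" if "\<sigma> \<in> \<Omega>" "\<tau> \<in> \<Omega>" for \<sigma> \<tau>
      using PP.LipD[OF g F_in[OF that(1)] F_in[OF that(2)]] by simp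
    have gF_close: "\<bar>g (F \<sigma>) - g (F (ext (restrict \<sigma> (short_words M k))))\<bar> \<le> l ^ k * D" if "\<sigma> \<in> \<Omega>" for \<sigma>
      using gF[OF that ext[OF restr[OF that]]] close[OF that] by simp
    have intA: "integrable ?A (\<lambda>\<sigma>. g (F \<sigma>))"
      by (rule integrable_distr[OF F_measurable PP.Lip_integrable[OF g _ dA]]) simp
    have intB: "integrable ?B (\<lambda>a. g (?h' a))"
      by (rule integrable_distr[OF Fm' PP.Lip_integrable[OF g _ dB]]) simp
    have "(\<integral>\<sigma>. g (F \<sigma>) - c \<partial>?A) - (\<integral>a. g (?h' a) - c \<partial>?B) \<le> 2 * (l ^ k * D) + \<epsilon> * (2 * D)"
    proof (rule integral_diff_le_of_discretization[OF A B, where K = ?K and H = H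
          and r = "\<lambda>\<sigma>. restrict \<sigma> (short_words M k)" and r' = "\<lambda>a. restrict (vtree M a 1) (short_words M k)"])
      show "finite ?K" by (intro finite_PiE finite_short_words) simp
      show "restrict \<sigma> (short_words M k) \<in> ?K" if "\<sigma> \<in> space ?A" for \<sigma>
        using that restr by (simp add: space_code_tree_measure)
      show "{\<sigma>\<in>space ?A. restrict \<sigma> (short_words M k) = s} \<in> sets ?A" if "s \<in> ?K" for s
        unfolding space_code_tree_measure by (rule measure_code_tree_cylinder(1)[OF that])
      have ev: "{a\<in>space ?B. restrict (vtree M a 1) (short_words M k) = s} = tree_event M N V k {1} (\<lambda>_. ext s)"
        if s: "s \<in> ?K" for s
      proof -
        have "restrict \<tau> (short_words M k) = s \<longleftrightarrow> (\<forall>t\<in>short_words M k. \<tau> t = ext s t)" for \<tau>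
          using s by (auto simp: fun_eq_iff ext_eq PiE_iff extensional_def)
        then show ?thesis unfolding tree_event_def by simp
      qed
      show "{a\<in>space ?B. restrict (vtree M a 1) (short_words M k) = s} \<in> sets ?B" if "s \<in> ?K" for s
        unfolding ev[OF that] by (rule tree_event_sets)
      show "restrict (vtree M a 1) (short_words M k) \<in> ?K" if "a \<in> space ?B" for a
        using that by (intro restr vtree_in[OF _ 1]) simp
      show "integrable ?A (\<lambda>\<sigma>. g (F \<sigma>) - c)" "integrable ?B (\<lambda>a. g (?h' a) - c)"
        using intA intB by simp_all
      show "g (F \<sigma>) - c \<le> H (restrict \<sigma> (short_words M k)) + l ^ k * D" if "\<sigma> \<in> space ?A" for \<sigma>
        using gF_close[of \<sigma>] that by (simp add: space_code_tree_measure H_def)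
      show "H (restrict (vtree M a 1) (short_words M k)) \<le> g (?h' a) - c + l ^ k * D" if "a \<in> space ?B" for a
        using gF_close[OF vtree_in[OF _ 1], of a] that by (simp add: H_def abs_le_iff)
      fix s assume s: "s \<in> ?K"
      have "\<bar>g (F (ext s)) - g (F \<sigma>0)\<bar> \<le> D"
        using gF[OF ext[OF s] \<sigma>0] MK_bounded[OF F_in[OF ext[OF s]] F_in[OF \<sigma>0]] by simp
      then show "0 \<le> H s" "H s \<le> 2 * D" by (simp_all add: H_def c_def abs_le_iff)
      have "(\<Prod>t\<in>short_words M k. P (ext s t)) = (\<Prod>t\<in>short_words M k. P (s t))"
        by (intro prod.cong refl) (simp add: ext_eq)
      then show "(1 - \<epsilon>) * measure ?A {\<sigma>\<in>space ?A. restrict \<sigma> (short_words M k) = s}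
        \<le> measure ?B {a\<in>space ?B. restrict (vtree M a 1) (short_words M k) = s}"
        using le[OF ext[OF s]] unfolding ev[OF s] space_code_tree_measure measure_code_tree_cylinder(2)[OF s] by simp
    qed (rule \<epsilon>)
    then show "(\<integral>x. g x \<partial>distr ?A (borel_on \<P> MK) F) - (\<integral>x. g x \<partial>distr ?B (borel_on \<P> MK) ?h')
        \<le> 2 * (l ^ k * D) + \<epsilon> * (2 * D)"
      using intA intB A.prob_space B.prob_space
        integral_distr[OF F_measurable gm] integral_distr[OF Fm' gm] by simp
  qed
qed

lemma fractal_distributions_limit:
  "limitin (Metric_space.mtopology (prob_measures \<P> MK) (MK_dist \<P> MK))
    (\<lambda>V. distr (address_measure M N V (uniform_weight M P V)) (borel_on \<P> MK) (\<lambda>a. F (vtree M a 1)))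
    (fractal_distribution X d M N f p P) sequentially"
proof -
  interpret PP: bounded_metric \<P> MK D by (rule bounded_metric_MK)
  interpret PPP: bounded_metric "prob_measures \<P> MK" "MK_dist \<P> MK" D by (rule PP.bounded_metric_MK)
  let ?d = "\<lambda>V. distr (address_measure M N V (uniform_weight M P V)) (borel_on \<P> MK) (\<lambda>a. F (vtree M a 1))"
  show ?thesis
    unfolding PPP.limit_metric_sequentially
  proof (intro conjI allI impI)
    show "fractal_distribution X d M N f p P \<in> prob_measures \<P> MK"
      unfolding fractal_distribution_def
      using prob_space_code_tree_measure F_measurable by (rule PP.distr_prob_measures)
    fix e :: real assume e: "e > 0"
    obtain k where k: "l ^ k * D < e / 4" using power_bound_less[of l "e / 4"] l e by auto
    \<comment> \<open>Each of the two error terms is to be at most \<open>e / 2\<close>;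
      \<open>D + 1\<close> keeps the denominator positive when \<open>D\<close> is 0.\<close>
    define \<epsilon> where "\<epsilon> = min 1 (e / (4 * (D + 1)))"
    have D1: "D + 1 > 0" using D_nonneg by simp
    have \<epsilon>: "0 < \<epsilon>" "\<epsilon> \<le> 1" using e D1 by (simp_all add: \<epsilon>_def)
    have "\<epsilon> * (2 * D) \<le> e / (4 * (D + 1)) * (2 * (D + 1))"
      using \<epsilon> D_nonneg e by (intro mult_mono) (simp_all add: \<epsilon>_def)
    also have "\<dots> = e / 2" using D1 by (simp add: field_simps)
    finally have \<epsilon>D: "\<epsilon> * (2 * D) \<le> e / 2" .
    obtain V0 where V0: "V0 \<ge> 1" "\<forall>V\<ge>V0. \<forall>R s. R \<subseteq> {1..V} \<longrightarrow> card R = 1 \<longrightarrow> (\<forall>v\<in>R. s v \<in> code_trees M N) \<longrightarrow>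
        (1 - \<epsilon>) * (\<Prod>v\<in>R. \<Prod>t\<in>short_words M k. P (s v t))
          \<le> measure (address_measure M N V (uniform_weight M P V)) (tree_event M N V k R s)"
      using tree_event_prob[OF \<epsilon>, of 1 k] by (elim exE conjE)
    show "\<exists>K. \<forall>V\<ge>K. ?d V \<in> prob_measures \<P> MK \<and> MK_dist \<P> MK (?d V) (fractal_distribution X d M N f p P) < e"
    proof (intro exI[of _ V0] allI impI conjI)
      fix V assume VV0: "V \<ge> V0"
      then have V: "V \<ge> 1" using V0(1) by simp
      show "?d V \<in> prob_measures \<P> MK"
        using prob_space_address_measure[OF uniform_weight_nonneg sum_uniform_weight[OF V]]
          PP.address_measurable[OF vtree_F_cyl_continuous[OF V]] by (rule PP.distr_prob_measures)
      have "MK_dist \<P> MK (fractal_distribution X d M N f p P) (?d V) \<le> 2 * (l ^ k * D) + \<epsilon> * (2 * D)"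
      proof (rule fractal_distributions_close[OF V])
        fix s assume "s \<in> code_trees M N"
        then show "(1 - \<epsilon>) * (\<Prod>t\<in>short_words M k. P (s t))
            \<le> measure (address_measure M N V (uniform_weight M P V)) (tree_event M N V k {1} (\<lambda>_. s))"
          using V0(2)[rule_format, OF VV0, of "{1}" "\<lambda>_. s"] V by simp
      qed (use \<epsilon> in simp)
      then show "MK_dist \<P> MK (?d V) (fractal_distribution X d M N f p P) < e"
        using k \<epsilon>D PP.MK_commute[of "?d V"] by simp
    qed
  qed
qed

end

lemma address_measure_cong:
  assumes "\<And>b. b \<in> addresses M N V \<Longrightarrow> w b = w' b"
  shows "address_measure M N V w = address_measure M N V w'"
  unfolding address_measure_def point_measure_def using assms
  by (intro PiM_cong refl density_cong) (auto simp: AE_count_space)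

theorem theorem24:
  fixes X :: "'a set" and d :: "'a \<Rightarrow> 'a \<Rightarrow> real"
    and M N :: nat
    and f :: "nat \<Rightarrow> nat \<Rightarrow> 'a \<Rightarrow> 'a" and l :: real
    and p :: "nat \<Rightarrow> nat \<Rightarrow> real" and P :: "nat \<Rightarrow> real"
    and w :: "nat \<Rightarrow> (nat \<Rightarrow> nat \<times> (nat \<Rightarrow> nat)) \<Rightarrow> real"
  assumes "Metric_space X d" and "compact_space (Metric_space.mtopology X d)" and "X \<noteq> {}"
    and "M \<ge> 1" and "N \<ge> 1"
    and "0 \<le> l" and "l < 1"
    and "\<And>n m. n \<in> {1..N} \<Longrightarrow> m \<in> {1..M} \<Longrightarrow> f n m \<in> X \<rightarrow> X"
    and "\<And>n m x y. n \<in> {1..N} \<Longrightarrow> m \<in> {1..M} \<Longrightarrow> x \<in> X \<Longrightarrow> y \<in> X \<Longrightarrow>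
           d (f n m x) (f n m y) \<le> l * d x y"
    and "\<And>n m. n \<in> {1..N} \<Longrightarrow> m \<in> {1..M} \<Longrightarrow> p n m \<ge> 0"
    and "\<And>n. n \<in> {1..N} \<Longrightarrow> (\<Sum>m\<in>{1..M}. p n m) = 1"
    and "\<And>n. n \<in> {1..N} \<Longrightarrow> P n > 0"
    and "(\<Sum>n\<in>{1..N}. P n) = 1"
    and "\<And>V a. V \<ge> 1 \<Longrightarrow> a \<in> addresses M N V \<Longrightarrow> w V a \<ge> 0"
    and "\<And>V. V \<ge> 1 \<Longrightarrow> (\<Sum>a\<in>addresses M N V. w V a) = 1"
  shows "limitin
           (Metric_space.mtopology
              (hyperspace (prob_measures X d) (MK_dist X d))
              (hausdorff_dist (prob_measures X d) (MK_dist X d)))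
           (\<lambda>V. V_fractal_measures X d M N f p V) (fractal_measures X d M N f p) sequentially
       \<and> ((\<forall>V\<ge>1. \<forall>a\<in>addresses M N V.
             w V a = (\<Prod>v\<in>{1..V}. P (fst (a v))) / real V ^ (M * V)) \<longrightarrow>
          limitin
            (Metric_space.mtopology
               (prob_measures (prob_measures X d) (MK_dist X d))
               (MK_dist (prob_measures X d) (MK_dist X d)))
            (\<lambda>V. V_fractal_distribution X d M N f p V (w V)) (fractal_distribution X d M N f p P)
            sequentially)"
proof -
  interpret X: Metric_space X d by fact
  have "X.mbounded X"
    using assms(2) X.compactin_imp_mbounded by (simp add: compact_space_def)
  then obtain D0 where D0: "\<And>x y. x \<in> X \<Longrightarrow> y \<in> X \<Longrightarrow> d x y \<le> D0"
    unfolding X.mbounded_alt by blast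
  \<comment> \<open>a positive contraction constant, so that rescaled test functions can be divided by it\<close>
  define l' where "l' = max l (1/2)"
  have l': "0 < l'" "l' < 1" "l \<le> l'" using assms(7) by (simp_all add: l'_def)
  interpret random_superIFS X d "max D0 0" M N f l' p P
  proof unfold_locales
    show "d x y \<le> max D0 0" if "x \<in> X" "y \<in> X" for x y using D0[OF that] by simp
    show "d (f n m x) (f n m y) \<le> l' * d x y"
      if "n \<in> {1..N}" "m \<in> {1..M}" "x \<in> X" "y \<in> X" for n m x y
      using assms(9)[OF that] mult_right_mono[OF l'(3) X.nonneg[of x y]] by simp
  qed (use assms l' in simp_all)
  show ?thesis
  proof (intro conjI impI)
    assume w: "\<forall>V\<ge>1. \<forall>a\<in>addresses M N V. w V a = (\<Prod>v\<in>{1..V}. P (fst (a v))) / real V ^ (M * V)"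
    have eq: "V_fractal_distribution X d M N f p V (w V) =
        distr (address_measure M N V (uniform_weight M P V)) (borel_on \<P> MK) (\<lambda>a. F (vtree M a 1))"
      if V: "V \<ge> 1" for V
    proof -
      have "address_measure M N V (w V) = address_measure M N V (uniform_weight M P V)"
        using w V by (intro address_measure_cong) (simp add: uniform_weight_def)
      then show ?thesis
        using V_fractal_distribution_eq[OF V, of "w V"] assms(14,15) V by simp
    qed
    show "limitin (Metric_space.mtopology (prob_measures \<P> MK) (MK_dist \<P> MK))
        (\<lambda>V. V_fractal_distribution X d M N f p V (w V)) (fractal_distribution X d M N f p P) sequentially"
      \<comment> \<open>The identification of the distributions is available from
        \<open>V = 1\<close> on, which is enough for a limit.\<close>
      by (rule limitin_transform_eventually[OF _ fractal_distributions_limit])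
        (use eq in \<open>auto simp: eventually_sequentially intro!: exI[of _ 1]\<close>)
  qed (rule fractal_sets_limit)
qed

end
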